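(* Let $Y\to X$ be a semi-ikeo simplicial map between simplicial spaces. If $X$ is a decomposition space, then $Y$ is also a decomposition space.
   Context: A simplicial space is a functor $X:\Delta^{\mathrm{op}}\to\mathcal{S}$ into the $\infty$-category of spaces ($\infty$-groupoids); pullbacks are homotopy pullbacks. A map $a:[m]\to[n]$ in $\Delta$ is active if $a(0)=0$ and $a(m)=n$, and inert if $a(i+1)=a(i)+1$ for $0\le i\le m-1$; every map factors uniquely as an active map followed by an inert map. $X$ is a decomposition space if it sends all pushout squares in $\Delta$ of an active map along an inert map to pullback squares. For $1\le i\le k$, $\rho_i:[1]\to[k]$ is the inert map with image $\{i-1,i\}$. For an active map $\alpha:[k]\to[n]$, write $[1]\to[n_i]\xrightarrow{\gamma^\alpha_i}[n]$ for the active-inert factorisation of $\alpha\circ\rho_i$, so $n_i=\alpha(i)-\alpha(i-1)$. A simplicial map $Y\to X$ is semi-ikeo if for every active injection $\alpha:[k]\to[n]$ with $k\neq 0$ and $n\neq0$, the square formed by $(\gamma^\alpha_1,\dots,\gamma^\alpha_k)^*:Y_n\to Y_{n_1}\times\cdots\times Y_{n_k}$, the analogous map $X_n\to X_{n_1}\times\cdots\times X_{n_k}$, and the vertical maps induced by $Y\to X$, is a pullback. *)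

theory Defs
  imports "HOL-Analysis.Analysis"
begin

record ('o, 'm) cat =
  Ob :: "'o set"
  Ar :: "'m set"
  Dom :: "'m \<Rightarrow> 'o"
  Cod :: "'m \<Rightarrow> 'o"
  Idt :: "'o \<Rightarrow> 'm"
  Cmp :: "'m \<Rightarrow> 'm \<Rightarrow> 'm"  (* Cmp C g f is "g after f" *)

definition opp_cat :: "('o, 'm) cat \<Rightarrow> ('o, 'm) cat" where
  "opp_cat C = \<lparr>Ob = Ob C, Ar = Ar C, Dom = Cod C, Cod = Dom C, Idt = Idt C,
     Cmp = (\<lambda>g f. Cmp C f g)\<rparr>"

definition prod_cat :: "('o, 'm) cat \<Rightarrow> ('p, 'k) cat \<Rightarrow> ('o \<times> 'p, 'm \<times> 'k) cat" where
  "prod_cat C D = \<lparr>Ob = Ob C \<times> Ob D, Ar = Ar C \<times> Ar D,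
     Dom = map_prod (Dom C) (Dom D), Cod = map_prod (Cod C) (Cod D),
     Idt = map_prod (Idt C) (Idt D),
     Cmp = (\<lambda>g f. (Cmp C (fst g) (fst f), Cmp D (snd g) (snd f)))\<rparr>"

text \<open>The poset \<open>False \<le> True\<close> regarded as a category; an arrow is a pair \<open>(e, e')\<close>
  with \<open>e \<le> e'\<close>.\<close>

definition walking_arrow :: "(bool, bool \<times> bool) cat" where
  "walking_arrow = \<lparr>Ob = UNIV, Ar = {(e, e'). e \<le> e'}, Dom = fst, Cod = snd,
     Idt = (\<lambda>e. (e, e)), Cmp = (\<lambda>g f. (fst f, snd g))\<rparr>"

definition arrow_in :: "('o, 'm) cat \<Rightarrow> 'm \<Rightarrow> 'o \<Rightarrow> 'o \<Rightarrow> bool" where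
  "arrow_in C f a b \<longleftrightarrow> f \<in> Ar C \<and> Dom C f = a \<and> Cod C f = b"

text \<open>The square with \<open>f : a \<rightarrow> b\<close>, \<open>g : a \<rightarrow> c\<close>, \<open>h : b \<rightarrow> d\<close>, \<open>k : c \<rightarrow> d\<close>.\<close>

definition pushout_square :: "('o, 'm) cat \<Rightarrow> 'm \<Rightarrow> 'm \<Rightarrow> 'm \<Rightarrow> 'm \<Rightarrow> bool" where
  "pushout_square C f g h k \<longleftrightarrow>
     f \<in> Ar C \<and> g \<in> Ar C \<and> Dom C f = Dom C g \<and>
     arrow_in C h (Cod C f) (Cod C h) \<and> arrow_in C k (Cod C g) (Cod C h) \<and>
     Cmp C h f = Cmp C k g \<and>
     (\<forall>e\<in>Ob C. \<forall>u v. arrow_in C u (Cod C f) e \<and> arrow_in C v (Cod C g) e \<and>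
        Cmp C u f = Cmp C v g \<longrightarrow>
        (\<exists>!w. arrow_in C w (Cod C h) e \<and> Cmp C w h = u \<and> Cmp C w k = v))"

text \<open>The object \<open>n\<close> stands for \<open>[n] = {0, \<dots>, n}\<close>. The underlying function of an arrow is
  required to be extensional, so that equality of arrows is equality of monotone maps.\<close>

datatype darrow = Arr (src: nat) (fn: "nat \<Rightarrow> nat") (tgt: nat)

definition delta_cat :: "(nat, darrow) cat" where
  "delta_cat = \<lparr>Ob = UNIV,
     Ar = {a. fn a \<in> {..src a} \<rightarrow>\<^sub>E {..tgt a} \<and> mono_on {..src a} (fn a)},
     Dom = src, Cod = tgt, Idt = (\<lambda>n. Arr n (\<lambda>i\<in>{..n}. i) n),
     Cmp = (\<lambda>b a. Arr (src a) (compose {..src a} (fn b) (fn a)) (tgt b))\<rparr>"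

definition active :: "darrow \<Rightarrow> bool" where
  "active a \<longleftrightarrow> a \<in> Ar delta_cat \<and> fn a 0 = 0 \<and> fn a (src a) = tgt a"

definition inert :: "darrow \<Rightarrow> bool" where
  "inert a \<longleftrightarrow> a \<in> Ar delta_cat \<and> (\<forall>i<src a. fn a (i + 1) = fn a i + 1)"

definition inert_part :: "darrow \<Rightarrow> darrow" where
  "inert_part a = (THE g. inert g \<and>
     (\<exists>b. active b \<and> tgt b = src g \<and> Cmp delta_cat g b = a))"

definition rho :: "nat \<Rightarrow> nat \<Rightarrow> darrow" where
  "rho k i = Arr 1 (\<lambda>j\<in>{..1}. i - 1 + j) k"

definition gam :: "darrow \<Rightarrow> nat \<Rightarrow> darrow" where
  "gam a i = inert_part (Cmp delta_cat a (rho (src a) i))"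

definition disc :: "nat \<Rightarrow> (nat \<Rightarrow> real) topology" where
  "disc n = subtopology (Euclidean_space n) {x. (\<Sum>i<n. (x i)\<^sup>2) \<le> 1}"

definition open_disc :: "nat \<Rightarrow> (nat \<Rightarrow> real) set" where
  "open_disc n = {x \<in> topspace (disc n). (\<Sum>i<n. (x i)\<^sup>2) < 1}"

definition disc_boundary :: "nat \<Rightarrow> (nat \<Rightarrow> real) set" where
  "disc_boundary n = {x \<in> topspace (disc n). (\<Sum>i<n. (x i)\<^sup>2) = 1}"

text \<open>Intrinsic form of the definition of a CW complex (Hatcher, Algebraic Topology,
  Proposition A.2): \<open>cells\<close> is the set of characteristic maps, each paired with the dimension of
  its cell.\<close>

definition CW_complex :: "'a topology \<Rightarrow> bool" where
  "CW_complex X \<longleftrightarrow> Hausdorff_space X \<and>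
     (\<exists>cells :: (nat \<times> ((nat \<Rightarrow> real) \<Rightarrow> 'a)) set.
        (\<forall>(n, c)\<in>cells. continuous_map (disc n) X c \<and>
           homeomorphic_map (subtopology (disc n) (open_disc n))
             (subtopology X (c ` open_disc n)) c) \<and>
        pairwise (\<lambda>(n, c) (m, d). disjnt (c ` open_disc n) (d ` open_disc m)) cells \<and>
        (\<Union>(n, c)\<in>cells. c ` open_disc n) = topspace X \<and>
        (\<forall>(n, c)\<in>cells. \<exists>F\<subseteq>cells. finite F \<and> (\<forall>(m, d)\<in>F. m < n) \<and>
           c ` disc_boundary n \<subseteq> (\<Union>(m, d)\<in>F. d ` open_disc m)) \<and>
        (\<forall>S\<subseteq>topspace X. closedin X S \<longleftrightarrow>
           (\<forall>(n, c)\<in>cells. closedin X (S \<inter> c ` topspace (disc n)))))"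

definition homotopy_equivalence_map :: "'a topology \<Rightarrow> 'b topology \<Rightarrow> ('a \<Rightarrow> 'b) \<Rightarrow> bool" where
  "homotopy_equivalence_map X Y f \<longleftrightarrow> continuous_map X Y f \<and>
     (\<exists>g. continuous_map Y X g \<and>
        homotopic_with (\<lambda>_. True) X X (g \<circ> f) id \<and>
        homotopic_with (\<lambda>_. True) Y Y (f \<circ> g) id)"

text \<open>Continuous paths \<open>[0,1] \<rightarrow> Z\<close> with the compact-open topology.\<close>

definition path_space :: "'a topology \<Rightarrow> (real \<Rightarrow> 'a) topology" where
  "path_space Z = topology_generated_by
     {{w \<in> extensional {0..1}. continuous_map (top_of_set {0..1}) Z w \<and> w ` K \<subseteq> U} | K U.
        compact K \<and> K \<subseteq> {0..1} \<and> openin Z U}"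

definition hpb_space ::
  "'a topology \<Rightarrow> 'b topology \<Rightarrow> 'c topology \<Rightarrow> ('a \<Rightarrow> 'c) \<Rightarrow> ('b \<Rightarrow> 'c) \<Rightarrow>
   ('a \<times> 'b \<times> (real \<Rightarrow> 'c)) topology" where
  "hpb_space A B Z f g =
     subtopology (prod_topology A (prod_topology B (path_space Z)))
       {(a, b, w). w 0 = f a \<and> w 1 = g b}"

text \<open>\<open>homotopy_pullback P A B Z p q f g H\<close>: the square with sides \<open>p : P \<rightarrow> A\<close>, \<open>q : P \<rightarrow> B\<close>,
  \<open>f : A \<rightarrow> Z\<close>, \<open>g : B \<rightarrow> Z\<close>, commuting up to the specified homotopy \<open>H\<close> from \<open>f \<circ> p\<close> to
  \<open>g \<circ> q\<close>, is a homotopy pullback. The spaces occurring below are finite products of CW complexes; these,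
  and homotopy pullbacks of these, have the homotopy type of a CW complex (Milnor), so comparing
  by homotopy equivalence is the same as comparing by weak homotopy equivalence.\<close>

definition homotopy_pullback ::
  "'p topology \<Rightarrow> 'a topology \<Rightarrow> 'b topology \<Rightarrow> 'c topology \<Rightarrow> ('p \<Rightarrow> 'a) \<Rightarrow> ('p \<Rightarrow> 'b) \<Rightarrow>
   ('a \<Rightarrow> 'c) \<Rightarrow> ('b \<Rightarrow> 'c) \<Rightarrow> (real \<Rightarrow> 'p \<Rightarrow> 'c) \<Rightarrow> bool" where
  "homotopy_pullback P A B Z p q f g H \<longleftrightarrow>
     continuous_map P A p \<and> continuous_map P B q \<and>
     continuous_map A Z f \<and> continuous_map B Z g \<and>
     continuous_map (prod_topology (top_of_set {0..1}) P) Z (\<lambda>(s, x). H s x) \<and>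
     (\<forall>x\<in>topspace P. H 0 x = f (p x) \<and> H 1 x = g (q x)) \<and>
     homotopy_equivalence_map P (hpb_space A B Z f g) (\<lambda>x. (p x, q x, \<lambda>s\<in>{0..1}. H s x))"

text \<open>
  The infinity-category of spaces is taken to be the homotopy coherent nerve of the topologically
  enriched category of CW complexes, and a functor from an ordinary category \<open>C\<close> to it is a map
  of simplicial sets out of the nerve of \<open>C\<close>. Written out, such a functor is a homotopy coherent
  diagram in the sense of Vogt and Cordier-Porter: a space for every object and, for every string
  of composable arrows \<open>x\<^sub>0 \<rightarrow> \<dots> \<rightarrow> x\<^sub>n\<close> (listed in the order of application, \<open>n \<ge> 1\<close>), a
  family of maps from the space at \<open>x\<^sub>0\<close> to the space at \<open>x\<^sub>n\<close> parametrised by the cube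
  \<open>[0,1]\<^sup>n\<^sup>-\<^sup>1\<close>. The coordinate numbered \<open>j\<close> belongs to the intermediate object between the list
  entries \<open>j\<close> and \<open>j + 1\<close>: at \<open>0\<close> the two entries are composed in \<open>C\<close>, at \<open>1\<close> the diagram is
  composed out of the two halves of the string. Since the maps for \<open>x\<^sub>i \<rightarrow> \<dots> \<rightarrow> x\<^sub>j\<close> are those
  of the corresponding substring, this is exactly the datum of a compatible family of
  enriched functors out of the simplicial categories \<open>\<CC>[\<Delta>\<^sup>n]\<close>. An identity at an end of a
  string deletes the adjacent coordinate; an identity inside it merges the two adjacent ones
  by \<open>max\<close>, which is the effect of a degeneracy on these cubes.\<close>

definition cube :: "nat \<Rightarrow> (nat \<Rightarrow> real) topology" where
  "cube n = product_topology (\<lambda>_. top_of_set {0..1}) {..<n}"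

definition cube_init :: "nat \<Rightarrow> (nat \<Rightarrow> real) \<Rightarrow> nat \<Rightarrow> real" where
  "cube_init n t = (\<lambda>j\<in>{..<n}. t j)"

definition cube_shift :: "nat \<Rightarrow> nat \<Rightarrow> (nat \<Rightarrow> real) \<Rightarrow> nat \<Rightarrow> real" where
  "cube_shift k n t = (\<lambda>j\<in>{..<n}. t (j + k))"

text \<open>The next two operations send a point of the \<open>(n + 1)\<close>-cube to the \<open>n\<close>-cube, by deleting
  coordinate \<open>i\<close> and by replacing coordinates \<open>i\<close>, \<open>i + 1\<close> by their maximum.\<close>

definition cube_del :: "nat \<Rightarrow> nat \<Rightarrow> (nat \<Rightarrow> real) \<Rightarrow> nat \<Rightarrow> real" where
  "cube_del i n t = (\<lambda>j\<in>{..<n}. if j < i then t j else t (j + 1))"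

definition cube_merge :: "nat \<Rightarrow> nat \<Rightarrow> (nat \<Rightarrow> real) \<Rightarrow> nat \<Rightarrow> real" where
  "cube_merge i n t = (\<lambda>j\<in>{..<n}.
     if j < i then t j else if j = i then max (t i) (t (i + 1)) else t (j + 1))"

definition comp_string :: "('o, 'm) cat \<Rightarrow> 'm list \<Rightarrow> bool" where
  "comp_string C fs \<longleftrightarrow> fs \<noteq> [] \<and> set fs \<subseteq> Ar C \<and>
     (\<forall>i. i + 1 < length fs \<longrightarrow> Cod C (fs ! i) = Dom C (fs ! (i + 1)))"

record ('o, 'm, 'a) hc_diagram =
  space_at :: "'o \<Rightarrow> 'a topology"
  coh :: "'m list \<Rightarrow> (nat \<Rightarrow> real) \<Rightarrow> 'a \<Rightarrow> 'a"

definition hc_functor :: "('o, 'm) cat \<Rightarrow> ('o, 'm, 'a) hc_diagram \<Rightarrow> bool" where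
  "hc_functor C D \<longleftrightarrow>
     (\<forall>x\<in>Ob C. CW_complex (space_at D x)) \<and>
     (\<forall>fs. comp_string C fs \<longrightarrow>
        continuous_map
          (prod_topology (cube (length fs - 1)) (space_at D (Dom C (hd fs))))
          (space_at D (Cod C (last fs))) (\<lambda>(t, x). coh D fs t x)) \<and>
     (\<forall>fs f g gs. comp_string C (fs @ [f, g] @ gs) \<longrightarrow>
        (\<forall>t\<in>topspace (cube (length fs + 1 + length gs)).
         \<forall>x\<in>topspace (space_at D (Dom C (hd (fs @ [f, g] @ gs)))).
           t (length fs) = 0 \<longrightarrow>
           coh D (fs @ [f, g] @ gs) t x =
           coh D (fs @ [Cmp C g f] @ gs) (cube_del (length fs) (length fs + length gs) t) x)) \<and>
     (\<forall>fs gs. fs \<noteq> [] \<and> gs \<noteq> [] \<and> comp_string C (fs @ gs) \<longrightarrow>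
        (\<forall>t\<in>topspace (cube (length fs + length gs - 1)).
         \<forall>x\<in>topspace (space_at D (Dom C (hd fs))).
           t (length fs - 1) = 1 \<longrightarrow>
           coh D (fs @ gs) t x =
           coh D gs (cube_shift (length fs) (length gs - 1) t)
             (coh D fs (cube_init (length fs - 1) t) x))) \<and>
     (\<forall>a\<in>Ob C. \<forall>t\<in>topspace (cube 0). \<forall>x\<in>topspace (space_at D a).
        coh D [Idt C a] t x = x) \<and>
     (\<forall>a gs. gs \<noteq> [] \<and> a \<in> Ob C \<and> comp_string C ([Idt C a] @ gs) \<longrightarrow>
        (\<forall>t\<in>topspace (cube (length gs)). \<forall>x\<in>topspace (space_at D a).
           coh D ([Idt C a] @ gs) t x = coh D gs (cube_del 0 (length gs - 1) t) x)) \<and>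
     (\<forall>a fs. fs \<noteq> [] \<and> a \<in> Ob C \<and> comp_string C (fs @ [Idt C a]) \<longrightarrow>
        (\<forall>t\<in>topspace (cube (length fs)). \<forall>x\<in>topspace (space_at D (Dom C (hd fs))).
           coh D (fs @ [Idt C a]) t x = coh D fs (cube_init (length fs - 1) t) x)) \<and>
     (\<forall>a fs gs. fs \<noteq> [] \<and> gs \<noteq> [] \<and> a \<in> Ob C \<and> comp_string C (fs @ [Idt C a] @ gs) \<longrightarrow>
        (\<forall>t\<in>topspace (cube (length fs + length gs)).
         \<forall>x\<in>topspace (space_at D (Dom C (hd fs))).
           coh D (fs @ [Idt C a] @ gs) t x =
           coh D (fs @ gs) (cube_merge (length fs - 1) (length fs + length gs - 1) t) x))"

text \<open>The functor on single arrows, and the homotopy from the value on \<open>g \<circ> f\<close> (at \<open>s = 0\<close>)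
  to the composite of the values on \<open>f\<close> and \<open>g\<close> (at \<open>s = 1\<close>).\<close>

definition act :: "('o, 'm, 'a) hc_diagram \<Rightarrow> 'm \<Rightarrow> 'a \<Rightarrow> 'a" where
  "act D f = coh D [f] (\<lambda>j\<in>{..<0}. 0)"

definition act2 :: "('o, 'm, 'a) hc_diagram \<Rightarrow> 'm \<Rightarrow> 'm \<Rightarrow> real \<Rightarrow> 'a \<Rightarrow> 'a" where
  "act2 D f g s = coh D [f, g] (\<lambda>j\<in>{..<1}. s)"

text \<open>For a commutative square \<open>f \<circ> p = g \<circ> q\<close> in the index category, the homotopy from
  \<open>act D f \<circ> act D p\<close> to \<open>act D g \<circ> act D q\<close> running through the value on the diagonal.\<close>

definition square_filler ::
  "('o, 'm, 'a) hc_diagram \<Rightarrow> 'm \<Rightarrow> 'm \<Rightarrow> 'm \<Rightarrow> 'm \<Rightarrow> real \<Rightarrow> 'a \<Rightarrow> 'a" where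
  "square_filler D p f q g s x =
     (if s \<le> 1/2 then act2 D p f (1 - 2 * s) x else act2 D q g (2 * s - 1) x)"

definition sends_to_pullback ::
  "('o, 'm) cat \<Rightarrow> ('o, 'm, 'a) hc_diagram \<Rightarrow> 'm \<Rightarrow> 'm \<Rightarrow> 'm \<Rightarrow> 'm \<Rightarrow> bool" where
  "sends_to_pullback C D p f q g \<longleftrightarrow>
     homotopy_pullback (space_at D (Dom C p)) (space_at D (Cod C p)) (space_at D (Cod C q))
       (space_at D (Cod C f)) (act D p) (act D q) (act D f) (act D g) (square_filler D p f q g)"

type_synonym 'a sspace = "(nat, darrow, 'a) hc_diagram"
type_synonym 'a smap = "(nat \<times> bool, darrow \<times> (bool \<times> bool), 'a) hc_diagram"

definition simplicial_space :: "'a sspace \<Rightarrow> bool" where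
  "simplicial_space X \<longleftrightarrow> hc_functor (opp_cat delta_cat) X"

text \<open>A simplicial map is a natural transformation, i.e. a functor on the product of the opposite
  simplex category with the walking arrow, whose restrictions to the two ends are the given
  simplicial spaces.\<close>

definition restricts_to :: "'a smap \<Rightarrow> bool \<Rightarrow> 'a sspace \<Rightarrow> bool" where
  "restricts_to F e X \<longleftrightarrow>
     (\<forall>n. space_at F (n, e) = space_at X n) \<and>
     (\<forall>fs. comp_string (opp_cat delta_cat) fs \<longrightarrow>
        (\<forall>t\<in>topspace (cube (length fs - 1)). \<forall>x\<in>topspace (space_at X (tgt (hd fs))).
           coh F (map (\<lambda>f. (f, (e, e))) fs) t x = coh X fs t x))"

definition simplicial_map :: "'a sspace \<Rightarrow> 'a sspace \<Rightarrow> 'a smap \<Rightarrow> bool" where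
  "simplicial_map Y X F \<longleftrightarrow>
     hc_functor (prod_cat (opp_cat delta_cat) walking_arrow) F \<and>
     restricts_to F False Y \<and> restricts_to F True X"

definition decomposition_space :: "'a sspace \<Rightarrow> bool" where
  "decomposition_space X \<longleftrightarrow>
     (\<forall>a i h k. active a \<and> inert i \<and> pushout_square delta_cat a i h k \<longrightarrow>
        sends_to_pullback (opp_cat delta_cat) X h a k i)"

definition component :: "'a smap \<Rightarrow> nat \<Rightarrow> 'a \<Rightarrow> 'a" where
  "component F n = act F (Idt delta_cat n, (False, True))"

definition smap_filler :: "'a smap \<Rightarrow> darrow \<Rightarrow> real \<Rightarrow> 'a \<Rightarrow> 'a" where
  "smap_filler F a = square_filler F
     (Idt delta_cat (tgt a), (False, True)) (a, (True, True))
     (a, (False, False)) (Idt delta_cat (src a), (False, True))"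

text \<open>In the square for \<open>a : [k] \<rightarrow> [n]\<close>, the homotopy in the product of the spaces \<open>X\<close> at
  \<open>n\<^sub>1, \<dots>, n\<^sub>k\<close> has as its components the naturality homotopies of the simplicial map at
  \<open>gam a 1, \<dots>, gam a k\<close>.\<close>

definition semi_ikeo :: "'a sspace \<Rightarrow> 'a sspace \<Rightarrow> 'a smap \<Rightarrow> bool" where
  "semi_ikeo Y X F \<longleftrightarrow>
     (\<forall>a. active a \<and> inj_on (fn a) {..src a} \<and> src a \<noteq> 0 \<and> tgt a \<noteq> 0 \<longrightarrow>
        homotopy_pullback
          (space_at Y (tgt a))
          (space_at X (tgt a))
          (product_topology (\<lambda>i. space_at Y (src (gam a i))) {1..src a})
          (product_topology (\<lambda>i. space_at X (src (gam a i))) {1..src a})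
          (component F (tgt a))
          (\<lambda>y. \<lambda>i\<in>{1..src a}. act Y (gam a i) y)
          (\<lambda>x. \<lambda>i\<in>{1..src a}. act X (gam a i) x)
          (\<lambda>y. \<lambda>i\<in>{1..src a}. component F (src (gam a i)) (y i))
          (\<lambda>s y. \<lambda>i\<in>{1..src a}. smap_filler F (gam a i) s y))"

end

theory Submission
  imports Defs
begin

text \<open>Let \<open>a : [k] \<rightarrow> [n]\<close> be active, let \<open>i : [k] \<rightarrow> [m]\<close> be the inert map that leaves \<open>p\<close> edges before and \<open>q\<close>
  edges after its image, so that \<open>m = p + k + q\<close>, and let \<open>M = p + n + q\<close> be the corner of their
  pushout. If \<open>n > 0\<close>, cut \<open>[m]\<close> into blocks of lengths \<open>p, k, q\<close> and \<open>[M]\<close> into blocks of lengths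
  \<open>p, n, q\<close>, leaving out the blocks of length \<open>0\<close>. Since the simplicial map is semi-ikeo,
  \<open>Y\<^sub>m = X\<^sub>m \<times> (Y\<^sub>p \<times> Y\<^sub>k \<times> Y\<^sub>q)\<close> over \<open>X\<^sub>p \<times> X\<^sub>k \<times> X\<^sub>q\<close> and
  \<open>Y\<^sub>M = X\<^sub>M \<times> (Y\<^sub>p \<times> Y\<^sub>n \<times> Y\<^sub>q)\<close> over \<open>X\<^sub>p \<times> X\<^sub>n \<times> X\<^sub>q\<close>, all pullbacks being homotopy
  pullbacks. As \<open>X\<^sub>M\<close> is the pullback of \<open>X\<^sub>m\<close> and \<open>X\<^sub>n\<close> over \<open>X\<^sub>k\<close>, both \<open>Y\<^sub>M\<close> and the pullback of
  \<open>Y\<^sub>m\<close> and \<open>Y\<^sub>n\<close> over \<open>Y\<^sub>k\<close> are identified with the pullback of \<open>X\<^sub>m\<close> and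
  \<open>Y\<^sub>p \<times> Y\<^sub>n \<times> Y\<^sub>q\<close> over \<open>X\<^sub>p \<times> X\<^sub>k \<times> X\<^sub>q\<close>. Formally this is the pasting law used once in each
  direction (\<open>strict_hpb_from_blocks\<close>).

  If \<open>n = 0\<close>, the middle block of \<open>[M]\<close> is empty, the map that marks the blocks is not
  injective, and the argument breaks down. But then
  the square in question is a retract of the square of the map \<open>[k + 1] \<rightarrow> [1]\<close> that collapses the
  first \<open>k\<close> edges, to which the first case applies, and homotopy pullbacks are closed under retracts
  (\<open>strict_hpb_degenerate\<close>).

  These arguments need squares and retractions that commute on the nose, whereas the diagrams here
  commute only up to coherent homotopy. Therefore the whole homotopy coherent diagram is first
  replaced by a strict one: \<open>rect c\<close> is the space of all ways to attach a cone point to the diagram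
  by an arrow into \<open>c\<close>. Precomposition makes this strictly functorial (\<open>rect_act_comp\<close>), and the
  evaluation \<open>vertex\<close> at the object \<open>c\<close> is a homotopy equivalence to the original space (\<open>he_vertex\<close>).
  A coherent square is a homotopy pullback if and only if its rectification is one
  (\<open>homotopy_pullback_strictification\<close>), because homotopy pullbacks are invariant under
  equivalences of cospans that are natural up to homotopy (\<open>he_hpb_homotopy_invariance\<close>).\<close>

section \<open>Homotopy equivalences\<close>

abbreviation UI :: "real topology" where
  "UI \<equiv> top_of_set {0..1}"

abbreviation homotopic_maps :: "'a topology \<Rightarrow> 'b topology \<Rightarrow> ('a \<Rightarrow> 'b) \<Rightarrow> ('a \<Rightarrow> 'b) \<Rightarrow> bool" where
  "homotopic_maps \<equiv> homotopic_with (\<lambda>_. True)"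

lemma homotopic_mapsI:
  assumes "continuous_map (prod_topology UI X) Y (\<lambda>z. h (fst z) (snd z))"
    and "\<And>x. x \<in> topspace X \<Longrightarrow> h 0 x = f x" "\<And>x. x \<in> topspace X \<Longrightarrow> h 1 x = g x"
  shows "homotopic_maps X Y f g"
  by (subst homotopic_with, simp) (use assms in \<open>auto intro!: exI[of _ "\<lambda>z. h (fst z) (snd z)"]\<close>)

lemma homotopic_mapsE:
  assumes "homotopic_maps X Y f g"
  obtains h where "continuous_map (prod_topology UI X) Y (\<lambda>z. h (fst z) (snd z))"
    "\<And>x. h 0 x = f x" "\<And>x. h 1 x = g x"
proof -
  obtain k where k: "continuous_map (prod_topology UI X) Y k" "\<forall>x. k (0, x) = f x" "\<forall>x. k (1, x) = g x"
    using assms unfolding homotopic_with_def by auto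
  show ?thesis by (rule that[of "\<lambda>u x. k (u, x)"]) (use k in auto)
qed

lemma homotopic_maps_postcompose:
  "homotopic_maps X Y f g \<Longrightarrow> continuous_map Y Z h \<Longrightarrow> homotopic_maps X Z (h \<circ> f) (h \<circ> g)"
  by (rule homotopic_with_compose_continuous_map_left) auto

lemma homotopic_maps_precompose:
  "homotopic_maps Y Z f g \<Longrightarrow> continuous_map X Y h \<Longrightarrow> homotopic_maps X Z (f \<circ> h) (g \<circ> h)"
  by (rule homotopic_with_compose_continuous_map_right) auto

lemma continuous_map_compose':
  "continuous_map Y Z g \<Longrightarrow> continuous_map X Y f \<Longrightarrow> continuous_map X Z (\<lambda>x. g (f x))"
  using continuous_map_compose[of X Y f Z g] by (simp add: comp_def)

lemma he_continuous: "homotopy_equivalence_map X Y f \<Longrightarrow> continuous_map X Y f"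
  by (simp add: homotopy_equivalence_map_def)

text \<open>The two inverses are homotopic by the usual computation \<open>h = (g f) h = g (f h) = g\<close>.\<close>

lemma he_of_one_sided_inverses:
  assumes f: "continuous_map X Y f" and g: "continuous_map Y X g" and h: "continuous_map Y X h"
    and gf: "homotopic_maps X X (g \<circ> f) id" and fh: "homotopic_maps Y Y (f \<circ> h) id"
  shows "homotopy_equivalence_map X Y f"
proof -
  have "homotopic_maps Y X ((g \<circ> f) \<circ> h) (id \<circ> h)"
    by (rule homotopic_with_compose_continuous_map_right[OF gf h]) simp
  moreover have "homotopic_maps Y X (g \<circ> (f \<circ> h)) (g \<circ> id)"
    by (rule homotopic_with_compose_continuous_map_left[OF fh g]) simp
  ultimately have "homotopic_maps Y X h g"
    by (metis comp_assoc comp_id id_comp homotopic_with_symD homotopic_with_trans)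
  then have "homotopic_maps Y Y (f \<circ> h) (f \<circ> g)"
    by (rule homotopic_with_compose_continuous_map_left[OF _ f]) simp
  then have "homotopic_maps Y Y (f \<circ> g) id"
    by (metis fh homotopic_with_symD homotopic_with_trans)
  then show ?thesis
    using f g gf unfolding homotopy_equivalence_map_def by blast
qed

lemma he_homotopic:
  assumes "homotopy_equivalence_map X Y f" "homotopic_maps X Y f f'"
  shows "homotopy_equivalence_map X Y f'"
proof -
  obtain g where g: "continuous_map Y X g" "homotopic_maps X X (g \<circ> f) id" "homotopic_maps Y Y (f \<circ> g) id"
    using assms(1) unfolding homotopy_equivalence_map_def by blast
  have "homotopic_maps X X (g \<circ> f') (g \<circ> f)"
    by (rule homotopic_with_compose_continuous_map_left[OF homotopic_with_symD[OF assms(2)] g(1)]) simp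
  moreover have "homotopic_maps Y Y (f' \<circ> g) (f \<circ> g)"
    by (rule homotopic_with_compose_continuous_map_right[OF homotopic_with_symD[OF assms(2)] g(1)]) simp
  moreover have "continuous_map X Y f'"
    using homotopic_with_imp_continuous_maps[OF assms(2)] by blast
  ultimately show ?thesis
    using g unfolding homotopy_equivalence_map_def by (meson homotopic_with_trans)
qed

lemma he_cong:
  assumes "homotopy_equivalence_map X Y f" "\<And>x. x \<in> topspace X \<Longrightarrow> f x = f' x"
  shows "homotopy_equivalence_map X Y f'"
  by (rule he_homotopic[OF assms(1)], rule homotopic_with_equal)
     (use assms in \<open>auto simp: he_continuous\<close>)

lemma he_id: "homotopy_equivalence_map X X id"
  unfolding homotopy_equivalence_map_def by (auto intro!: exI[of _ id])

lemma he_comp: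
  assumes "homotopy_equivalence_map X Y f" "homotopy_equivalence_map Y Z g"
  shows "homotopy_equivalence_map X Z (g \<circ> f)"
proof -
  obtain f' where f': "continuous_map Y X f'" "homotopic_maps X X (f' \<circ> f) id" "homotopic_maps Y Y (f \<circ> f') id"
    using assms(1) unfolding homotopy_equivalence_map_def by blast
  obtain g' where g': "continuous_map Z Y g'" "homotopic_maps Y Y (g' \<circ> g) id" "homotopic_maps Z Z (g \<circ> g') id"
    using assms(2) unfolding homotopy_equivalence_map_def by blast
  have cf: "continuous_map X Y f" and cg: "continuous_map Y Z g"
    using assms by (auto simp: he_continuous)
  have "homotopic_maps X Y ((g' \<circ> g) \<circ> f) (id \<circ> f)"
    by (rule homotopic_with_compose_continuous_map_right[OF g'(2) cf]) simp
  then have "homotopic_maps X X (f' \<circ> ((g' \<circ> g) \<circ> f)) (f' \<circ> (id \<circ> f))"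
    by (rule homotopic_with_compose_continuous_map_left[OF _ f'(1)]) simp
  then have 1: "homotopic_maps X X ((f' \<circ> g') \<circ> (g \<circ> f)) id"
    by (metis comp_assoc id_comp f'(2) homotopic_with_trans)
  have "homotopic_maps Z Y ((f \<circ> f') \<circ> g') (id \<circ> g')"
    by (rule homotopic_with_compose_continuous_map_right[OF f'(3) g'(1)]) simp
  then have "homotopic_maps Z Z (g \<circ> ((f \<circ> f') \<circ> g')) (g \<circ> (id \<circ> g'))"
    by (rule homotopic_with_compose_continuous_map_left[OF _ cg]) simp
  then have 2: "homotopic_maps Z Z ((g \<circ> f) \<circ> (f' \<circ> g')) id"
    by (metis comp_assoc id_comp g'(3) homotopic_with_trans)
  show ?thesis unfolding homotopy_equivalence_map_def
    using 1 2 continuous_map_compose[OF cf cg] continuous_map_compose[OF g'(1) f'(1)] by blast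
qed

text \<open>Part of the two-out-of-six property. It yields homotopy invariance of homotopy pullbacks without
  a choice of inverses that satisfy triangle identities.\<close>

lemma he_two_of_six_middle:
  assumes "continuous_map W X f" "continuous_map X Y g" "continuous_map Y Z h"
    and "homotopy_equivalence_map W Y (g \<circ> f)" "homotopy_equivalence_map X Z (h \<circ> g)"
  shows "homotopy_equivalence_map X Y g"
proof -
  obtain k where k: "continuous_map Y W k" "homotopic_maps Y Y ((g \<circ> f) \<circ> k) id"
    using assms(4) unfolding homotopy_equivalence_map_def by blast
  obtain l where l: "continuous_map Z X l" "homotopic_maps X X (l \<circ> (h \<circ> g)) id"
    using assms(5) unfolding homotopy_equivalence_map_def by blast
  show ?thesis
    by (rule he_of_one_sided_inverses[OF assms(2), of "l \<circ> h" "f \<circ> k"])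
       (use k l assms in \<open>auto simp: comp_assoc intro: continuous_map_compose\<close>)
qed

lemma he_inverse:
  assumes "homotopy_equivalence_map X Y f"
  obtains g where "homotopy_equivalence_map Y X g" "homotopic_maps X X (g \<circ> f) id"
    "homotopic_maps Y Y (f \<circ> g) id"
  using assms unfolding homotopy_equivalence_map_def by blast

lemma he_cancel_left:
  assumes f: "continuous_map X Y f" and g: "homotopy_equivalence_map Y Z g"
    and gf: "homotopy_equivalence_map X Z (g \<circ> f)"
  shows "homotopy_equivalence_map X Y f"
proof -
  obtain g' where g': "homotopy_equivalence_map Z Y g'" "homotopic_maps Y Y (g' \<circ> g) id"
    using he_inverse[OF g] by metis
  have "homotopic_maps X Y ((g' \<circ> g) \<circ> f) (id \<circ> f)"
    by (rule homotopic_with_compose_continuous_map_right[OF g'(2) f]) simp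
  then show ?thesis
    using he_homotopic[OF he_comp[OF gf g'(1)]] by (simp add: comp_assoc)
qed

lemma he_cancel_right:
  assumes g: "continuous_map Y Z g" and f: "homotopy_equivalence_map X Y f"
    and gf: "homotopy_equivalence_map X Z (g \<circ> f)"
  shows "homotopy_equivalence_map Y Z g"
proof -
  obtain f' where f': "homotopy_equivalence_map Y X f'" "homotopic_maps Y Y (f \<circ> f') id"
    using he_inverse[OF f] by metis
  have "homotopic_maps Y Z (g \<circ> (f \<circ> f')) (g \<circ> id)"
    by (rule homotopic_with_compose_continuous_map_left[OF f'(2) g]) simp
  then show ?thesis
    using he_homotopic[OF he_comp[OF f'(1) gf]] by (simp add: comp_assoc)
qed

lemma he_comp_iff_left:
  assumes "continuous_map X Y f" "homotopy_equivalence_map Y Z g"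
  shows "homotopy_equivalence_map X Z (g \<circ> f) \<longleftrightarrow> homotopy_equivalence_map X Y f"
  using he_cancel_left[OF assms] he_comp[of X Y f Z g] assms by blast

lemma he_comp_iff_right:
  assumes "continuous_map Y Z g" "homotopy_equivalence_map X Y f"
  shows "homotopy_equivalence_map X Z (g \<circ> f) \<longleftrightarrow> homotopy_equivalence_map Y Z g"
  using he_cancel_right[OF assms] he_comp[of X Y f Z g] assms by blast

lemma he_retract:
  assumes f: "continuous_map P Q f" and f': "homotopy_equivalence_map P' Q' f'"
    and i: "continuous_map P P' i" and r: "continuous_map P' P r"
    and j: "continuous_map Q Q' j" and s: "continuous_map Q' Q s"
    and ri: "\<And>x. x \<in> topspace P \<Longrightarrow> r (i x) = x"
    and sj: "\<And>y. y \<in> topspace Q \<Longrightarrow> s (j y) = y"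
    and fi: "\<And>x. x \<in> topspace P \<Longrightarrow> f' (i x) = j (f x)"
    and fr: "\<And>x. x \<in> topspace P' \<Longrightarrow> f (r x) = s (f' x)"
  shows "homotopy_equivalence_map P Q f"
proof -
  obtain g' where g': "continuous_map Q' P' g'" "homotopic_maps P' P' (g' \<circ> f') id" "homotopic_maps Q' Q' (f' \<circ> g') id"
    using f' unfolding homotopy_equivalence_map_def by blast
  let ?g = "r \<circ> g' \<circ> j"
  have g: "continuous_map Q P ?g"
    by (intro continuous_map_compose[of _ Q'] continuous_map_compose[of _ P'] g' r j)
  have "homotopic_maps P P (r \<circ> (g' \<circ> f') \<circ> i) (r \<circ> id \<circ> i)"
    by (rule homotopic_maps_precompose[OF homotopic_maps_postcompose[OF g'(2) r] i])
  then have 1: "homotopic_maps P P (?g \<circ> f) id"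
    by (rule homotopic_with_eq) (auto simp: ri fi)
  have "homotopic_maps Q Q (s \<circ> (f' \<circ> g') \<circ> j) (s \<circ> id \<circ> j)"
    by (rule homotopic_maps_precompose[OF homotopic_maps_postcompose[OF g'(3) s] j])
  then have 2: "homotopic_maps Q Q (f \<circ> ?g) id"
    by (rule homotopic_with_eq)
       (use continuous_map_image_subset_topspace[OF g'(1)] continuous_map_image_subset_topspace[OF j]
         in \<open>auto simp: sj fr image_subset_iff\<close>)
  show ?thesis unfolding homotopy_equivalence_map_def using f g 1 2 by blast
qed

lemma he_product_topology:
  assumes "\<And>i. i \<in> I \<Longrightarrow> homotopy_equivalence_map (X i) (Y i) (f i)"
  shows "homotopy_equivalence_map (product_topology X I) (product_topology Y I) (\<lambda>x. \<lambda>i\<in>I. f i (x i))"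
proof -
  have "\<forall>i\<in>I. \<exists>g h k. continuous_map (Y i) (X i) g \<and>
     continuous_map (prod_topology UI (X i)) (X i) (\<lambda>z. h (fst z) (snd z)) \<and> (\<forall>x. h 0 x = g (f i x)) \<and> (\<forall>x. h 1 x = x) \<and>
     continuous_map (prod_topology UI (Y i)) (Y i) (\<lambda>z. k (fst z) (snd z)) \<and> (\<forall>x. k 0 x = f i (g x)) \<and> (\<forall>x. k 1 x = x)"
  proof
    fix i assume "i \<in> I"
    from assms[OF this] obtain g where g: "continuous_map (Y i) (X i) g"
      "homotopic_maps (X i) (X i) (g \<circ> f i) id" "homotopic_maps (Y i) (Y i) (f i \<circ> g) id"
      unfolding homotopy_equivalence_map_def by blast
    from homotopic_mapsE[OF g(2)] obtain h where h: "continuous_map (prod_topology UI (X i)) (X i) (\<lambda>z. h (fst z) (snd z))"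
      "\<And>x. h 0 x = (g \<circ> f i) x" "\<And>x. h 1 x = id x" by metis
    from homotopic_mapsE[OF g(3)] obtain k where k: "continuous_map (prod_topology UI (Y i)) (Y i) (\<lambda>z. k (fst z) (snd z))"
      "\<And>x. k 0 x = (f i \<circ> g) x" "\<And>x. k 1 x = id x" by metis
    show "\<exists>g h k. continuous_map (Y i) (X i) g \<and>
     continuous_map (prod_topology UI (X i)) (X i) (\<lambda>z. h (fst z) (snd z)) \<and> (\<forall>x. h 0 x = g (f i x)) \<and> (\<forall>x. h 1 x = x) \<and>
     continuous_map (prod_topology UI (Y i)) (Y i) (\<lambda>z. k (fst z) (snd z)) \<and> (\<forall>x. k 0 x = f i (g x)) \<and> (\<forall>x. k 1 x = x)"
      by (intro exI[of _ g] exI[of _ h] exI[of _ k]) (use g(1) h k in simp)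
  qed
  then obtain g h k where g: "\<And>i. i \<in> I \<Longrightarrow> continuous_map (Y i) (X i) (g i)"
    and h: "\<And>i. i \<in> I \<Longrightarrow> continuous_map (prod_topology UI (X i)) (X i) (\<lambda>z. h i (fst z) (snd z))"
      "\<And>i x. i \<in> I \<Longrightarrow> h i 0 x = g i (f i x)" "\<And>i x. i \<in> I \<Longrightarrow> h i 1 x = x"
    and k: "\<And>i. i \<in> I \<Longrightarrow> continuous_map (prod_topology UI (Y i)) (Y i) (\<lambda>z. k i (fst z) (snd z))"
      "\<And>i x. i \<in> I \<Longrightarrow> k i 0 x = f i (g i x)" "\<And>i x. i \<in> I \<Longrightarrow> k i 1 x = x"
    unfolding bchoice_iff by blast
  have *: "continuous_map (product_topology X I) (product_topology Y I) (\<lambda>x. \<lambda>i\<in>I. f i (x i))"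
    if "\<And>i. i \<in> I \<Longrightarrow> continuous_map (X i) (Y i) (f i)" for X Y f
    unfolding continuous_map_componentwise
  proof (intro conjI ballI)
    fix i assume i: "i \<in> I"
    from continuous_map_compose'[OF that[OF i] continuous_map_product_projection[OF i, of X]] i
    show "continuous_map (product_topology X I) (Y i) (\<lambda>x. (\<lambda>i\<in>I. f i (x i)) i)"
      by simp
  qed auto
  have H: "continuous_map (prod_topology UI (product_topology X I)) (product_topology X I) (\<lambda>z. \<lambda>i\<in>I. h i (fst z) (snd z i))"
    if h: "\<And>i. i \<in> I \<Longrightarrow> continuous_map (prod_topology UI (X i)) (X i) (\<lambda>z. h i (fst z) (snd z))" for X h
    unfolding continuous_map_componentwise
  proof (intro conjI ballI)
    fix i assume i: "i \<in> I"
    have "continuous_map (prod_topology UI (product_topology X I)) (prod_topology UI (X i)) (\<lambda>z. (fst z, snd z i))"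
      by (intro continuous_map_pairedI continuous_map_fst
          continuous_map_compose'[OF continuous_map_product_projection[OF i, of X] continuous_map_snd])
    from continuous_map_compose'[OF h[OF i] this] i
    show "continuous_map (prod_topology UI (product_topology X I)) (X i) (\<lambda>x. (\<lambda>i\<in>I. h i (fst x) (snd x i)) i)"
      by simp
  qed auto
  have 1: "homotopic_maps (product_topology X I) (product_topology X I)
      ((\<lambda>y. \<lambda>i\<in>I. g i (y i)) \<circ> (\<lambda>x. \<lambda>i\<in>I. f i (x i))) id"
    by (rule homotopic_mapsI[where h = "\<lambda>u x. \<lambda>i\<in>I. h i u (x i)"])
       (use h in \<open>auto intro!: H ext simp: PiE_def extensional_def\<close>)
  have 2: "homotopic_maps (product_topology Y I) (product_topology Y I)
      ((\<lambda>x. \<lambda>i\<in>I. f i (x i)) \<circ> (\<lambda>y. \<lambda>i\<in>I. g i (y i))) id"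
    by (rule homotopic_mapsI[where h = "\<lambda>u x. \<lambda>i\<in>I. k i u (x i)"])
       (use k in \<open>auto intro!: H ext simp: PiE_def extensional_def\<close>)
  show ?thesis
    unfolding homotopy_equivalence_map_def
    by (intro conjI exI[of _ "\<lambda>y. \<lambda>i\<in>I. g i (y i)"] * 1 2) (use assms g in \<open>auto simp: he_continuous\<close>)
qed

section \<open>Mapping spaces and homotopy pullback spaces\<close>

text \<open>Continuity of maps into path spaces and mapping spaces is always reduced to this form.\<close>

abbreviation continuous2 :: "'a topology \<Rightarrow> 'b topology \<Rightarrow> 'c topology \<Rightarrow> ('a \<Rightarrow> 'b \<Rightarrow> 'c) \<Rightarrow> bool" where
  "continuous2 A B Z K \<equiv> continuous_map (prod_topology A B) Z (\<lambda>z. K (fst z) (snd z))"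

lemma continuous2_apply:
  assumes "continuous2 A B Z K" "continuous_map T A a" "continuous_map T B b"
  shows "continuous_map T Z (\<lambda>t. K (a t) (b t))"
  using continuous_map_compose'[OF assms(1) continuous_map_pairedI[OF assms(2,3)]] by simp

lemma continuous_map_fst_of:
  "continuous_map T (prod_topology A B) f \<Longrightarrow> continuous_map T A (\<lambda>t. fst (f t))"
  by (rule continuous_map_compose'[OF continuous_map_fst])

lemma continuous_map_snd_of:
  "continuous_map T (prod_topology A B) f \<Longrightarrow> continuous_map T B (\<lambda>t. snd (f t))"
  by (rule continuous_map_compose'[OF continuous_map_snd])

lemma continuous_map_self: "continuous_map T T (\<lambda>t. t)"
  by simp

text \<open>The compact-open topology. Paths are the case of the unit interval, and the cubes occur in
  rectified diagrams.\<close>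

definition mapping_space :: "'k topology \<Rightarrow> 'a topology \<Rightarrow> ('k \<Rightarrow> 'a) topology" where
  "mapping_space K Z = topology_generated_by
     {{w \<in> extensional (topspace K). continuous_map K Z w \<and> w ` C \<subseteq> U} | C U.
        compactin K C \<and> openin Z U}"

lemma path_space_eq_mapping_space: "path_space Z = mapping_space UI Z"
  unfolding path_space_def mapping_space_def by (simp add: compactin_subtopology conj_assoc)

lemma topspace_mapping_space:
  "topspace (mapping_space K Z) = {w \<in> extensional (topspace K). continuous_map K Z w}"
proof -
  let ?S = "{{w \<in> extensional (topspace K). continuous_map K Z w \<and> w ` C \<subseteq> U} | C U.
        compactin K C \<and> openin Z U}"
  have "{w \<in> extensional (topspace K). continuous_map K Z w \<and> w ` {} \<subseteq> {}} \<in> ?S"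
    by (rule CollectI, rule exI[of _ "{}"], rule exI[of _ "{}"]) simp
  then have "{w \<in> extensional (topspace K). continuous_map K Z w} \<subseteq> \<Union>?S"
    by (intro Union_upper) simp
  moreover have "\<Union>?S \<subseteq> {w \<in> extensional (topspace K). continuous_map K Z w}"
    by (intro Union_least) blast
  ultimately show ?thesis
    unfolding mapping_space_def topology_generated_by_topspace by (rule subset_antisym[rotated])
qed

text \<open>For a compact set \<open>C\<close> and an open set \<open>U\<close>, the points \<open>t\<close> with \<open>h t ` C \<subseteq> U\<close> form an open set
  by the tube lemma.\<close>

lemma continuous_map_curry:
  assumes h: "continuous2 T K Z h"
  shows "continuous_map T (mapping_space K Z) (\<lambda>t. \<lambda>x\<in>topspace K. h t x)"
proof -
  have cont: "continuous_map K Z (\<lambda>x\<in>topspace K. h t x)" if "t \<in> topspace T" for t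
  proof (rule continuous_map_eq)
    show "continuous_map K Z (h t)"
      by (rule continuous2_apply[OF h]) (use that in auto)
  qed auto
  show ?thesis
    unfolding mapping_space_def
  proof (rule continuous_on_generated_topo)
    fix S assume "S \<in> {{w \<in> extensional (topspace K). continuous_map K Z w \<and> w ` C \<subseteq> U} | C U.
        compactin K C \<and> openin Z U}"
    then obtain C U where S: "S = {w \<in> extensional (topspace K). continuous_map K Z w \<and> w ` C \<subseteq> U}"
      and C: "compactin K C" and U: "openin Z U" by auto
    have CK: "C \<subseteq> topspace K" using C by (rule compactin_subset_topspace)
    let ?W = "{z \<in> topspace (prod_topology T K). h (fst z) (snd z) \<in> U}"
    have W: "openin (prod_topology T K) ?W"
      by (rule openin_continuous_map_preimage[OF h U])
    have eq: "(\<lambda>t. \<lambda>x\<in>topspace K. h t x) -` S \<inter> topspace T = {t \<in> topspace T. \<forall>x\<in>C. h t x \<in> U}"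
    proof (intro set_eqI iffI)
      fix t assume t: "t \<in> {t \<in> topspace T. \<forall>x\<in>C. h t x \<in> U}"
      then have "(\<lambda>x\<in>topspace K. h t x) ` C \<subseteq> U"
        using CK by auto
      then show "t \<in> (\<lambda>t. \<lambda>x\<in>topspace K. h t x) -` S \<inter> topspace T"
        using t cont[of t] by (simp add: S)
    next
      fix t assume t: "t \<in> (\<lambda>t. \<lambda>x\<in>topspace K. h t x) -` S \<inter> topspace T"
      then have "(\<lambda>x\<in>topspace K. h t x) ` C \<subseteq> U"
        by (simp add: S)
      then have "\<forall>x\<in>C. (\<lambda>x\<in>topspace K. h t x) x \<in> U"
        by blast
      then show "t \<in> {t \<in> topspace T. \<forall>x\<in>C. h t x \<in> U}"
        using t CK by (simp add: subset_eq)
    qed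
    show "openin T ((\<lambda>t. \<lambda>x\<in>topspace K. h t x) -` S \<inter> topspace T)"
      unfolding eq
    proof (subst openin_subopen, intro ballI)
      fix t assume t: "t \<in> {t \<in> topspace T. \<forall>x\<in>C. h t x \<in> U}"
      have sub: "{t} \<times> C \<subseteq> ?W" using t CK by auto
      have "compactin T {t}" using t by simp
      from this C W sub obtain V V' where "openin T V" "openin K V'" "{t} \<subseteq> V" "C \<subseteq> V'" "V \<times> V' \<subseteq> ?W"
        by (rule Wallace_theorem_prod_topology)
      have "h x y \<in> U" if "x \<in> V" "y \<in> C" for x y
        using \<open>V \<times> V' \<subseteq> ?W\<close> \<open>C \<subseteq> V'\<close> that by (auto dest!: subsetD[of _ _ "(x, y)"])
      then show "\<exists>V. openin T V \<and> t \<in> V \<and> V \<subseteq> {t \<in> topspace T. \<forall>x\<in>C. h t x \<in> U}"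
        using \<open>openin T V\<close> \<open>{t} \<subseteq> V\<close> openin_subset[OF \<open>openin T V\<close>]
        by (intro exI[of _ V] conjI subsetI CollectI ballI) auto
    qed
  next
    show "(\<lambda>t. restrict (h t) (topspace K)) ` topspace T \<subseteq> \<Union> {{w \<in> extensional (topspace K). continuous_map K Z w \<and> w ` C \<subseteq> U} | C U.
        compactin K C \<and> openin Z U}"
      using cont
      unfolding topology_generated_by_topspace[symmetric] mapping_space_def[symmetric] topspace_mapping_space
      by (intro image_subsetI CollectI conjI) auto
  qed
qed

text \<open>In a compact Hausdorff space \<open>K\<close> each point has arbitrarily small compact neighbourhoods; for such
  a neighbourhood \<open>C\<close>, the maps sending \<open>C\<close> into a given open set form a subbasic open set.\<close>

lemma continuous_map_evaluation:
  assumes "compact_space K" "Hausdorff_space K"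
  shows "continuous2 (mapping_space K Z) K Z (\<lambda>w x. w x)"
proof -
  have nb: "neighbourhood_base_of (compactin K) K"
    using assms compact_imp_locally_compact_space locally_compact_space_neighbourhood_base by blast
  let ?P = "prod_topology (mapping_space K Z) K"
  show ?thesis
    unfolding continuous_map_def
  proof (intro conjI allI impI)
    show "(\<lambda>z. fst z (snd z)) \<in> topspace ?P \<rightarrow> topspace Z"
      by (auto simp: topspace_mapping_space dest!: continuous_map_funspace)
    fix U assume U: "openin Z U"
    show "openin ?P {z \<in> topspace ?P. fst z (snd z) \<in> U}"
    proof (subst openin_subopen, intro ballI)
      fix z assume z: "z \<in> {z \<in> topspace ?P. fst z (snd z) \<in> U}"
      then obtain w x where wx: "z = (w, x)" "w \<in> extensional (topspace K)" "continuous_map K Z w" "x \<in> topspace K" "w x \<in> U"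
        by (auto simp: topspace_mapping_space)
      have "openin K {x \<in> topspace K. w x \<in> U}"
        by (rule openin_continuous_map_preimage[OF wx(3) U])
      moreover have "x \<in> {x \<in> topspace K. w x \<in> U}" using wx by simp
      ultimately have "\<exists>V C. openin K V \<and> compactin K C \<and> x \<in> V \<and> V \<subseteq> C \<and> C \<subseteq> {x \<in> topspace K. w x \<in> U}"
        by (intro nb[unfolded neighbourhood_base_of, rule_format] conjI)
      then obtain V C where V: "openin K V" "compactin K C" "x \<in> V" "V \<subseteq> C" "C \<subseteq> {x \<in> topspace K. w x \<in> U}"
        by blast
      let ?S = "{w \<in> extensional (topspace K). continuous_map K Z w \<and> w ` C \<subseteq> U}"
      have "openin (mapping_space K Z) ?S"
        unfolding mapping_space_def by (rule topology_generated_by_Basis) (use V U in auto)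
      then have "openin ?P (?S \<times> V)"
        using V(1) by (simp add: openin_prod_Times_iff)
      moreover have "?S \<times> V \<subseteq> {z \<in> topspace ?P. fst z (snd z) \<in> U}"
        using V(4) openin_subset[OF V(1)] by (auto simp: topspace_mapping_space image_subset_iff)
      moreover have "z \<in> ?S \<times> V"
        using wx V by auto
      ultimately show "\<exists>T. openin ?P T \<and> z \<in> T \<and> T \<subseteq> {z \<in> topspace ?P. fst z (snd z) \<in> U}"
        by blast
    qed
  qed
qed

lemma compact_space_UI: "compact_space UI" and Hausdorff_space_UI: "Hausdorff_space UI"
  by (auto simp: compact_space_subtopology Hausdorff_space_subtopology)

lemma continuous_map_UI_iff:
  "continuous_map T UI s \<longleftrightarrow> continuous_map T euclideanreal s \<and> (\<forall>t\<in>topspace T. 0 \<le> s t \<and> s t \<le> 1)"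
  by (auto simp: continuous_map_in_subtopology)

lemma in_topspace_hpb_space:
  "x \<in> topspace (hpb_space A B Z f g) \<longleftrightarrow>
     fst x \<in> topspace A \<and> fst (snd x) \<in> topspace B \<and> snd (snd x) \<in> extensional {0..1} \<and>
     continuous_map UI Z (snd (snd x)) \<and> snd (snd x) 0 = f (fst x) \<and> snd (snd x) 1 = g (fst (snd x))"
  unfolding hpb_space_def path_space_eq_mapping_space
  by (cases x) (auto simp: topspace_mapping_space)

lemma continuous_map_into_hpb_space:
  assumes "continuous_map T A a" "continuous_map T B b" "continuous2 T UI Z w"
    and "\<And>t. t \<in> topspace T \<Longrightarrow> w t 0 = f (a t)" "\<And>t. t \<in> topspace T \<Longrightarrow> w t 1 = g (b t)"
  shows "continuous_map T (hpb_space A B Z f g) (\<lambda>t. (a t, b t, \<lambda>s\<in>{0..1}. w t s))"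
  unfolding hpb_space_def path_space_eq_mapping_space
proof (rule continuous_map_into_subtopology)
  have "continuous_map T (mapping_space UI Z) (\<lambda>t. \<lambda>s\<in>{0..1}. w t s)"
    using continuous_map_curry[OF assms(3)] by simp
  then show "continuous_map T (prod_topology A (prod_topology B (mapping_space UI Z)))
     (\<lambda>t. (a t, b t, restrict (w t) {0..1}))"
    by (intro continuous_map_pairedI assms)
qed (use assms(4,5) in auto)

lemma continuous_map_hpb_fst:
  "continuous_map T (hpb_space A B Z f g) x \<Longrightarrow> continuous_map T A (\<lambda>t. fst (x t))"
  unfolding hpb_space_def continuous_map_in_subtopology by (auto intro: continuous_map_fst_of)

lemma continuous_map_hpb_snd:
  assumes "continuous_map T (hpb_space A B Z f g) x"
  shows "continuous_map T B (\<lambda>t. fst (snd (x t)))"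
proof -
  have "continuous_map T (prod_topology A (prod_topology B (path_space Z))) x"
    using assms unfolding hpb_space_def continuous_map_in_subtopology by simp
  from continuous_map_fst_of[OF continuous_map_snd_of[OF this]] show ?thesis .
qed

lemma continuous_map_hpb_path:
  assumes "continuous_map T (hpb_space A B Z f g) x" "continuous_map T UI s"
  shows "continuous_map T Z (\<lambda>t. snd (snd (x t)) (s t))"
proof -
  have "continuous_map T (prod_topology A (prod_topology B (mapping_space UI Z))) x"
    using assms unfolding hpb_space_def path_space_eq_mapping_space continuous_map_in_subtopology by simp
  from continuous_map_snd_of[OF continuous_map_snd_of[OF this]]
  show ?thesis
    by (rule continuous2_apply[OF continuous_map_evaluation[OF compact_space_UI Hausdorff_space_UI] _ assms(2)])
qed

lemma hpb_space_cong:
  assumes "\<And>a. a \<in> topspace A \<Longrightarrow> f a = f' a" "\<And>b. b \<in> topspace B \<Longrightarrow> g b = g' b"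
  shows "hpb_space A B Z f g = hpb_space A B Z f' g'"
proof -
  let ?P = "prod_topology A (prod_topology B (path_space Z))"
  have "topspace ?P \<inter> {(a, b, w). w 0 = f a \<and> w 1 = g b} = topspace ?P \<inter> {(a, b, w). w 0 = f' a \<and> w 1 = g' b}"
    using assms by auto
  then show ?thesis
    unfolding hpb_space_def
    using subtopology_restrict[of ?P "{(a, b, w). w 0 = f a \<and> w 1 = g b}"]
      subtopology_restrict[of ?P "{(a, b, w). w 0 = f' a \<and> w 1 = g' b}"] by simp
qed

lemma homotopic_maps_into_hpb_space:
  assumes "continuous2 UI X A a" "continuous2 UI X B b"
    and "continuous_map (prod_topology (prod_topology UI X) UI) Z (\<lambda>z. w (fst (fst z)) (snd (fst z)) (snd z))"
    and "\<And>u x. 0 \<le> u \<Longrightarrow> u \<le> 1 \<Longrightarrow> x \<in> topspace X \<Longrightarrow> w u x 0 = f (a u x)"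
    and "\<And>u x. 0 \<le> u \<Longrightarrow> u \<le> 1 \<Longrightarrow> x \<in> topspace X \<Longrightarrow> w u x 1 = g (b u x)"
    and "\<And>x. x \<in> topspace X \<Longrightarrow> h x = (a 0 x, b 0 x, \<lambda>s\<in>{0..1}. w 0 x s)"
    and "\<And>x. x \<in> topspace X \<Longrightarrow> h' x = (a 1 x, b 1 x, \<lambda>s\<in>{0..1}. w 1 x s)"
  shows "homotopic_maps X (hpb_space A B Z f g) h h'"
proof (rule homotopic_mapsI[where h = "\<lambda>u x. (a u x, b u x, \<lambda>s\<in>{0..1}. w u x s)"])
  show "continuous2 UI X (hpb_space A B Z f g) (\<lambda>u x. (a u x, b u x, \<lambda>s\<in>{0..1}. w u x s))"
    by (rule continuous_map_into_hpb_space) (use assms(1-5) in auto)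
qed (use assms(6,7) in auto)

section \<open>Homotopy invariance of homotopy pullbacks\<close>

lemma continuous_map_case_le:
  assumes "continuous_map T euclideanreal p" "continuous_map T euclideanreal q"
    and "continuous_map T Z f" "continuous_map T Z g"
    and "\<And>t. t \<in> topspace T \<Longrightarrow> p t = q t \<Longrightarrow> f t = g t"
  shows "continuous_map T Z (\<lambda>t. if p t \<le> q t then f t else g t)"
  using assms by (intro continuous_map_cases_le) (auto intro: continuous_map_from_subtopology)

text \<open>The point reached after walking the distance \<open>r\<close> from \<open>v\<close> towards \<open>u\<close>, stopping at \<open>u\<close>. This form
  covers \<open>u \<le> v\<close> and \<open>v \<le> u\<close> at once and is visibly continuous.\<close>

definition between :: "real \<Rightarrow> real \<Rightarrow> real \<Rightarrow> real" where
  "between u v r = max (v - r) (min (v + r) u)"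

lemma between_0 [simp]: "between u v 0 = v"
  by (simp add: between_def)

lemma between_dist [simp]: "between u v \<bar>u - v\<bar> = u"
  by (auto simp: between_def)

lemma between_unit: "0 \<le> r \<Longrightarrow> 0 \<le> u \<Longrightarrow> u \<le> 1 \<Longrightarrow> 0 \<le> v \<Longrightarrow> v \<le> 1 \<Longrightarrow> 0 \<le> between u v r \<and> between u v r \<le> 1"
  by (auto simp: between_def)

text \<open>Let \<open>K\<close> and \<open>J\<close> be homotopies of the legs of a cospan and \<open>w\<close> a path from \<open>K u a\<close> to \<open>J u b\<close>. The
  result is the path from \<open>K v a\<close> to \<open>J v b\<close> that runs along \<open>K\<close> from \<open>v\<close> to \<open>u\<close>, then along \<open>w\<close>, and
  back along \<open>J\<close> from \<open>u\<close> to \<open>v\<close>. Each piece takes time proportional to its length, so that the path is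
  \<open>w\<close> itself when \<open>u = v\<close>; with fixed thirds it would be a reparametrisation only.\<close>

definition transport_path ::
  "(real \<Rightarrow> 'a \<Rightarrow> 'c) \<Rightarrow> (real \<Rightarrow> 'b \<Rightarrow> 'c) \<Rightarrow> real \<Rightarrow> real \<Rightarrow> 'a \<Rightarrow> 'b \<Rightarrow> (real \<Rightarrow> 'c) \<Rightarrow> real \<Rightarrow> 'c" where
  "transport_path K J u v a b w s =
     (let d = \<bar>u - v\<bar>; r = s * (1 + 2 * d) in
       if r \<le> d then K (between u v r) a
       else if r \<le> 1 + d then w (min 1 (max 0 (r - d)))
       else J (between u v (1 + 2 * d - r)) b)"

lemma transport_path_start: "transport_path K J u v a b w 0 = K v a"
  by (simp add: transport_path_def)

lemma transport_path_end: "w 1 = J u b \<Longrightarrow> transport_path K J u v a b w 1 = J v b"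
  by (auto simp: transport_path_def Let_def)

lemma transport_path_same:
  "w 0 = K u a \<Longrightarrow> 0 \<le> s \<Longrightarrow> s \<le> 1 \<Longrightarrow> transport_path K J u u a b w s = w s"
  by (cases "s = 0") (simp_all add: transport_path_def Let_def)

lemma transport_path_cong:
  assumes "\<And>s. 0 \<le> s \<Longrightarrow> s \<le> 1 \<Longrightarrow> w s = w' s"
  shows "transport_path K J u v a b w s = transport_path K J u v a b w' s"
proof -
  have "w (min 1 (max 0 r)) = w' (min 1 (max 0 r))" for r
    by (rule assms) auto
  then show ?thesis by (simp only: transport_path_def Let_def)
qed

lemma continuous_map_transport_path:
  assumes K: "continuous2 UI A Z K" and J: "continuous2 UI B Z J"
    and u: "continuous_map T UI u" and v: "continuous_map T UI v" and s: "continuous_map T UI s"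
    and a: "continuous_map T A a" and b: "continuous_map T B b"
    and w: "\<And>r. continuous_map T UI r \<Longrightarrow> continuous_map T Z (\<lambda>t. w t (r t))"
    and w0: "\<And>t. t \<in> topspace T \<Longrightarrow> w t 0 = K (u t) (a t)"
    and w1: "\<And>t. t \<in> topspace T \<Longrightarrow> w t 1 = J (u t) (b t)"
  shows "continuous_map T Z (\<lambda>t. transport_path K J (u t) (v t) (a t) (b t) (w t) (s t))"
proof -
  have real: "continuous_map T euclideanreal u" "continuous_map T euclideanreal v" "continuous_map T euclideanreal s"
    and unit: "\<And>t. t \<in> topspace T \<Longrightarrow> 0 \<le> u t \<and> u t \<le> 1 \<and> 0 \<le> v t \<and> v t \<le> 1 \<and> 0 \<le> s t \<and> s t \<le> 1"
    using u v s unfolding continuous_map_UI_iff by auto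
  let ?d = "\<lambda>t. \<bar>u t - v t\<bar>"
  let ?r = "\<lambda>t. s t * (1 + 2 * ?d t)"
  have d: "continuous_map T euclideanreal ?d"
    by (intro continuous_map_real_abs continuous_map_diff real)
  have r: "continuous_map T euclideanreal ?r"
    by (intro continuous_map_real_mult continuous_map_add real d continuous_map_const[THEN iffD2]) auto
  have r0: "0 \<le> ?r t" if "t \<in> topspace T" for t
    using unit[OF that] by simp
  have r1: "0 \<le> 1 + 2 * ?d t - ?r t" if "t \<in> topspace T" for t
  proof -
    have "s t * (1 + 2 * ?d t) \<le> 1 * (1 + 2 * ?d t)"
      by (rule mult_right_mono) (use unit[OF that] in auto)
    then show ?thesis by simp
  qed
  have btw: "continuous_map T UI (\<lambda>t. between (u t) (v t) (e t))"
    if "continuous_map T euclideanreal e" "\<And>t. t \<in> topspace T \<Longrightarrow> 0 \<le> e t" for e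
    unfolding continuous_map_UI_iff
  proof (intro conjI ballI)
    show "continuous_map T euclideanreal (\<lambda>t. between (u t) (v t) (e t))"
      unfolding between_def
      by (intro continuous_map_real_max continuous_map_real_min continuous_map_add continuous_map_diff real that)
  qed (use between_unit that(2) unit in auto)
  have 1: "continuous_map T Z (\<lambda>t. K (between (u t) (v t) (?r t)) (a t))"
    by (rule continuous2_apply[OF K btw[OF r r0] a])
  have 2: "continuous_map T Z (\<lambda>t. w t (min 1 (max 0 (?r t - ?d t))))"
    by (rule w) (auto simp: continuous_map_UI_iff intro!: continuous_map_real_max continuous_map_real_min continuous_map_diff r d)
  have r': "continuous_map T euclideanreal (\<lambda>t. 1 + 2 * ?d t - ?r t)"
    by (intro continuous_map_diff continuous_map_real_mult continuous_map_add r d continuous_map_const[THEN iffD2]) auto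
  have 3: "continuous_map T Z (\<lambda>t. J (between (u t) (v t) (1 + 2 * ?d t - ?r t)) (b t))"
    by (rule continuous2_apply[OF J btw[OF r' r1] b])
  have 23: "continuous_map T Z (\<lambda>t. if ?r t \<le> 1 + ?d t then w t (min 1 (max 0 (?r t - ?d t)))
      else J (between (u t) (v t) (1 + 2 * ?d t - ?r t)) (b t))"
  proof (rule continuous_map_case_le[OF r _ 2 3])
    show "continuous_map T euclideanreal (\<lambda>t. 1 + ?d t)"
      by (intro continuous_map_add d continuous_map_const[THEN iffD2]) auto
    fix t assume t: "t \<in> topspace T" "?r t = 1 + ?d t"
    have e: "1 + 2 * ?d t - ?r t = ?d t" "min 1 (max 0 (?r t - ?d t)) = 1" unfolding t(2) by auto
    show "w t (min 1 (max 0 (?r t - ?d t))) = J (between (u t) (v t) (1 + 2 * ?d t - ?r t)) (b t)"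
      unfolding e between_dist by (rule w1[OF t(1)])
  qed
  show ?thesis
    unfolding transport_path_def Let_def
  proof (rule continuous_map_case_le[OF r d 1 23])
    fix t assume t: "t \<in> topspace T" "?r t = ?d t"
    show "K (between (u t) (v t) (?r t)) (a t) = (if ?r t \<le> 1 + ?d t then w t (min 1 (max 0 (?r t - ?d t)))
      else J (between (u t) (v t) (1 + 2 * ?d t - ?r t)) (b t))"
      unfolding t(2) using w0[OF t(1)] by simp
  qed
qed

definition transport ::
  "(real \<Rightarrow> 'a \<Rightarrow> 'c) \<Rightarrow> (real \<Rightarrow> 'b \<Rightarrow> 'c) \<Rightarrow> real \<Rightarrow> real \<Rightarrow> 'a \<times> 'b \<times> (real \<Rightarrow> 'c) \<Rightarrow> 'a \<times> 'b \<times> (real \<Rightarrow> 'c)" where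
  "transport K J u v x = (fst x, fst (snd x),
     \<lambda>s\<in>{0..1}. transport_path K J u v (fst x) (fst (snd x)) (snd (snd x)) s)"

lemma continuous_map_transport:
  assumes K: "continuous2 UI A Z K" and J: "continuous2 UI B Z J"
    and uv: "u \<in> {0..1}" "v \<in> {0..1}"
  shows "continuous_map (hpb_space A B Z (K u) (J u)) (hpb_space A B Z (K v) (J v)) (transport K J u v)"
  unfolding transport_def
proof (rule continuous_map_into_hpb_space)
  let ?H = "hpb_space A B Z (K u) (J u)"
  have x: "continuous_map (prod_topology ?H UI) ?H fst" by (rule continuous_map_fst)
  show "continuous2 ?H UI Z (\<lambda>x s. transport_path K J u v (fst x) (fst (snd x)) (snd (snd x)) s)"
  proof (rule continuous_map_transport_path[OF K J _ _ continuous_map_snd continuous_map_hpb_fst[OF x] continuous_map_hpb_snd[OF x]])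
    show "continuous_map (prod_topology ?H UI) Z (\<lambda>t. snd (snd (fst t)) (r t))"
      if "continuous_map (prod_topology ?H UI) UI r" for r
      by (rule continuous_map_hpb_path[OF x that])
  qed (use uv in \<open>auto simp: in_topspace_hpb_space\<close>)
  show "continuous_map ?H A fst" "continuous_map ?H B (\<lambda>x. fst (snd x))"
    by (rule continuous_map_hpb_fst[OF continuous_map_self] continuous_map_hpb_snd[OF continuous_map_self])+
qed (auto simp: in_topspace_hpb_space transport_path_start transport_path_end)

text \<open>Let the far end \<open>v\<close> move to \<open>u\<close>: the composites of the two transports form a homotopy which ends
  with two transports over length \<open>0\<close>, that is, with the identity. No path algebra is needed.\<close>

lemma transport_there_and_back:
  assumes K: "continuous2 UI A Z K" and J: "continuous2 UI B Z J"
    and uv: "u \<in> {0..1}" "v \<in> {0..1}"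
  shows "homotopic_maps (hpb_space A B Z (K u) (J u)) (hpb_space A B Z (K u) (J u))
    (transport K J v u \<circ> transport K J u v) id"
proof (rule homotopic_with_symD, rule homotopic_maps_into_hpb_space)
  let ?H = "hpb_space A B Z (K u) (J u)"
  \<comment> \<open>The far end of the transport, moving from \<open>u\<close> to \<open>v\<close>.\<close>
  let ?y = "\<lambda>r. u + (v - u) * r"
  have y: "?y r \<in> {0..1}" if "0 \<le> r" "r \<le> 1" for r
  proof -
    have "?y r = (1 - r) * u + r * v" by (simp add: algebra_simps)
    then show ?thesis
      using uv that convexD_alt[of "{0..1::real}" u v r] by simp
  qed
  show "continuous2 UI ?H A (\<lambda>r x. fst x)"
    by (rule continuous_map_hpb_fst[OF continuous_map_snd])
  show "continuous2 UI ?H B (\<lambda>r x. fst (snd x))"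
    by (rule continuous_map_hpb_snd[OF continuous_map_snd])
  let ?T = "prod_topology (prod_topology UI ?H) UI"
  have x: "continuous_map ?T ?H (\<lambda>z. snd (fst z))"
    by (rule continuous_map_snd_of[OF continuous_map_fst])
  have r: "continuous_map ?T UI (\<lambda>z. fst (fst z))"
    by (rule continuous_map_fst_of[OF continuous_map_fst])
  have yc: "continuous_map ?T UI (\<lambda>z. ?y (fst (fst z)))"
    unfolding continuous_map_UI_iff
  proof (intro conjI ballI)
    have "continuous_map ?T euclideanreal (\<lambda>z. fst (fst z))"
      using r unfolding continuous_map_UI_iff by blast
    then show "continuous_map ?T euclideanreal (\<lambda>z. ?y (fst (fst z)))"
      by (intro continuous_map_add continuous_map_real_mult continuous_map_const[THEN iffD2]) auto
  next
    fix z assume "z \<in> topspace ?T"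
    then have "0 \<le> fst (fst z)" "fst (fst z) \<le> 1" by auto
    from y[OF this] show "0 \<le> ?y (fst (fst z))" "?y (fst (fst z)) \<le> 1" by auto
  qed
  let ?w = "\<lambda>r x s. transport_path K J u (?y r) (fst x) (fst (snd x)) (snd (snd x)) s"
  show "continuous_map ?T Z (\<lambda>z. transport_path K J (?y (fst (fst z))) u (fst (snd (fst z))) (fst (snd (snd (fst z))))
     (?w (fst (fst z)) (snd (fst z))) (snd z))"
  proof (rule continuous_map_transport_path[OF K J yc _ _ continuous_map_hpb_fst[OF x] continuous_map_hpb_snd[OF x]])
    fix s assume s: "continuous_map ?T UI s"
    show "continuous_map ?T Z (\<lambda>z. ?w (fst (fst z)) (snd (fst z)) (s z))"
    proof (rule continuous_map_transport_path[OF K J _ yc s continuous_map_hpb_fst[OF x] continuous_map_hpb_snd[OF x]])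
      show "continuous_map ?T Z (\<lambda>t. snd (snd (snd (fst t))) (r t))" if "continuous_map ?T UI r" for r
        by (rule continuous_map_hpb_path[OF x that])
    qed (use uv in \<open>auto simp: in_topspace_hpb_space\<close>)
  qed (use uv in \<open>auto simp: in_topspace_hpb_space transport_path_start transport_path_end continuous_map_snd\<close>)
  have start: "?w r x 0 = K (?y r) (fst x)" for r x
    by (simp add: transport_path_start)
  have "end": "?w r x 1 = J (?y r) (fst (snd x))" if "x \<in> topspace ?H" for r x
    by (rule transport_path_end) (use that in \<open>simp add: in_topspace_hpb_space\<close>)
  fix x assume x: "x \<in> topspace ?H"
  show "transport_path K J (?y r) u (fst x) (fst (snd x)) (?w r x) 0 = K u (fst x)" for r
    by (simp add: transport_path_start)
  show "transport_path K J (?y r) u (fst x) (fst (snd x)) (?w r x) 1 = J u (fst (snd x))" for r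
    by (rule transport_path_end, rule "end"[OF x])
  have w0: "snd (snd x) 0 = K u (fst x)" and ext: "snd (snd x) \<in> extensional {0..1}"
    using x by (auto simp: in_topspace_hpb_space)
  have "transport_path K J (?y 0) u (fst x) (fst (snd x)) (?w 0 x) s = snd (snd x) s" if s: "s \<in> {0..1}" for s
    using s w0 by (simp add: transport_path_same start[of 0, simplified])
  then show "id x = (fst x, fst (snd x), \<lambda>s\<in>{0..1}. transport_path K J (?y 0) u (fst x) (fst (snd x)) (?w 0 x) s)"
    using ext by (simp add: prod_eq_iff extensional_def fun_eq_iff)
  show "(transport K J v u \<circ> transport K J u v) x =
     (fst x, fst (snd x), \<lambda>s\<in>{0..1}. transport_path K J (?y 1) u (fst x) (fst (snd x)) (?w 1 x) s)"
    by (auto simp: transport_def intro!: restrict_ext transport_path_cong)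
qed

text \<open>Homotopic cospans have equivalent homotopy pullbacks.\<close>

lemma he_transport:
  assumes "continuous2 UI A Z K" "continuous2 UI B Z J" "u \<in> {0..1}" "v \<in> {0..1}"
  shows "homotopy_equivalence_map (hpb_space A B Z (K u) (J u)) (hpb_space A B Z (K v) (J v)) (transport K J u v)"
  unfolding homotopy_equivalence_map_def
  using assms continuous_map_transport[OF assms(1,2)] transport_there_and_back[OF assms(1,2)] by blast

definition hpb_map :: "('a \<Rightarrow> 'a2) \<Rightarrow> ('b \<Rightarrow> 'b2) \<Rightarrow> ('c \<Rightarrow> 'c2) \<Rightarrow>
    'a \<times> 'b \<times> (real \<Rightarrow> 'c) \<Rightarrow> 'a2 \<times> 'b2 \<times> (real \<Rightarrow> 'c2)" where
  "hpb_map p q r x = (p (fst x), q (fst (snd x)), \<lambda>s\<in>{0..1}. r (snd (snd x) s))"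

lemma continuous_map_hpb_map:
  assumes p: "continuous_map A A' p" and q: "continuous_map B B' q" and r: "continuous_map Z Z' r"
    and f: "\<And>a. a \<in> topspace A \<Longrightarrow> r (f a) = f' (p a)"
    and g: "\<And>b. b \<in> topspace B \<Longrightarrow> r (g b) = g' (q b)"
  shows "continuous_map (hpb_space A B Z f g) (hpb_space A' B' Z' f' g') (hpb_map p q r)"
  unfolding hpb_map_def
proof (rule continuous_map_into_hpb_space)
  let ?H = "hpb_space A B Z f g"
  show "continuous_map ?H A' (\<lambda>x. p (fst x))" "continuous_map ?H B' (\<lambda>x. q (fst (snd x)))"
    by (rule continuous_map_compose'[OF p continuous_map_hpb_fst[OF continuous_map_self]]
        continuous_map_compose'[OF q continuous_map_hpb_snd[OF continuous_map_self]])+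
  show "continuous2 ?H UI Z' (\<lambda>x s. r (snd (snd x) s))"
    by (rule continuous_map_compose'[OF r continuous_map_hpb_path[OF continuous_map_fst continuous_map_snd]])
qed (auto simp: in_topspace_hpb_space f g)

lemma hpb_map_comp: "hpb_map p q r \<circ> hpb_map p' q' r' = hpb_map (p \<circ> p') (q \<circ> q') (r \<circ> r')"
  by (auto simp: hpb_map_def fun_eq_iff)

text \<open>With a homotopy from \<open>m\<close> and \<open>n\<close> to the identities, the map deforms into a transport along the
  induced homotopy of the legs, which is an equivalence.\<close>

lemma he_hpb_map_homotopic_id_corners:
  assumes f: "continuous_map A Z f" and g: "continuous_map B Z g"
    and m: "homotopic_maps A A m id" and n: "homotopic_maps B B n id"
  shows "homotopy_equivalence_map (hpb_space A B Z (f \<circ> m) (g \<circ> n)) (hpb_space A B Z f g) (hpb_map m n id)"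
proof -
  obtain M where M: "continuous2 UI A A M" "\<And>x. M 0 x = m x" "\<And>x. M 1 x = x"
    using homotopic_mapsE[OF m] by (metis id_apply)
  obtain N where N: "continuous2 UI B B N" "\<And>x. N 0 x = n x" "\<And>x. N 1 x = x"
    using homotopic_mapsE[OF n] by (metis id_apply)
  define K where "K v a = f (M v a)" for v a
  define J where "J v b = g (N v b)" for v b
  have K: "continuous2 UI A Z K" unfolding K_def by (rule continuous_map_compose'[OF f M(1)])
  have J: "continuous2 UI B Z J" unfolding J_def by (rule continuous_map_compose'[OF g N(1)])
  have K01: "K 0 = f \<circ> m" "K 1 = f" and J01: "J 0 = g \<circ> n" "J 1 = g"
    by (auto simp: K_def J_def M N)
  let ?H = "hpb_space A B Z (f \<circ> m) (g \<circ> n)"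
  have tr: "homotopy_equivalence_map ?H (hpb_space A B Z f g) (transport K J 0 1)"
    using he_transport[OF K J, of 0 1] by (simp add: K01 J01 comp_def)
  have "homotopic_maps ?H (hpb_space A B Z f g) (transport K J 0 1) (hpb_map m n id)"
  proof (rule homotopic_with_symD, rule homotopic_maps_into_hpb_space)
    let ?P = "prod_topology UI ?H"
    have x: "continuous_map ?P ?H snd" by (rule continuous_map_snd)
    show "continuous2 UI ?H A (\<lambda>v x. M v (fst x))"
      by (rule continuous2_apply[OF M(1) continuous_map_fst continuous_map_hpb_fst[OF x]])
    show "continuous2 UI ?H B (\<lambda>v x. N v (fst (snd x)))"
      by (rule continuous2_apply[OF N(1) continuous_map_fst continuous_map_hpb_snd[OF x]])
    let ?T = "prod_topology ?P UI"
    have y: "continuous_map ?T ?H (\<lambda>z. snd (fst z))"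
      by (rule continuous_map_snd_of[OF continuous_map_fst])
    show "continuous_map ?T Z (\<lambda>z. transport_path K J 0 (fst (fst z)) (fst (snd (fst z)))
       (fst (snd (snd (fst z)))) (snd (snd (snd (fst z)))) (snd z))"
    proof (rule continuous_map_transport_path[OF K J _ continuous_map_fst_of[OF continuous_map_fst]
            continuous_map_snd continuous_map_hpb_fst[OF y] continuous_map_hpb_snd[OF y]])
      show "continuous_map ?T Z (\<lambda>t. snd (snd (snd (fst t))) (r t))" if "continuous_map ?T UI r" for r
        by (rule continuous_map_hpb_path[OF y that])
    qed (auto simp: in_topspace_hpb_space K01 J01)
    fix x assume x: "x \<in> topspace ?H"
    show "transport_path K J 0 u (fst x) (fst (snd x)) (snd (snd x)) 0 = f (M u (fst x))" for u
      by (simp add: transport_path_start K_def)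
    show "transport_path K J 0 u (fst x) (fst (snd x)) (snd (snd x)) 1 = g (N u (fst (snd x)))" for u
      using x by (subst transport_path_end) (auto simp: in_topspace_hpb_space J_def N)
    show "hpb_map m n id x = (M 0 (fst x), N 0 (fst (snd x)),
        \<lambda>s\<in>{0..1}. transport_path K J 0 0 (fst x) (fst (snd x)) (snd (snd x)) s)"
      using x by (auto simp: hpb_map_def M N in_topspace_hpb_space K01 J01 transport_path_same intro!: restrict_ext)
    show "transport K J 0 1 x = (M 1 (fst x), N 1 (fst (snd x)),
        \<lambda>s\<in>{0..1}. transport_path K J 0 1 (fst x) (fst (snd x)) (snd (snd x)) s)"
      by (simp add: transport_def M N)
  qed
  with tr show ?thesis by (rule he_homotopic)
qed

text \<open>Apply a homotopy from \<open>m\<close> to the identity for time \<open>v\<close> to the path and transport the result back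
  to time \<open>0\<close>: this deforms the map into a transport.\<close>

lemma he_hpb_map_homotopic_id_base:
  assumes f: "continuous_map A Z f" and g: "continuous_map B Z g" and m: "homotopic_maps Z Z m id"
  shows "homotopy_equivalence_map (hpb_space A B Z f g) (hpb_space A B Z (m \<circ> f) (m \<circ> g)) (hpb_map id id m)"
proof -
  obtain M where M: "continuous2 UI Z Z M" "\<And>x. M 0 x = m x" "\<And>x. M 1 x = x"
    using homotopic_mapsE[OF m] by (metis id_apply)
  define K where "K v a = M v (f a)" for v a
  define J where "J v b = M v (g b)" for v b
  have K: "continuous2 UI A Z K" unfolding K_def
    by (rule continuous2_apply[OF M(1) continuous_map_fst continuous_map_compose'[OF f continuous_map_snd]])
  have J: "continuous2 UI B Z J" unfolding J_def
    by (rule continuous2_apply[OF M(1) continuous_map_fst continuous_map_compose'[OF g continuous_map_snd]])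
  have K01: "K 0 = m \<circ> f" "K 1 = f" and J01: "J 0 = m \<circ> g" "J 1 = g"
    by (auto simp: K_def J_def M)
  let ?H = "hpb_space A B Z f g" and ?H' = "hpb_space A B Z (m \<circ> f) (m \<circ> g)"
  have tr: "homotopy_equivalence_map ?H ?H' (transport K J 1 0)"
    using he_transport[OF K J, of 1 0] by (simp add: K01 J01 comp_def)
  have "homotopic_maps ?H ?H' (transport K J 1 0) (hpb_map id id m)"
  proof (rule homotopic_with_symD, rule homotopic_maps_into_hpb_space)
    show "continuous2 UI ?H A (\<lambda>v x. fst x)"
      by (rule continuous_map_hpb_fst[OF continuous_map_snd])
    show "continuous2 UI ?H B (\<lambda>v x. fst (snd x))"
      by (rule continuous_map_hpb_snd[OF continuous_map_snd])
    let ?T = "prod_topology (prod_topology UI ?H) UI"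
    have y: "continuous_map ?T ?H (\<lambda>z. snd (fst z))"
      by (rule continuous_map_snd_of[OF continuous_map_fst])
    have v: "continuous_map ?T UI (\<lambda>z. fst (fst z))"
      by (rule continuous_map_fst_of[OF continuous_map_fst])
    show "continuous_map ?T Z (\<lambda>z. transport_path K J (fst (fst z)) 0 (fst (snd (fst z)))
       (fst (snd (snd (fst z)))) (\<lambda>s. M (fst (fst z)) (snd (snd (snd (fst z))) s)) (snd z))"
    proof (rule continuous_map_transport_path[OF K J v _
            continuous_map_snd continuous_map_hpb_fst[OF y] continuous_map_hpb_snd[OF y]])
      show "continuous_map ?T Z (\<lambda>z. M (fst (fst z)) (snd (snd (snd (fst z))) (r z)))"
        if "continuous_map ?T UI r" for r
        by (rule continuous2_apply[OF M(1) v continuous_map_hpb_path[OF y that]])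
    qed (auto simp: in_topspace_hpb_space K_def J_def)
    fix x assume x: "x \<in> topspace ?H"
    show "transport_path K J u 0 (fst x) (fst (snd x)) (\<lambda>s. M u (snd (snd x) s)) 0 = (m \<circ> f) (fst x)" for u
      by (simp add: transport_path_start K01)
    show "transport_path K J u 0 (fst x) (fst (snd x)) (\<lambda>s. M u (snd (snd x) s)) 1 = (m \<circ> g) (fst (snd x))" for u
      using x by (subst transport_path_end) (auto simp: in_topspace_hpb_space J_def M)
    show "hpb_map id id m x = (fst x, fst (snd x),
        \<lambda>s\<in>{0..1}. transport_path K J 0 0 (fst x) (fst (snd x)) (\<lambda>s. M 0 (snd (snd x) s)) s)"
      using x by (auto simp: hpb_map_def M in_topspace_hpb_space K01 J01 transport_path_same intro!: restrict_ext)
    show "transport K J 1 0 x = (fst x, fst (snd x),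
        \<lambda>s\<in>{0..1}. transport_path K J 1 0 (fst x) (fst (snd x)) (\<lambda>s. M 1 (snd (snd x) s)) s)"
      by (simp add: transport_def M)
  qed
  with tr show ?thesis by (rule he_homotopic)
qed

text \<open>Alternate the given maps with homotopy inverses, over the cospans with correspondingly longer legs.
  The composites of two neighbours are induced by maps homotopic to identities, so two-out-of-six
  applies.\<close>

lemma he_hpb_map_corners:
  assumes f: "continuous_map A Z f" and g: "continuous_map B Z g"
    and p: "homotopy_equivalence_map A' A p" and q: "homotopy_equivalence_map B' B q"
  shows "homotopy_equivalence_map (hpb_space A' B' Z (f \<circ> p) (g \<circ> q)) (hpb_space A B Z f g) (hpb_map p q id)"
proof -
  obtain p' where p': "homotopy_equivalence_map A A' p'" "homotopic_maps A' A' (p' \<circ> p) id" "homotopic_maps A A (p \<circ> p') id"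
    using he_inverse[OF p] by metis
  obtain q' where q': "homotopy_equivalence_map B B' q'" "homotopic_maps B' B' (q' \<circ> q) id" "homotopic_maps B B (q \<circ> q') id"
    using he_inverse[OF q] by metis
  note c = he_continuous[OF p] he_continuous[OF q] he_continuous[OF p'(1)] he_continuous[OF q'(1)]
  have fp: "continuous_map A' Z (f \<circ> p)" and gq: "continuous_map B' Z (g \<circ> q)"
    using continuous_map_compose f g c by blast+
  let ?H1 = "hpb_space A' B' Z (f \<circ> p \<circ> (p' \<circ> p)) (g \<circ> q \<circ> (q' \<circ> q))"
  let ?H2 = "hpb_space A B Z (f \<circ> (p \<circ> p')) (g \<circ> (q \<circ> q'))"
  let ?H3 = "hpb_space A' B' Z (f \<circ> p) (g \<circ> q)"
  let ?H4 = "hpb_space A B Z f g"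
  have c1: "continuous_map ?H1 ?H2 (hpb_map p q id)" and c2: "continuous_map ?H2 ?H3 (hpb_map p' q' id)"
    and c3: "continuous_map ?H3 ?H4 (hpb_map p q id)"
    by (rule continuous_map_hpb_map; use c in simp)+
  have h: "homotopy_equivalence_map ?H1 ?H3 (hpb_map p' q' id \<circ> hpb_map p q id)"
    "homotopy_equivalence_map ?H2 ?H4 (hpb_map p q id \<circ> hpb_map p' q' id)"
    unfolding hpb_map_comp id_comp
    by (rule he_hpb_map_homotopic_id_corners f g fp gq p' q')+
  \<comment> \<open>Once the middle map is an equivalence, so is the right neighbour by cancellation.\<close>
  have "homotopy_equivalence_map ?H2 ?H3 (hpb_map p' q' id)"
    by (rule he_two_of_six_middle[OF c1 c2 c3 h])
  then show ?thesis
    by (rule he_cancel_right[OF c3 _ h(2)])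
qed

text \<open>The same alternation as for the corners, now in the common target of the two legs.\<close>

lemma he_hpb_map_base:
  assumes f: "continuous_map A Z f" and g: "continuous_map B Z g" and r: "homotopy_equivalence_map Z Z' r"
  shows "homotopy_equivalence_map (hpb_space A B Z f g) (hpb_space A B Z' (r \<circ> f) (r \<circ> g)) (hpb_map id id r)"
proof -
  obtain r' where r': "homotopy_equivalence_map Z' Z r'" "homotopic_maps Z Z (r' \<circ> r) id" "homotopic_maps Z' Z' (r \<circ> r') id"
    using he_inverse[OF r] by metis
  note c = he_continuous[OF r] he_continuous[OF r'(1)]
  have rf: "continuous_map A Z' (r \<circ> f)" and rg: "continuous_map B Z' (r \<circ> g)"
    using continuous_map_compose f g c by blast+
  let ?H1 = "hpb_space A B Z f g"
  let ?H2 = "hpb_space A B Z' (r \<circ> f) (r \<circ> g)"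
  let ?H3 = "hpb_space A B Z ((r' \<circ> r) \<circ> f) ((r' \<circ> r) \<circ> g)"
  let ?H4 = "hpb_space A B Z' ((r \<circ> r') \<circ> (r \<circ> f)) ((r \<circ> r') \<circ> (r \<circ> g))"
  have c1: "continuous_map ?H1 ?H2 (hpb_map id id r)" and c2: "continuous_map ?H2 ?H3 (hpb_map id id r')"
    and c3: "continuous_map ?H3 ?H4 (hpb_map id id r)"
    by (rule continuous_map_hpb_map; use c in simp)+
  have h: "homotopy_equivalence_map ?H1 ?H3 (hpb_map id id r' \<circ> hpb_map id id r)"
    "homotopy_equivalence_map ?H2 ?H4 (hpb_map id id r \<circ> hpb_map id id r')"
    unfolding hpb_map_comp id_comp
    by (rule he_hpb_map_homotopic_id_base f g rf rg r')+
  have "homotopy_equivalence_map ?H2 ?H3 (hpb_map id id r')"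
    by (rule he_two_of_six_middle[OF c1 c2 c3 h])
  then show ?thesis
    by (rule he_cancel_left[OF c1 _ h(1)])
qed

text \<open>The three kinds of change combine: replace the target \<open>Z'\<close>, slide the legs along the homotopies
  \<open>K\<close> and \<open>J\<close>, and replace the two corners.\<close>

lemma he_hpb_homotopy_invariance:
  assumes f': "continuous_map A' Z' f'" and g': "continuous_map B' Z' g'"
    and f: "continuous_map A Z f" and g: "continuous_map B Z g"
    and p: "homotopy_equivalence_map A' A p" and q: "homotopy_equivalence_map B' B q"
    and r: "homotopy_equivalence_map Z' Z r"
    and K: "continuous2 UI A' Z K" and J: "continuous2 UI B' Z J"
    and K0: "\<And>a. a \<in> topspace A' \<Longrightarrow> K 0 a = r (f' a)" and K1: "\<And>a. a \<in> topspace A' \<Longrightarrow> K 1 a = f (p a)"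
    and J0: "\<And>b. b \<in> topspace B' \<Longrightarrow> J 0 b = r (g' b)" and J1: "\<And>b. b \<in> topspace B' \<Longrightarrow> J 1 b = g (q b)"
  shows "homotopy_equivalence_map (hpb_space A' B' Z' f' g') (hpb_space A B Z f g)
    (hpb_map p q id \<circ> (transport K J 0 1 \<circ> hpb_map id id r))"
proof (intro he_comp)
  have "hpb_space A' B' Z (r \<circ> f') (r \<circ> g') = hpb_space A' B' Z (K 0) (J 0)"
    by (rule hpb_space_cong) (auto simp: K0 J0)
  then show "homotopy_equivalence_map (hpb_space A' B' Z' f' g') (hpb_space A' B' Z (K 0) (J 0)) (hpb_map id id r)"
    using he_hpb_map_base[OF f' g' r] by simp
  show "homotopy_equivalence_map (hpb_space A' B' Z (K 0) (J 0)) (hpb_space A' B' Z (K 1) (J 1)) (transport K J 0 1)"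
    by (rule he_transport[OF K J]) auto
  have "hpb_space A' B' Z (f \<circ> p) (g \<circ> q) = hpb_space A' B' Z (K 1) (J 1)"
    by (rule hpb_space_cong) (auto simp: K1 J1)
  then show "homotopy_equivalence_map (hpb_space A' B' Z (K 1) (J 1)) (hpb_space A B Z f g) (hpb_map p q id)"
    using he_hpb_map_corners[OF f g p q] by simp
qed

section \<open>Coherent squares and strictly commuting squares\<close>

abbreviation constant_cone :: "('p \<Rightarrow> 'a) \<Rightarrow> ('p \<Rightarrow> 'b) \<Rightarrow> ('a \<Rightarrow> 'c) \<Rightarrow> 'p \<Rightarrow> 'a \<times> 'b \<times> (real \<Rightarrow> 'c)" where
  "constant_cone p q f \<equiv> \<lambda>x. (p x, q x, \<lambda>s\<in>{0..1}. f (p x))"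

text \<open>A strictly commuting square is compared with the homotopy pullback by constant paths.\<close>

definition strict_hpb ::
  "'p topology \<Rightarrow> 'a topology \<Rightarrow> 'b topology \<Rightarrow> 'c topology \<Rightarrow> ('p \<Rightarrow> 'a) \<Rightarrow> ('p \<Rightarrow> 'b) \<Rightarrow>
   ('a \<Rightarrow> 'c) \<Rightarrow> ('b \<Rightarrow> 'c) \<Rightarrow> bool" where
  "strict_hpb P A B Z p q f g \<longleftrightarrow> homotopy_pullback P A B Z p q f g (\<lambda>s x. f (p x))"

definition commuting_square ::
  "'p topology \<Rightarrow> 'a topology \<Rightarrow> 'b topology \<Rightarrow> 'c topology \<Rightarrow> ('p \<Rightarrow> 'a) \<Rightarrow> ('p \<Rightarrow> 'b) \<Rightarrow>
   ('a \<Rightarrow> 'c) \<Rightarrow> ('b \<Rightarrow> 'c) \<Rightarrow> bool" where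
  "commuting_square P A B Z p q f g \<longleftrightarrow>
     continuous_map P A p \<and> continuous_map P B q \<and> continuous_map A Z f \<and> continuous_map B Z g \<and>
     (\<forall>x\<in>topspace P. f (p x) = g (q x))"

lemma strict_hpb_iff:
  "strict_hpb P A B Z p q f g \<longleftrightarrow> commuting_square P A B Z p q f g \<and>
     homotopy_equivalence_map P (hpb_space A B Z f g) (constant_cone p q f)"
proof -
  have "continuous_map (prod_topology UI P) Z (\<lambda>(s, x). f (p x))"
    if "continuous_map P A p" "continuous_map A Z f"
    using continuous_map_compose'[OF continuous_map_compose'[OF that(2,1)] continuous_map_snd]
    by (simp add: case_prod_unfold)
  then show ?thesis
    unfolding strict_hpb_def homotopy_pullback_def commuting_square_def by auto
qed

lemma continuous_map_constant_cone:
  assumes "commuting_square P A B Z p q f g"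
  shows "continuous_map P (hpb_space A B Z f g) (constant_cone p q f)"
proof (rule continuous_map_into_hpb_space)
  show "continuous2 P UI Z (\<lambda>x s. f (p x))"
    using assms unfolding commuting_square_def
    by (blast intro: continuous_map_compose'[OF continuous_map_compose' continuous_map_fst])
qed (use assms in \<open>auto simp: commuting_square_def\<close>)

lemma homotopy_pullback_cong:
  assumes "\<And>x. x \<in> topspace P \<Longrightarrow> p x = p' x" "\<And>x. x \<in> topspace P \<Longrightarrow> q x = q' x"
    and "\<And>a. a \<in> topspace A \<Longrightarrow> f a = f' a" "\<And>b. b \<in> topspace B \<Longrightarrow> g b = g' b"
    and "\<And>s x. 0 \<le> s \<Longrightarrow> s \<le> 1 \<Longrightarrow> x \<in> topspace P \<Longrightarrow> H s x = H' s x"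
    and h: "homotopy_pullback P A B Z p q f g H"
  shows "homotopy_pullback P A B Z p' q' f' g' H'"
proof -
  have Heq: "continuous_map (prod_topology UI P) Z (\<lambda>(s, x). H' s x)"
    by (rule continuous_map_eq[of _ _ "\<lambda>(s, x). H s x"])
       (use assms(5) h in \<open>auto simp: homotopy_pullback_def\<close>)
  have e: "hpb_space A B Z f' g' = hpb_space A B Z f g"
    by (rule hpb_space_cong) (auto simp: assms)
  have he: "homotopy_equivalence_map P (hpb_space A B Z f' g') (\<lambda>x. (p' x, q' x, \<lambda>s\<in>{0..1}. H' s x))"
    unfolding e
    by (rule he_cong[of _ _ "\<lambda>x. (p x, q x, \<lambda>s\<in>{0..1}. H s x)"])
       (use h assms(1,2,5) in \<open>auto simp: homotopy_pullback_def intro!: restrict_ext\<close>)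
  have c: "continuous_map P A p'" "continuous_map P B q'" "continuous_map A Z f'" "continuous_map B Z g'"
    using h assms(1-4) unfolding homotopy_pullback_def by (auto intro: continuous_map_eq)
  have "p x \<in> topspace A" "q x \<in> topspace B" if "x \<in> topspace P" for x
    using h that unfolding homotopy_pullback_def by (auto dest: continuous_map_funspace)
  then have "\<forall>x\<in>topspace P. H' 0 x = f' (p' x) \<and> H' 1 x = g' (q' x)"
    using h assms(1-4) unfolding homotopy_pullback_def by (auto simp flip: assms(5))
  with Heq he c show ?thesis unfolding homotopy_pullback_def by blast
qed

text \<open>The primed square commutes strictly and maps to the other square by homotopy equivalences. On the
  edges of the squares these maps are natural up to the homotopies \<open>K\<close>, \<open>J\<close>, \<open>M\<close>, \<open>N\<close>, and the
  two-parameter families \<open>L\<close> and \<open>R\<close> say that these homotopies fit together with \<open>H\<close>, each filling one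
  half of the square cut along its diagonal. The equivalence of the homotopy pullbacks induced by
  \<open>K\<close> and \<open>J\<close> then matches the two comparison maps up to a homotopy made from \<open>L\<close> and \<open>R\<close>.\<close>

lemma homotopy_pullback_strictification:
  fixes H :: "real \<Rightarrow> 'p \<Rightarrow> 'c" and L R :: "real \<Rightarrow> real \<Rightarrow> 'p2 \<Rightarrow> 'c"
  assumes strict: "commuting_square P' A' B' Z' p' q' f' g'"
    and c: "continuous_map P A p" "continuous_map P B q" "continuous_map A Z f" "continuous_map B Z g"
    and H: "continuous2 UI P Z H" "\<And>x. x \<in> topspace P \<Longrightarrow> H 0 x = f (p x)" "\<And>x. x \<in> topspace P \<Longrightarrow> H 1 x = g (q x)"
    and eP: "homotopy_equivalence_map P' P eP" and eA: "homotopy_equivalence_map A' A eA"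
    and eB: "homotopy_equivalence_map B' B eB" and eZ: "homotopy_equivalence_map Z' Z eZ"
    and K: "continuous2 UI A' Z K" and J: "continuous2 UI B' Z J"
    and K0: "\<And>a. a \<in> topspace A' \<Longrightarrow> K 0 a = eZ (f' a)" and K1: "\<And>a. a \<in> topspace A' \<Longrightarrow> K 1 a = f (eA a)"
    and J0: "\<And>b. b \<in> topspace B' \<Longrightarrow> J 0 b = eZ (g' b)" and J1: "\<And>b. b \<in> topspace B' \<Longrightarrow> J 1 b = g (eB b)"
    and M: "continuous2 UI P' A M" and N: "continuous2 UI P' B N"
    and M0: "\<And>x. x \<in> topspace P' \<Longrightarrow> M 0 x = eA (p' x)" and M1: "\<And>x. x \<in> topspace P' \<Longrightarrow> M 1 x = p (eP x)"
    and N0: "\<And>x. x \<in> topspace P' \<Longrightarrow> N 0 x = eB (q' x)" and N1: "\<And>x. x \<in> topspace P' \<Longrightarrow> N 1 x = q (eP x)"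
    and L: "continuous2 (prod_topology UI UI) P' Z (\<lambda>y. L (fst y) (snd y))"
    and R: "continuous2 (prod_topology UI UI) P' Z (\<lambda>y. R (fst y) (snd y))"
    and L0: "\<And>t x. \<lbrakk>0 \<le> t; t \<le> 1; x \<in> topspace P'\<rbrakk> \<Longrightarrow> L 0 t x = K t (p' x)"
    and R0: "\<And>t x. \<lbrakk>0 \<le> t; t \<le> 1; x \<in> topspace P'\<rbrakk> \<Longrightarrow> R 0 t x = J t (q' x)"
    and L1: "\<And>u x. \<lbrakk>0 \<le> u; u \<le> 1; x \<in> topspace P'\<rbrakk> \<Longrightarrow> L u 1 x = f (M u x)"
    and R1: "\<And>u x. \<lbrakk>0 \<le> u; u \<le> 1; x \<in> topspace P'\<rbrakk> \<Longrightarrow> R u 1 x = g (N u x)"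
    and LR: "\<And>u x. \<lbrakk>0 \<le> u; u \<le> 1; x \<in> topspace P'\<rbrakk> \<Longrightarrow> L u 0 x = R u 0 x"
    and LH: "\<And>s x. \<lbrakk>0 \<le> s; s \<le> 1/2; x \<in> topspace P'\<rbrakk> \<Longrightarrow> L 1 (1 - 2 * s) x = H s (eP x)"
    and RH: "\<And>s x. \<lbrakk>1/2 \<le> s; s \<le> 1; x \<in> topspace P'\<rbrakk> \<Longrightarrow> R 1 (2 * s - 1) x = H s (eP x)"
  shows "homotopy_pullback P A B Z p q f g H \<longleftrightarrow> strict_hpb P' A' B' Z' p' q' f' g'"
proof -
  let ?G' = "hpb_space A' B' Z' f' g'" and ?G = "hpb_space A B Z f g"
  let ?cone = "\<lambda>x. (p x, q x, \<lambda>s\<in>{0..1}. H s x)"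
  let ?\<Phi> = "hpb_map eA eB id \<circ> (transport K J 0 1 \<circ> hpb_map id id eZ)"
  have c': "continuous_map P' A' p'" "continuous_map P' B' q'" "continuous_map A' Z' f'" "continuous_map B' Z' g'"
    and comm: "\<And>x. x \<in> topspace P' \<Longrightarrow> f' (p' x) = g' (q' x)"
    using strict unfolding commuting_square_def by auto
  have inP: "p' x \<in> topspace A'" "q' x \<in> topspace B'" "eP x \<in> topspace P" if "x \<in> topspace P'" for x
    using that c' he_continuous[OF eP] by (auto dest: continuous_map_funspace)
  have \<Phi>: "homotopy_equivalence_map ?G' ?G ?\<Phi>"
    by (rule he_hpb_homotopy_invariance[OF c'(3,4) c(3,4) eA eB eZ K J K0 K1 J0 J1])
  have cone: "continuous_map P ?G ?cone"
  proof (rule continuous_map_into_hpb_space[OF c(1,2)])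
    show "continuous2 P UI Z (\<lambda>x s. H s x)"
      by (rule continuous2_apply[OF H(1) continuous_map_snd continuous_map_fst])
  qed (use H in auto)
  have cone': "continuous_map P' ?G' (constant_cone p' q' f')"
    by (rule continuous_map_constant_cone[OF strict])
  \<comment> \<open>The parameters \<open>l\<close> and \<open>r\<close> interpolate between the thirds in which a transported path is traversed
    and the halves of a square filler.\<close>
  define l where "l u s = (1 - u) * max 0 (1 - 3 * s) + u * max 0 (1 - 2 * s)" for u s :: real
  define r where "r u s = (1 - u) * max 0 (3 * s - 2) + u * max 0 (2 * s - 1)" for u s :: real
  have convex_unit: "0 \<le> (1 - u) * x + u * y \<and> (1 - u) * x + u * y \<le> 1"
    if "0 \<le> u" "u \<le> 1" "0 \<le> x" "x \<le> 1" "0 \<le> y" "y \<le> 1" for u x y :: real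
    using convexD_alt[of "{0..1::real}" x y u] that by simp
  have lr: "0 \<le> l u s \<and> l u s \<le> 1 \<and> 0 \<le> r u s \<and> r u s \<le> 1" if "0 \<le> u" "u \<le> 1" "0 \<le> s" "s \<le> 1" for u s
    unfolding l_def r_def using convex_unit[OF that(1,2)] that by auto
  have hom: "homotopic_maps P' ?G (?\<Phi> \<circ> constant_cone p' q' f') (?cone \<circ> eP)"
  proof (rule homotopic_maps_into_hpb_space[OF M N])
    let ?T = "prod_topology (prod_topology UI P') UI"
    have u: "continuous_map ?T UI (\<lambda>z. fst (fst z))" and x: "continuous_map ?T P' (\<lambda>z. snd (fst z))"
      and s: "continuous_map ?T UI snd"
      by (rule continuous_map_fst_of[OF continuous_map_fst] continuous_map_snd_of[OF continuous_map_fst] continuous_map_snd)+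
    have ru: "continuous_map ?T euclideanreal (\<lambda>z. fst (fst z))" and rs: "continuous_map ?T euclideanreal snd"
      using u s unfolding continuous_map_UI_iff by auto
    have lc: "continuous_map ?T UI (\<lambda>z. l (fst (fst z)) (snd z))"
      unfolding continuous_map_UI_iff
    proof (intro conjI ballI)
      show "continuous_map ?T euclideanreal (\<lambda>z. l (fst (fst z)) (snd z))"
        unfolding l_def
        by (intro continuous_map_add continuous_map_diff continuous_map_real_mult continuous_map_real_max ru rs
            continuous_map_const[THEN iffD2] disjI2) simp_all
    qed (use lr in auto)
    have rc: "continuous_map ?T UI (\<lambda>z. r (fst (fst z)) (snd z))"
      unfolding continuous_map_UI_iff
    proof (intro conjI ballI)
      show "continuous_map ?T euclideanreal (\<lambda>z. r (fst (fst z)) (snd z))"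
        unfolding r_def
        by (intro continuous_map_add continuous_map_diff continuous_map_real_mult continuous_map_real_max ru rs
            continuous_map_const[THEN iffD2] disjI2) simp_all
    qed (use lr in auto)
    show "continuous_map ?T Z (\<lambda>z. if snd z \<le> 1/2 then L (fst (fst z)) (l (fst (fst z)) (snd z)) (snd (fst z))
        else R (fst (fst z)) (r (fst (fst z)) (snd z)) (snd (fst z)))"
    proof (rule continuous_map_case_le[OF rs])
      show "continuous_map ?T Z (\<lambda>z. L (fst (fst z)) (l (fst (fst z)) (snd z)) (snd (fst z)))"
        using continuous2_apply[OF L continuous_map_pairedI[OF u lc] x] by simp
      show "continuous_map ?T Z (\<lambda>z. R (fst (fst z)) (r (fst (fst z)) (snd z)) (snd (fst z)))"
        using continuous2_apply[OF R continuous_map_pairedI[OF u rc] x] by simp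
      fix z assume z: "z \<in> topspace ?T" "snd z = 1/2"
      have e: "l (fst (fst z)) (snd z) = 0" "r (fst (fst z)) (snd z) = 0"
        unfolding l_def r_def z(2) by auto
      show "L (fst (fst z)) (l (fst (fst z)) (snd z)) (snd (fst z)) = R (fst (fst z)) (r (fst (fst z)) (snd z)) (snd (fst z))"
        unfolding e by (rule LR) (use z in auto)
    qed simp
    fix x assume x: "x \<in> topspace P'"
    have l0: "l u 0 = 1" and r1: "r u 1 = 1" for u
      by (simp_all add: l_def r_def)
    show "(if 0 \<le> (1/2::real) then L u (l u 0) x else R u (r u 0) x) = f (M u x)" if "0 \<le> u" "u \<le> 1" for u
      using that x by (simp add: l0 L1)
    show "(if 1 \<le> (1/2::real) then L u (l u 1) x else R u (r u 1) x) = g (N u x)" if "0 \<le> u" "u \<le> 1" for u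
      using that x by (simp add: r1 R1)
    have half: "(if s \<le> 1/2 then L 1 (l 1 s) x else R 1 (r 1 s) x) = H s (eP x)" if s: "0 \<le> s" "s \<le> 1" for s
    proof (cases "s \<le> 1/2")
      case True
      then have "l 1 s = 1 - 2 * s" by (simp add: l_def)
      then show ?thesis using True LH s x by simp
    next
      case False
      then have "r 1 s = 2 * s - 1" by (simp add: r_def)
      then show ?thesis using False RH s x by simp
    qed
    show "(?cone \<circ> eP) x = (M 1 x, N 1 x, \<lambda>s\<in>{0..1}. if s \<le> 1/2 then L 1 (l 1 s) x else R 1 (r 1 s) x)"
      using half by (auto simp: M1[OF x] N1[OF x] intro!: restrict_ext)
    have KJ: "K 0 (p' x) = eZ (f' (p' x))" "J 0 (q' x) = eZ (f' (p' x))"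
      using inP[OF x] comm[OF x] by (auto simp: K0 J0)
    \<comment> \<open>At parameter \<open>0\<close> the three thirds of the transported path appear.\<close>
    have tr: "transport_path K J 0 1 (p' x) (q' x) (\<lambda>s\<in>{0..1}. eZ ((\<lambda>s\<in>{0..1}. f' (p' x)) s)) s =
        (if s \<le> 1/2 then L 0 (l 0 s) x else R 0 (r 0 s) x)" if s: "0 \<le> s" "s \<le> 1" for s
    proof -
      have rhs: "(if s \<le> 1/2 then L 0 (l 0 s) x else R 0 (r 0 s) x) =
          (if s \<le> 1/2 then K (l 0 s) (p' x) else J (r 0 s) (q' x))"
        using lr[of 0 s] s x by (simp add: L0 R0)
      consider "s \<le> 1/3" | "1/3 < s" "s \<le> 1/2" | "1/2 < s" "s \<le> 2/3" | "2/3 < s" by linarith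
      then show ?thesis
      proof cases
        case 1
        then have "between 0 1 (s * (1 + 2 * \<bar>0 - 1\<bar>)) = l 0 s" using s by (simp add: between_def l_def)
        then show ?thesis unfolding rhs transport_path_def Let_def using 1 s by simp
      next
        case 2
        then have "l 0 s = 0" by (simp add: l_def)
        then show ?thesis unfolding rhs transport_path_def Let_def using 2 s by (simp add: KJ)
      next
        case 3
        then have "r 0 s = 0" by (simp add: r_def)
        then show ?thesis unfolding rhs transport_path_def Let_def using 3 s by (simp add: KJ)
      next
        case 4
        then have "between 0 1 (1 + 2 * \<bar>0 - 1\<bar> - s * (1 + 2 * \<bar>0 - 1\<bar>)) = r 0 s" using s by (simp add: between_def r_def)
        then show ?thesis unfolding rhs transport_path_def Let_def using 4 s by simp
      qed
    qed
    show "(?\<Phi> \<circ> constant_cone p' q' f') x =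
       (M 0 x, N 0 x, \<lambda>s\<in>{0..1}. if s \<le> 1/2 then L 0 (l 0 s) x else R 0 (r 0 s) x)"
      using tr by (auto simp: hpb_map_def transport_def M0[OF x] N0[OF x] intro!: restrict_ext)
  qed
  have "homotopy_pullback P A B Z p q f g H \<longleftrightarrow> homotopy_equivalence_map P ?G ?cone"
    using c H unfolding homotopy_pullback_def by (simp add: case_prod_unfold)
  also have "\<dots> \<longleftrightarrow> homotopy_equivalence_map P' ?G (?cone \<circ> eP)"
    by (rule he_comp_iff_right[OF cone eP, symmetric])
  also have "\<dots> \<longleftrightarrow> homotopy_equivalence_map P' ?G (?\<Phi> \<circ> constant_cone p' q' f')"
    using he_homotopic[OF _ hom] he_homotopic[OF _ homotopic_with_symD[OF hom]] by blast
  also have "\<dots> \<longleftrightarrow> homotopy_equivalence_map P' ?G' (constant_cone p' q' f')"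
    by (rule he_comp_iff_left[OF cone' \<Phi>])
  finally show ?thesis using strict by (simp add: strict_hpb_iff)
qed

section \<open>Pasting, factors and retracts of strict squares\<close>

text \<open>For \<open>u\<close> between \<open>0\<close> and \<open>1\<close>, this is the path \<open>v\<close> followed by the part of \<open>w\<close> up to time \<open>u\<close>. It
  takes time proportional to length, so that it is \<open>v\<close> itself for \<open>u = 0\<close>.\<close>

definition join_path :: "real \<Rightarrow> (real \<Rightarrow> 'a) \<Rightarrow> (real \<Rightarrow> 'a) \<Rightarrow> real \<Rightarrow> 'a" where
  "join_path u v w s = (let r = s * (1 + u) in
     if r \<le> 1 then v (max 0 (min 1 r)) else w (max 0 (min 1 (r - 1))))"

lemma join_path_0 [simp]: "0 \<le> s \<Longrightarrow> s \<le> 1 \<Longrightarrow> join_path 0 v w s = v s"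
  by (simp add: join_path_def)

lemma join_path_start [simp]: "join_path u v w 0 = v 0"
  by (simp add: join_path_def)

lemma join_path_end: "0 \<le> u \<Longrightarrow> u \<le> 1 \<Longrightarrow> w 0 = v 1 \<Longrightarrow> join_path u v w 1 = w u"
  by (cases "u = 0") (auto simp: join_path_def Let_def)

lemma continuous_map_join_path:
  assumes u: "continuous_map T UI u" and s: "continuous_map T UI s"
    and v: "\<And>r. continuous_map T UI r \<Longrightarrow> continuous_map T Z (\<lambda>t. v t (r t))"
    and w: "\<And>r. continuous_map T UI r \<Longrightarrow> continuous_map T Z (\<lambda>t. w t (r t))"
    and vw: "\<And>t. t \<in> topspace T \<Longrightarrow> v t 1 = w t 0"
  shows "continuous_map T Z (\<lambda>t. join_path (u t) (v t) (w t) (s t))"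
proof -
  let ?r = "\<lambda>t. s t * (1 + u t)"
  have real: "continuous_map T euclideanreal u" "continuous_map T euclideanreal s"
    using u s unfolding continuous_map_UI_iff by auto
  have r: "continuous_map T euclideanreal ?r"
    by (intro continuous_map_real_mult continuous_map_add real continuous_map_const[THEN iffD2]) auto
  have clamp: "continuous_map T UI (\<lambda>t. max 0 (min 1 (e t)))" if "continuous_map T euclideanreal e" for e
    unfolding continuous_map_UI_iff
    by (intro conjI ballI continuous_map_real_max continuous_map_real_min that continuous_map_const[THEN iffD2]) auto
  have r': "continuous_map T euclideanreal (\<lambda>t. ?r t - 1)"
    by (intro continuous_map_diff r continuous_map_const[THEN iffD2]) auto
  show ?thesis
    unfolding join_path_def Let_def
  proof (rule continuous_map_case_le[OF r _ v[OF clamp[OF r]] w[OF clamp[OF r']]])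
    fix t assume t: "t \<in> topspace T" "?r t = 1"
    show "v t (max 0 (min 1 (?r t))) = w t (max 0 (min 1 (?r t - 1)))"
      unfolding t(2) using vw[OF t(1)] by simp
  qed simp
qed

lemma continuous_map_UI_max:
  "continuous_map T UI r \<Longrightarrow> continuous_map T UI s \<Longrightarrow> continuous_map T UI (\<lambda>t. max (r t) (s t))"
  unfolding continuous_map_UI_iff by (auto intro: continuous_map_real_max simp: le_max_iff_disj)

lemma continuous_map_UI_min:
  "continuous_map T UI r \<Longrightarrow> continuous_map T UI s \<Longrightarrow> continuous_map T UI (\<lambda>t. min (r t) (s t))"
  unfolding continuous_map_UI_iff by (auto intro: continuous_map_real_min simp: min_le_iff_disj)

text \<open>A point of the iterated homotopy pullback is a pair of composable paths, one in \<open>Z2\<close> and one in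
  \<open>Z\<close>. Joining the first with the image of the second has a homotopy inverse that takes the second
  path constant: the homotopy moves the intermediate point of \<open>Z\<close> along the second path to its end.\<close>

lemma he_iterated_hpb:
  fixes A2 :: "'a2 topology" and Z :: "'z topology"
  assumes f2: "continuous_map A2 Z2 f2" and z: "continuous_map Z Z2 z" and g: "continuous_map B Z g"
  defines "Q \<equiv> hpb_space A2 Z Z2 f2 z"
  shows "homotopy_equivalence_map (hpb_space Q B Z (\<lambda>y. fst (snd y)) g) (hpb_space A2 B Z2 f2 (z \<circ> g))
     (\<lambda>y. (fst (fst y), fst (snd y), \<lambda>s\<in>{0..1}. join_path 1 (snd (snd (fst y))) (\<lambda>s. z (snd (snd y) s)) s))"
    (is "homotopy_equivalence_map ?H ?G ?j")
proof -
  let ?k = "\<lambda>y. ((fst y, g (fst (snd y)), \<lambda>s\<in>{0..1}. snd (snd y) s), fst (snd y), \<lambda>s\<in>{0..1}. g (fst (snd y)))"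
  have inH: "fst (fst y) \<in> topspace A2" "fst (snd y) \<in> topspace B"
      "snd (snd (fst y)) 0 = f2 (fst (fst y))" "snd (snd (fst y)) 1 = z (snd (snd y) 0)"
      "snd (snd y) 0 = fst (snd (fst y))" "snd (snd y) 1 = g (fst (snd y))"
      "snd (snd (fst y)) \<in> extensional {0..1}" "snd (snd y) \<in> extensional {0..1}"
    if "y \<in> topspace ?H" for y
    using that unfolding Q_def by (auto simp: in_topspace_hpb_space)
  have q: "continuous_map T A2 (\<lambda>t. fst (fst (y t)))" if "continuous_map T ?H y" for T y
    by (rule continuous_map_hpb_fst[OF continuous_map_hpb_fst[OF that, unfolded Q_def]])
  have qp: "continuous_map T Z2 (\<lambda>t. snd (snd (fst (y t))) (r t))"
    if "continuous_map T ?H y" "continuous_map T UI r" for T y r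
    by (rule continuous_map_hpb_path[OF continuous_map_hpb_fst[OF that(1), unfolded Q_def] that(2)])
  have j: "continuous_map ?H ?G ?j"
  proof (rule continuous_map_into_hpb_space)
    have y: "continuous_map (prod_topology ?H UI) ?H fst" by (rule continuous_map_fst)
    show "continuous_map ?H A2 (\<lambda>y. fst (fst y))"
      by (rule q[OF continuous_map_self])
    show "continuous_map ?H B (\<lambda>y. fst (snd y))"
      by (rule continuous_map_hpb_snd[OF continuous_map_self])
    show "continuous2 ?H UI Z2 (\<lambda>y. join_path 1 (snd (snd (fst y))) (\<lambda>s. z (snd (snd y) s)))"
    proof (rule continuous_map_join_path)
      show "continuous_map (prod_topology ?H UI) UI snd" by (rule continuous_map_snd)
      fix r assume r: "continuous_map (prod_topology ?H UI) UI r"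
      show "continuous_map (prod_topology ?H UI) Z2 (\<lambda>t. snd (snd (fst (fst t))) (r t))"
        by (rule qp[OF y r])
      show "continuous_map (prod_topology ?H UI) Z2 (\<lambda>t. z (snd (snd (fst t)) (r t)))"
        by (rule continuous_map_compose'[OF z continuous_map_hpb_path[OF y r]])
    qed (simp_all add: inH mem_Times_iff)
  qed (simp_all add: inH mem_Times_iff join_path_end)
  have k: "continuous_map ?G ?H ?k"
  proof (rule continuous_map_into_hpb_space)
    have a: "continuous_map ?G A2 fst" and b: "continuous_map ?G B (\<lambda>y. fst (snd y))"
      by (rule continuous_map_hpb_fst[OF continuous_map_self] continuous_map_hpb_snd[OF continuous_map_self])+
    show "continuous_map ?G B (\<lambda>y. fst (snd y))" by (rule b)
    show "continuous_map ?G Q (\<lambda>y. (fst y, g (fst (snd y)), \<lambda>s\<in>{0..1}. snd (snd y) s))"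
      unfolding Q_def
    proof (rule continuous_map_into_hpb_space)
      show "continuous2 ?G UI Z2 (\<lambda>y. snd (snd y))"
        by (rule continuous_map_hpb_path[OF continuous_map_fst continuous_map_snd])
      show "continuous_map ?G A2 fst" by (rule a)
      show "continuous_map ?G Z (\<lambda>y. g (fst (snd y)))" by (rule continuous_map_compose'[OF g b])
    qed (auto simp: in_topspace_hpb_space)
    show "continuous2 ?G UI Z (\<lambda>y s. g (fst (snd y)))"
      by (rule continuous_map_compose'[OF g continuous_map_hpb_snd[OF continuous_map_fst]])
  qed auto
  have kj: "homotopic_maps ?H ?H id (?k \<circ> ?j)"
  proof (rule homotopic_maps_into_hpb_space)
    let ?P = "prod_topology UI ?H"
    have y: "continuous_map ?P ?H snd" by (rule continuous_map_snd)
    have u: "continuous_map ?P UI fst" by (rule continuous_map_fst)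
    have y': "continuous_map (prod_topology ?P UI) ?H (\<lambda>t. snd (fst t))"
      by (rule continuous_map_snd_of[OF continuous_map_fst])
    have u': "continuous_map (prod_topology ?P UI) UI (\<lambda>t. fst (fst t))"
      by (rule continuous_map_fst_of[OF continuous_map_fst])
    show "continuous2 UI ?H Q (\<lambda>u y. (fst (fst y), snd (snd y) u,
        \<lambda>s\<in>{0..1}. join_path u (snd (snd (fst y))) (\<lambda>s. z (snd (snd y) s)) s))"
    proof (rule continuous_map_into_hpb_space[where A = A2 and B = Z and Z = Z2 and f = f2 and g = z, folded Q_def])
      show "continuous_map ?P A2 (\<lambda>t. fst (fst (snd t)))"
        by (rule q[OF y])
      show "continuous_map ?P Z (\<lambda>t. snd (snd (snd t)) (fst t))"
        by (rule continuous_map_hpb_path[OF y u])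
      show "continuous2 ?P UI Z2 (\<lambda>t. join_path (fst t) (snd (snd (fst (snd t)))) (\<lambda>s. z (snd (snd (snd t)) s)))"
      proof (rule continuous_map_join_path[OF u'])
        show "continuous_map (prod_topology ?P UI) UI snd" by (rule continuous_map_snd)
        fix r assume r: "continuous_map (prod_topology ?P UI) UI r"
        show "continuous_map (prod_topology ?P UI) Z2 (\<lambda>t. snd (snd (fst (snd (fst t)))) (r t))"
          by (rule qp[OF y' r])
        show "continuous_map (prod_topology ?P UI) Z2 (\<lambda>t. z (snd (snd (snd (fst t))) (r t)))"
          by (rule continuous_map_compose'[OF z continuous_map_hpb_path[OF y' r]])
      qed (simp_all add: inH mem_Times_iff)
    qed (simp_all add: inH mem_Times_iff join_path_end)
    show "continuous2 UI ?H B (\<lambda>u y. fst (snd y))" by (rule continuous_map_hpb_snd[OF y])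
    show "continuous_map (prod_topology ?P UI) Z (\<lambda>t. snd (snd (snd (fst t))) (max (fst (fst t)) (snd t)))"
      by (rule continuous_map_hpb_path[OF y' continuous_map_UI_max[OF u' continuous_map_snd]])
    fix y assume y: "y \<in> topspace ?H"
    show "id y = ((fst (fst y), snd (snd y) 0, \<lambda>s\<in>{0..1}. join_path 0 (snd (snd (fst y))) (\<lambda>s. z (snd (snd y) s)) s),
        fst (snd y), \<lambda>s\<in>{0..1}. snd (snd y) (max 0 s))"
      using inH[OF y] by (auto simp: prod_eq_iff extensional_def fun_eq_iff)
    show "(?k \<circ> ?j) y = ((fst (fst y), snd (snd y) 1, \<lambda>s\<in>{0..1}. join_path 1 (snd (snd (fst y))) (\<lambda>s. z (snd (snd y) s)) s),
        fst (snd y), \<lambda>s\<in>{0..1}. snd (snd y) (max 1 s))"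
      using inH[OF y] by (auto simp: fun_eq_iff max_def)
  qed (simp_all add: inH mem_Times_iff max_def)
  have jk: "homotopic_maps ?G ?G id (?j \<circ> ?k)"
  proof (rule homotopic_maps_into_hpb_space)
    let ?T = "prod_topology (prod_topology UI ?G) UI"
    have x: "continuous_map ?T ?G (\<lambda>t. snd (fst t))"
      by (rule continuous_map_snd_of[OF continuous_map_fst])
    show "continuous2 UI ?G A2 (\<lambda>u x. fst x)" by (rule continuous_map_hpb_fst[OF continuous_map_snd])
    show "continuous2 UI ?G B (\<lambda>u x. fst (snd x))" by (rule continuous_map_hpb_snd[OF continuous_map_snd])
    show "continuous_map ?T Z2 (\<lambda>t. join_path (fst (fst t)) (snd (snd (snd (fst t)))) (\<lambda>s. z (g (fst (snd (snd (fst t)))))) (snd t))"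
    proof (rule continuous_map_join_path[OF continuous_map_fst_of[OF continuous_map_fst] continuous_map_snd])
      fix r assume r: "continuous_map ?T UI r"
      show "continuous_map ?T Z2 (\<lambda>t. snd (snd (snd (fst t))) (r t))"
        by (rule continuous_map_hpb_path[OF x r])
      show "continuous_map ?T Z2 (\<lambda>t. z (g (fst (snd (snd (fst t))))))"
        by (rule continuous_map_compose'[OF z continuous_map_compose'[OF g continuous_map_hpb_snd[OF x]]])
    qed (auto simp: in_topspace_hpb_space)
    fix x assume x: "x \<in> topspace ?G"
    show "id x = (fst x, fst (snd x), \<lambda>s\<in>{0..1}. join_path 0 (snd (snd x)) (\<lambda>s. z (g (fst (snd x)))) s)"
      using x by (auto simp: in_topspace_hpb_space prod_eq_iff extensional_def fun_eq_iff)
    show "(?j \<circ> ?k) x = (fst x, fst (snd x), \<lambda>s\<in>{0..1}. join_path 1 (snd (snd x)) (\<lambda>s. z (g (fst (snd x)))) s)"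
      by (auto simp: join_path_def Let_def intro!: restrict_ext)
  qed (auto simp: in_topspace_hpb_space join_path_end)
  show ?thesis
    unfolding homotopy_equivalence_map_def
    using j k homotopic_with_symD[OF kj] homotopic_with_symD[OF jk] by blast
qed

text \<open>Replace \<open>A\<close> by the homotopy pullback to which it is equivalent and use the iterated homotopy
  pullback. The composite prepends a constant path, which can be contracted away.\<close>

lemma he_hpb_paste:
  assumes S: "strict_hpb A A2 Z Z2 a f f2 z" and g: "continuous_map B Z g"
  shows "homotopy_equivalence_map (hpb_space A B Z f g) (hpb_space A2 B Z2 f2 (z \<circ> g)) (hpb_map a id z)"
proof -
  have comm: "commuting_square A A2 Z Z2 a f f2 z"
    and S': "homotopy_equivalence_map A (hpb_space A2 Z Z2 f2 z) (constant_cone a f f2)"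
    using S by (auto simp: strict_hpb_iff)
  have c: "continuous_map A A2 a" "continuous_map A Z f" "continuous_map A2 Z2 f2" "continuous_map Z Z2 z"
    and eq: "\<And>x. x \<in> topspace A \<Longrightarrow> f2 (a x) = z (f x)"
    using comm unfolding commuting_square_def by auto
  let ?Q = "hpb_space A2 Z Z2 f2 z"
  \<comment> \<open>Joining with the constant path that \<open>?c\<close> provides amounts to waiting at the start for half of
    the time.\<close>
  let ?j = "\<lambda>y. (fst (fst y), fst (snd y), \<lambda>s\<in>{0..1}. join_path 1 (snd (snd (fst y))) (\<lambda>s. z (snd (snd y) s)) s)"
  let ?c = "hpb_map (constant_cone a f f2) id id"
  let ?H = "hpb_space A B Z f g" and ?G = "hpb_space A2 B Z2 f2 (z \<circ> g)"
  have "homotopy_equivalence_map (hpb_space A B Z ((\<lambda>y. fst (snd y)) \<circ> constant_cone a f f2) (g \<circ> id))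
      (hpb_space ?Q B Z (\<lambda>y. fst (snd y)) g) ?c"
    by (rule he_hpb_map_corners[OF continuous_map_hpb_snd[OF continuous_map_self] g S' he_id])
  then have "homotopy_equivalence_map ?H (hpb_space ?Q B Z (\<lambda>y. fst (snd y)) g) ?c"
    by (simp add: comp_def)
  from he_comp[OF this he_iterated_hpb[OF c(3,4) g]]
  have 1: "homotopy_equivalence_map ?H ?G (?j \<circ> ?c)" .
  have "homotopic_maps ?H ?G (hpb_map a id z) (?j \<circ> ?c)"
  proof (rule homotopic_maps_into_hpb_space)
    let ?T = "prod_topology (prod_topology UI ?H) UI"
    have x: "continuous_map ?T ?H (\<lambda>t. snd (fst t))"
      by (rule continuous_map_snd_of[OF continuous_map_fst])
    have u: "continuous_map ?T UI (\<lambda>t. fst (fst t))"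
      by (rule continuous_map_fst_of[OF continuous_map_fst])
    have s: "continuous_map ?T UI snd" by (rule continuous_map_snd)
    have real: "continuous_map ?T euclideanreal (\<lambda>t. fst (fst t))" "continuous_map ?T euclideanreal snd"
      using u s unfolding continuous_map_UI_iff by auto
    show "continuous2 UI ?H A2 (\<lambda>u x. a (fst x))"
      by (rule continuous_map_compose'[OF c(1) continuous_map_hpb_fst[OF continuous_map_snd]])
    show "continuous2 UI ?H B (\<lambda>u x. fst (snd x))" by (rule continuous_map_hpb_snd[OF continuous_map_snd])
    have "continuous_map ?T UI (\<lambda>t. max 0 (min 1 (snd t * (1 + fst (fst t)) - fst (fst t))))"
      unfolding continuous_map_UI_iff
      by (intro conjI ballI continuous_map_real_max continuous_map_real_min continuous_map_diff
          continuous_map_real_mult continuous_map_add real continuous_map_const[THEN iffD2]) auto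
    then show "continuous_map ?T Z2
      (\<lambda>t. z (snd (snd (snd (fst t))) (max 0 (min 1 (snd t * (1 + fst (fst t)) - fst (fst t))))))"
      by (rule continuous_map_compose'[OF c(4) continuous_map_hpb_path[OF x]])
    fix x assume x: "x \<in> topspace ?H"
    show "z (snd (snd x) (max 0 (min 1 (0 * (1 + u) - u)))) = f2 (a (fst x))" if "0 \<le> u" for u
      using x that by (auto simp: in_topspace_hpb_space eq)
    show "z (snd (snd x) (max 0 (min 1 (1 * (1 + u) - u)))) = (z \<circ> g) (fst (snd x))" for u
      using x by (auto simp: in_topspace_hpb_space)
    show "hpb_map a id z x = (a (fst x), fst (snd x), \<lambda>s\<in>{0..1}. z (snd (snd x) (max 0 (min 1 (s * (1 + 0) - 0)))))"
      by (auto simp: hpb_map_def intro!: restrict_ext)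
    have "join_path 1 (\<lambda>s\<in>{0..1}. f2 (a (fst x))) (\<lambda>s. z ((\<lambda>s\<in>{0..1}. snd (snd x) s) s)) s =
        z (snd (snd x) (max 0 (min 1 (s * (1 + 1) - 1))))" if "0 \<le> s" "s \<le> 1" for s
    proof (cases "s * 2 \<le> 1")
      case True
      then have "max 0 (min 1 (s * (1 + 1) - 1)) = 0" by simp
      then show ?thesis
        using True that x by (simp add: join_path_def in_topspace_hpb_space eq)
    next
      case False
      then show ?thesis using that by (simp add: join_path_def)
    qed
    then show "(?j \<circ> ?c) x = (a (fst x), fst (snd x), \<lambda>s\<in>{0..1}. z (snd (snd x) (max 0 (min 1 (s * (1 + 1) - 1)))))"
      by (auto simp: hpb_map_def intro!: restrict_ext)
  qed
  from he_homotopic[OF 1 homotopic_with_symD[OF this]] show ?thesis .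
qed

text \<open>The pasting law. The comparison map of the outer rectangle factors strictly through that of the
  left square.\<close>

lemma strict_hpb_paste:
  assumes S: "strict_hpb A A2 Z Z2 a f f2 z" and sq: "commuting_square P A B Z p q f g"
  shows "strict_hpb P A B Z p q f g \<longleftrightarrow> strict_hpb P A2 B Z2 (a \<circ> p) q f2 (z \<circ> g)"
proof -
  let ?\<Theta> = "hpb_map a id z"
  have c: "continuous_map P A p" "continuous_map P B q" "continuous_map B Z g"
    using sq unfolding commuting_square_def by auto
  have comm: "commuting_square A A2 Z Z2 a f f2 z"
    using S by (simp add: strict_hpb_iff)
  have inA: "p x \<in> topspace A" if "x \<in> topspace P" for x
    using that c(1) by (auto dest: continuous_map_funspace)
  have sq2: "commuting_square P A2 B Z2 (a \<circ> p) q f2 (z \<circ> g)"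
    using sq comm inA unfolding commuting_square_def by (auto intro: continuous_map_compose)
  have eq: "(?\<Theta> \<circ> constant_cone p q f) x = constant_cone (a \<circ> p) q f2 x" if "x \<in> topspace P" for x
    using comm inA[OF that] by (auto simp: hpb_map_def commuting_square_def intro!: restrict_ext)
  have "strict_hpb P A B Z p q f g \<longleftrightarrow> homotopy_equivalence_map P (hpb_space A B Z f g) (constant_cone p q f)"
    using sq by (simp add: strict_hpb_iff)
  also have "\<dots> \<longleftrightarrow> homotopy_equivalence_map P (hpb_space A2 B Z2 f2 (z \<circ> g)) (?\<Theta> \<circ> constant_cone p q f)"
    by (rule he_comp_iff_left[symmetric, OF continuous_map_constant_cone[OF sq] he_hpb_paste[OF S c(3)]])
  also have "\<dots> \<longleftrightarrow> homotopy_equivalence_map P (hpb_space A2 B Z2 f2 (z \<circ> g)) (constant_cone (a \<circ> p) q f2)"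
    using he_cong[of _ _ "?\<Theta> \<circ> constant_cone p q f", OF _ eq]
      he_cong[of _ _ "constant_cone (a \<circ> p) q f2", OF _ eq[symmetric]] by blast
  finally show ?thesis using sq2 by (simp add: strict_hpb_iff)
qed

lemma continuous_map_product_component:
  "continuous_map T (product_topology X I) f \<Longrightarrow> i \<in> I \<Longrightarrow> continuous_map T (X i) (\<lambda>t. f t i)"
  by (simp add: continuous_map_componentwise)

lemma continuous_map_into_product:
  "(\<And>i. i \<in> I \<Longrightarrow> continuous_map T (X i) (\<lambda>t. f t i)) \<Longrightarrow>
    continuous_map T (product_topology X I) (\<lambda>t. \<lambda>i\<in>I. f t i)"
  by (auto simp: continuous_map_componentwise)

text \<open>Where the leg \<open>g i\<close> is an identity, a coordinate of the homotopy pullback is a path from \<open>f a i\<close>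
  with a free end, and such paths contract to their starting points.\<close>

lemma he_hpb_project_factor:
  fixes B :: "'i \<Rightarrow> 'b topology" and Z :: "'i \<Rightarrow> 'b topology"
  assumes j: "j \<in> I" and f: "continuous_map A (product_topology Z I) f"
    and g: "continuous_map (B j) (Z j) (g j)"
    and BZ: "\<And>i. i \<in> I \<Longrightarrow> i \<noteq> j \<Longrightarrow> B i = Z i"
    and gid: "\<And>i x. i \<in> I \<Longrightarrow> i \<noteq> j \<Longrightarrow> x \<in> topspace (Z i) \<Longrightarrow> g i x = x"
  shows "homotopy_equivalence_map
     (hpb_space A (product_topology B I) (product_topology Z I) f (\<lambda>b. \<lambda>i\<in>I. g i (b i)))
     (hpb_space A (B j) (Z j) (\<lambda>a. f a j) (g j)) (hpb_map id (\<lambda>b. b j) (\<lambda>z. z j))"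
    (is "homotopy_equivalence_map ?H ?G ?p")
proof -
  let ?k = "\<lambda>x. (fst x, \<lambda>i\<in>I. if i = j then fst (snd x) else f (fst x) i,
     \<lambda>s\<in>{0..1}. \<lambda>i\<in>I. if i = j then snd (snd x) s else f (fst x) i)"
  have fin: "f a i \<in> topspace (Z i)" if "a \<in> topspace A" "i \<in> I" for a i
    using continuous_map_funspace[OF f] that by (auto simp: PiE_iff)
  have fe: "f a \<in> extensional I" if "a \<in> topspace A" for a
    using continuous_map_funspace[OF f] that by (auto simp: PiE_iff)
  have p: "continuous_map ?H ?G ?p"
    by (rule continuous_map_hpb_map) (auto simp: j continuous_map_product_projection)
  have k: "continuous_map ?G ?H ?k"
  proof (rule continuous_map_into_hpb_space)
    have a: "continuous_map T A (\<lambda>t. fst (x t))" if "continuous_map T ?G x" for T x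
      by (rule continuous_map_hpb_fst[OF that])
    have fa: "continuous_map T (Z i) (\<lambda>t. f (fst (x t)) i)" if "continuous_map T ?G x" "i \<in> I" for T x i
      by (rule continuous_map_product_component[OF continuous_map_compose'[OF f a[OF that(1)]] that(2)])
    show "continuous_map ?G A fst" by (rule a[OF continuous_map_self])
    show "continuous_map ?G (product_topology B I) (\<lambda>x. \<lambda>i\<in>I. if i = j then fst (snd x) else f (fst x) i)"
    proof (rule continuous_map_into_product)
      fix i assume "i \<in> I"
      then show "continuous_map ?G (B i) (\<lambda>x. if i = j then fst (snd x) else f (fst x) i)"
        using continuous_map_hpb_snd[OF continuous_map_self, of A "B j"] fa[OF continuous_map_self] by (cases "i = j") (simp_all add: BZ)
    qed
    show "continuous2 ?G UI (product_topology Z I) (\<lambda>x s. \<lambda>i\<in>I. if i = j then snd (snd x) s else f (fst x) i)"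
    proof (rule continuous_map_into_product)
      fix i assume "i \<in> I"
      then show "continuous2 ?G UI (Z i) (\<lambda>x s. if i = j then snd (snd x) s else f (fst x) i)"
        using continuous_map_hpb_path[OF continuous_map_fst continuous_map_snd, of A "B j"] fa[OF continuous_map_fst]
        by (cases "i = j") simp_all
    qed
    fix x assume x: "x \<in> topspace ?G"
    show "(\<lambda>i\<in>I. if i = j then snd (snd x) 0 else f (fst x) i) = f (fst x)"
      using x fe[of "fst x"] by (auto simp: in_topspace_hpb_space extensional_def fun_eq_iff)
    show "(\<lambda>i\<in>I. if i = j then snd (snd x) 1 else f (fst x) i) =
        (\<lambda>i\<in>I. g i ((\<lambda>i\<in>I. if i = j then fst (snd x) else f (fst x) i) i))"
      using x by (auto simp: in_topspace_hpb_space fin gid intro!: restrict_ext)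
  qed
  have pk: "homotopic_maps ?G ?G (?p \<circ> ?k) id"
  proof (rule homotopic_with_equal)
    show "continuous_map ?G ?G (?p \<circ> ?k)" by (rule continuous_map_compose[OF k p])
    fix x assume "x \<in> topspace ?G"
    then show "(?p \<circ> ?k) x = id x"
      using j by (auto simp: in_topspace_hpb_space hpb_map_def prod_eq_iff extensional_def fun_eq_iff)
  qed auto
  have path_in: "snd (snd x) s \<in> (\<Pi>\<^sub>E i\<in>I. topspace (Z i))" if "x \<in> topspace ?H" "0 \<le> s" "s \<le> 1" for x s
    using that continuous_map_funspace[of UI "product_topology Z I" "snd (snd x)"]
    by (auto simp: in_topspace_hpb_space)
  have kp: "homotopic_maps ?H ?H (?k \<circ> ?p) id"
  proof (rule homotopic_maps_into_hpb_space)
    let ?P = "prod_topology UI ?H"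
    let ?T = "prod_topology ?P UI"
    have x: "continuous_map ?P ?H snd" by (rule continuous_map_snd)
    have y: "continuous_map ?T ?H (\<lambda>t. snd (fst t))"
      by (rule continuous_map_snd_of[OF continuous_map_fst])
    have u: "continuous_map ?T UI (\<lambda>t. fst (fst t))"
      by (rule continuous_map_fst_of[OF continuous_map_fst])
    show "continuous2 UI ?H A (\<lambda>u x. fst x)" by (rule continuous_map_hpb_fst[OF x])
    show "continuous2 UI ?H (product_topology B I) (\<lambda>u x. \<lambda>i\<in>I. if i = j then fst (snd x) j else snd (snd x) u i)"
    proof (rule continuous_map_into_product)
      fix i assume i: "i \<in> I"
      show "continuous2 UI ?H (B i) (\<lambda>u x. if i = j then fst (snd x) j else snd (snd x) u i)"
        using continuous_map_product_component[OF continuous_map_hpb_snd[OF x] j]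
          continuous_map_product_component[OF continuous_map_hpb_path[OF x continuous_map_fst] i] i
        by (cases "i = j") (simp_all add: BZ)
    qed
    show "continuous_map ?T (product_topology Z I)
       (\<lambda>t. \<lambda>i\<in>I. if i = j then snd (snd (snd (fst t))) (snd t) j else snd (snd (snd (fst t))) (min (fst (fst t)) (snd t)) i)"
    proof (rule continuous_map_into_product)
      fix i assume i: "i \<in> I"
      show "continuous_map ?T (Z i)
        (\<lambda>t. if i = j then snd (snd (snd (fst t))) (snd t) j else snd (snd (snd (fst t))) (min (fst (fst t)) (snd t)) i)"
        using continuous_map_product_component[OF continuous_map_hpb_path[OF y continuous_map_snd] j]
          continuous_map_product_component[OF continuous_map_hpb_path[OF y continuous_map_UI_min[OF u continuous_map_snd]] i]
        by (cases "i = j") simp_all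
    qed
    fix x assume x: "x \<in> topspace ?H"
    have x': "fst x \<in> topspace A" "snd (snd x) 0 = f (fst x)" "snd (snd x) 1 = (\<lambda>i\<in>I. g i (fst (snd x) i))"
      "snd (snd x) \<in> extensional {0..1}" "fst (snd x) \<in> (\<Pi>\<^sub>E i\<in>I. topspace (B i))"
      using x by (auto simp: in_topspace_hpb_space)
    have ext: "snd (snd x) s i = undefined" if "0 \<le> s" "s \<le> 1" "i \<notin> I" for s i
      using path_in[OF x that(1,2)] that(3) by (auto simp: PiE_iff extensional_def)
    have last: "g i (fst (snd x) i) = fst (snd x) i" if "i \<in> I" "i \<noteq> j" for i
      using x'(5) that gid[of i "fst (snd x) i"] by (auto simp: PiE_iff BZ)
    show "(\<lambda>i\<in>I. if i = j then snd (snd x) 0 j else snd (snd x) (min u 0) i) = f (fst x)" if "0 \<le> u" for u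
      using that x' fe[of "fst x"] by (auto simp: fun_eq_iff min_def extensional_def)
    show "(\<lambda>i\<in>I. if i = j then snd (snd x) 1 j else snd (snd x) (min u 1) i) =
       (\<lambda>i\<in>I. g i ((\<lambda>i\<in>I. if i = j then fst (snd x) j else snd (snd x) u i) i))" if "0 \<le> u" "u \<le> 1" for u
    proof (rule restrict_ext)
      fix i assume i: "i \<in> I"
      have "g i (snd (snd x) u i) = snd (snd x) u i" if "i \<noteq> j"
        using path_in[OF x \<open>0 \<le> u\<close> \<open>u \<le> 1\<close>] i that by (intro gid) (auto simp: PiE_iff)
      then show "(if i = j then snd (snd x) 1 j else snd (snd x) (min u 1) i) =
        g i ((\<lambda>i\<in>I. if i = j then fst (snd x) j else snd (snd x) u i) i)"
        using i that x' by (auto simp: min_def)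
    qed
    show "(?k \<circ> ?p) x = (fst x, \<lambda>i\<in>I. if i = j then fst (snd x) j else snd (snd x) 0 i,
       \<lambda>s\<in>{0..1}. \<lambda>i\<in>I. if i = j then snd (snd x) s j else snd (snd x) (min 0 s) i)"
      using x' by (auto simp: hpb_map_def min_def intro!: restrict_ext)
    have "fst (snd x) = (\<lambda>i\<in>I. if i = j then fst (snd x) j else snd (snd x) 1 i)"
      using x'(3,5) last by (auto simp: fun_eq_iff PiE_iff extensional_def)
    moreover have "snd (snd x) = (\<lambda>s\<in>{0..1}. \<lambda>i\<in>I. if i = j then snd (snd x) s j else snd (snd x) (min 1 s) i)"
      using x'(4) ext by (auto simp: fun_eq_iff extensional_def min_def)
    ultimately show "id x = (fst x, \<lambda>i\<in>I. if i = j then fst (snd x) j else snd (snd x) 1 i,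
       \<lambda>s\<in>{0..1}. \<lambda>i\<in>I. if i = j then snd (snd x) s j else snd (snd x) (min 1 s) i)"
      by (simp add: prod_eq_iff)
  qed
  show ?thesis
    unfolding homotopy_equivalence_map_def using p k pk kp by blast
qed

text \<open>Blocks on which nothing happens may be added to a square or removed from it.\<close>

lemma strict_hpb_product_iff_factor:
  fixes B :: "'i \<Rightarrow> 'b topology" and Z :: "'i \<Rightarrow> 'b topology"
  assumes j: "j \<in> I" and BZ: "\<And>i. i \<in> I \<Longrightarrow> i \<noteq> j \<Longrightarrow> B i = Z i"
    and gid: "\<And>i x. i \<in> I \<Longrightarrow> i \<noteq> j \<Longrightarrow> x \<in> topspace (Z i) \<Longrightarrow> g i x = x"
    and sq: "commuting_square P A (product_topology B I) (product_topology Z I) p q f (\<lambda>b. \<lambda>i\<in>I. g i (b i))"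
    and g: "continuous_map (B j) (Z j) (g j)"
  shows "strict_hpb P A (product_topology B I) (product_topology Z I) p q f (\<lambda>b. \<lambda>i\<in>I. g i (b i)) \<longleftrightarrow>
    strict_hpb P A (B j) (Z j) p (\<lambda>x. q x j) (\<lambda>a. f a j) (g j)"
proof -
  let ?H = "hpb_space A (product_topology B I) (product_topology Z I) f (\<lambda>b. \<lambda>i\<in>I. g i (b i))"
  let ?G = "hpb_space A (B j) (Z j) (\<lambda>a. f a j) (g j)"
  let ?pr = "hpb_map id (\<lambda>b. b j) (\<lambda>z. z j)"
  have c: "continuous_map P A p" "continuous_map P (product_topology B I) q" "continuous_map A (product_topology Z I) f"
    and comm: "\<And>x. x \<in> topspace P \<Longrightarrow> f (p x) = (\<lambda>i\<in>I. g i (q x i))"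
    using sq unfolding commuting_square_def by auto
  have sq2: "commuting_square P A (B j) (Z j) p (\<lambda>x. q x j) (\<lambda>a. f a j) (g j)"
    using c g comm j unfolding commuting_square_def by (auto intro: continuous_map_product_component)
  have pr: "homotopy_equivalence_map ?H ?G ?pr"
    by (rule he_hpb_project_factor[where j = j and B = B and Z = Z and g = g, OF j c(3) g BZ gid])
  have "?pr \<circ> constant_cone p q f = constant_cone p (\<lambda>x. q x j) (\<lambda>a. f a j)"
    by (auto simp: hpb_map_def fun_eq_iff)
  then have "homotopy_equivalence_map P ?G (constant_cone p (\<lambda>x. q x j) (\<lambda>a. f a j)) \<longleftrightarrow>
      homotopy_equivalence_map P ?H (constant_cone p q f)"
    using he_comp_iff_left[OF continuous_map_constant_cone[OF sq] pr] by simp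
  then show ?thesis
    using sq sq2 by (simp add: strict_hpb_iff)
qed

text \<open>The comparison map of the retract is a retract of the other comparison map.\<close>

lemma strict_hpb_retract:
  assumes S': "strict_hpb P' A' B' Z' p' q' f' g'" and sq: "commuting_square P A B Z p q f g"
    and "continuous_map P P' iP" "continuous_map A A' iA" "continuous_map B B' iB" "continuous_map Z Z' iZ"
    and "continuous_map P' P rP" "continuous_map A' A rA" "continuous_map B' B rB" "continuous_map Z' Z rZ"
    and "\<And>x. x \<in> topspace P \<Longrightarrow> rP (iP x) = x" "\<And>x. x \<in> topspace A \<Longrightarrow> rA (iA x) = x"
    and "\<And>x. x \<in> topspace B \<Longrightarrow> rB (iB x) = x" "\<And>x. x \<in> topspace Z \<Longrightarrow> rZ (iZ x) = x"
    and "\<And>x. x \<in> topspace P \<Longrightarrow> p' (iP x) = iA (p x)" "\<And>x. x \<in> topspace P \<Longrightarrow> q' (iP x) = iB (q x)"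
    and "\<And>a. a \<in> topspace A \<Longrightarrow> iZ (f a) = f' (iA a)" "\<And>b. b \<in> topspace B \<Longrightarrow> iZ (g b) = g' (iB b)"
    and "\<And>x. x \<in> topspace P' \<Longrightarrow> p (rP x) = rA (p' x)" "\<And>x. x \<in> topspace P' \<Longrightarrow> q (rP x) = rB (q' x)"
    and "\<And>a. a \<in> topspace A' \<Longrightarrow> rZ (f' a) = f (rA a)" "\<And>b. b \<in> topspace B' \<Longrightarrow> rZ (g' b) = g (rB b)"
  shows "strict_hpb P A B Z p q f g"
proof -
  let ?H = "hpb_space A B Z f g" and ?H' = "hpb_space A' B' Z' f' g'"
  have S: "commuting_square P' A' B' Z' p' q' f' g'" "homotopy_equivalence_map P' ?H' (constant_cone p' q' f')"
    using S' by (auto simp: strict_hpb_iff)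
  have inA: "p x \<in> topspace A" if "x \<in> topspace P" for x
    using that sq unfolding commuting_square_def by (auto dest: continuous_map_funspace)
  have inA': "p' x \<in> topspace A'" if "x \<in> topspace P'" for x
    using that S(1) unfolding commuting_square_def by (auto dest: continuous_map_funspace)
  have "homotopy_equivalence_map P ?H (constant_cone p q f)"
  proof (rule he_retract[OF continuous_map_constant_cone[OF sq] S(2) assms(3,7)])
    show "continuous_map ?H ?H' (hpb_map iA iB iZ)"
      by (rule continuous_map_hpb_map) (use assms in auto)
    show "continuous_map ?H' ?H (hpb_map rA rB rZ)"
      by (rule continuous_map_hpb_map) (use assms in auto)
    fix y assume y: "y \<in> topspace ?H"
    then have "snd (snd y) s \<in> topspace Z" if "s \<in> {0..1}" for s
      using that continuous_map_funspace[of UI Z "snd (snd y)"] by (auto simp: in_topspace_hpb_space)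
    then show "hpb_map rA rB rZ (hpb_map iA iB iZ y) = y"
      using y assms(12-14) by (auto simp: hpb_map_def prod_eq_iff in_topspace_hpb_space extensional_def fun_eq_iff)
  qed (use assms inA inA' in \<open>auto simp: hpb_map_def intro!: restrict_ext\<close>)
  then show ?thesis using sq by (simp add: strict_hpb_iff)
qed

lemma strict_hpb_cong:
  assumes "\<And>x. x \<in> topspace P \<Longrightarrow> p x = p' x" "\<And>x. x \<in> topspace P \<Longrightarrow> q x = q' x"
    and "\<And>a. a \<in> topspace A \<Longrightarrow> f a = f' a" "\<And>b. b \<in> topspace B \<Longrightarrow> g b = g' b"
    and S: "strict_hpb P A B Z p q f g"
  shows "strict_hpb P A B Z p' q' f' g'"
proof -
  have "p x \<in> topspace A" if "x \<in> topspace P" for x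
    using S that unfolding strict_hpb_iff commuting_square_def by (auto dest: continuous_map_funspace)
  then show ?thesis
    unfolding strict_hpb_def
    by (intro homotopy_pullback_cong[OF assms(1-4) _ S[unfolded strict_hpb_def]]) (auto simp flip: assms(1,3))
qed

lemma strict_hpb_flip:
  assumes S: "strict_hpb P A B Z p q f g"
  shows "strict_hpb P B A Z q p g f"
proof -
  let ?flip = "\<lambda>x. (fst (snd x), fst x, \<lambda>s\<in>{0..1}. snd (snd x) (1 - s))"
  have flip: "continuous_map (hpb_space A B Z f g) (hpb_space B A Z g f) ?flip"
    for A :: "'x topology" and B :: "'y topology" and Z :: "'z topology" and f g
  proof (rule continuous_map_into_hpb_space)
    let ?H = "hpb_space A B Z f g"
    show "continuous_map ?H B (\<lambda>x. fst (snd x))" "continuous_map ?H A fst"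
      by (rule continuous_map_hpb_snd[OF continuous_map_self] continuous_map_hpb_fst[OF continuous_map_self])+
    have s: "continuous_map (prod_topology ?H UI) UI snd" by (rule continuous_map_snd)
    have "continuous_map (prod_topology ?H UI) UI (\<lambda>z. 1 - snd z)"
      using s unfolding continuous_map_UI_iff by (auto intro!: continuous_map_diff)
    then show "continuous2 ?H UI Z (\<lambda>x s. snd (snd x) (1 - s))"
      by (rule continuous_map_hpb_path[OF continuous_map_fst])
  qed (auto simp: in_topspace_hpb_space)
  have ff: "homotopic_maps (hpb_space A B Z f g) (hpb_space A B Z f g) (?flip \<circ> ?flip) id"
    for A :: "'x topology" and B :: "'y topology" and Z :: "'z topology" and f g
  proof (rule homotopic_with_equal)
    show "continuous_map (hpb_space A B Z f g) (hpb_space A B Z f g) (?flip \<circ> ?flip)"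
      by (rule continuous_map_compose[OF flip flip])
    fix x assume "x \<in> topspace (hpb_space A B Z f g)"
    then show "(?flip \<circ> ?flip) x = id x"
      by (auto simp: in_topspace_hpb_space prod_eq_iff fun_eq_iff extensional_def)
  qed auto
  have he: "homotopy_equivalence_map (hpb_space A B Z f g) (hpb_space B A Z g f) ?flip"
    unfolding homotopy_equivalence_map_def by (intro conjI exI[of _ ?flip] flip ff)
  have sq: "commuting_square P A B Z p q f g" and c: "homotopy_equivalence_map P (hpb_space A B Z f g) (constant_cone p q f)"
    using S by (auto simp: strict_hpb_iff)
  have "homotopy_equivalence_map P (hpb_space B A Z g f) (?flip \<circ> constant_cone p q f)"
    by (rule he_comp[OF c he])
  then have "homotopy_equivalence_map P (hpb_space B A Z g f) (constant_cone q p g)"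
    by (rule he_cong) (use sq in \<open>auto simp: commuting_square_def intro!: restrict_ext\<close>)
  then show ?thesis
    using sq by (auto simp: strict_hpb_iff commuting_square_def)
qed

section \<open>Cubes and strings of arrows\<close>

lemma topspace_cube: "topspace (cube n) = {..<n} \<rightarrow>\<^sub>E {0..1}"
  by (simp add: cube_def)

lemma compact_space_cube: "compact_space (cube n)" and Hausdorff_space_cube: "Hausdorff_space (cube n)"
  unfolding cube_def
  by (simp_all add: compact_space_product_topology Hausdorff_space_product_topology compact_space_UI Hausdorff_space_UI)

lemma continuous_map_into_cube:
  "(\<And>j. j < n \<Longrightarrow> continuous_map T UI (\<lambda>t. e t j)) \<Longrightarrow> continuous_map T (cube n) (\<lambda>t. \<lambda>j\<in>{..<n}. e t j)"
  unfolding cube_def by (rule continuous_map_into_product) simp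

lemma continuous_map_cube_coordinate:
  "continuous_map T (cube n) e \<Longrightarrow> j < n \<Longrightarrow> continuous_map T UI (\<lambda>t. e t j)"
  unfolding cube_def by (rule continuous_map_product_component) auto

text \<open>This embeds the cube of dimension \<open>n\<close> as a face of the next one, in which the new coordinate is \<open>x\<close>.\<close>

definition cube_cons :: "real \<Rightarrow> nat \<Rightarrow> (nat \<Rightarrow> real) \<Rightarrow> nat \<Rightarrow> real" where
  "cube_cons x n t = (\<lambda>j\<in>{..<Suc n}. case j of 0 \<Rightarrow> x | Suc i \<Rightarrow> t i)"

text \<open>Only the coordinate \<open>0\<close> is raised. Taking maxima is what makes this compatible with
  \<open>cube_merge\<close>, since \<open>max\<close> is associative.\<close>

definition cube_raise :: "nat \<Rightarrow> real \<Rightarrow> (nat \<Rightarrow> real) \<Rightarrow> nat \<Rightarrow> real" where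
  "cube_raise n u t = (\<lambda>j\<in>{..<n}. if j = 0 then max u (t 0) else t j)"

lemma cube_memD: "t \<in> topspace (cube n) \<Longrightarrow> j < n \<Longrightarrow> 0 \<le> t j \<and> t j \<le> 1"
  by (auto simp: topspace_cube PiE_iff)

lemma cube_cons_in: "t \<in> topspace (cube n) \<Longrightarrow> 0 \<le> x \<Longrightarrow> x \<le> 1 \<Longrightarrow> cube_cons x n t \<in> topspace (cube (Suc n))"
  by (auto simp: cube_cons_def topspace_cube PiE_iff split: nat.splits)

lemma cube_raise_in: "t \<in> topspace (cube n) \<Longrightarrow> 0 \<le> u \<Longrightarrow> u \<le> 1 \<Longrightarrow> cube_raise n u t \<in> topspace (cube n)"
  by (auto simp: cube_raise_def topspace_cube PiE_iff)

lemma cube_init_in: "t \<in> topspace (cube m) \<Longrightarrow> n \<le> m \<Longrightarrow> cube_init n t \<in> topspace (cube n)"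
  by (auto simp: cube_init_def topspace_cube PiE_iff)

lemma cube_shift_in: "t \<in> topspace (cube m) \<Longrightarrow> n + k \<le> m \<Longrightarrow> cube_shift k n t \<in> topspace (cube n)"
  by (auto simp: cube_shift_def topspace_cube PiE_iff)

lemma cube_del_in: "t \<in> topspace (cube (Suc n)) \<Longrightarrow> cube_del i n t \<in> topspace (cube n)"
  by (auto simp: cube_del_def topspace_cube PiE_iff)

lemma cube_merge_in: "t \<in> topspace (cube (Suc n)) \<Longrightarrow> cube_merge i n t \<in> topspace (cube n)"
  by (auto simp: cube_merge_def topspace_cube PiE_iff le_max_iff_disj)

lemma cube_del_cons: "cube_del (Suc k) (Suc n) (cube_cons x (Suc n) t) = cube_cons x n (cube_del k n t)"
  by (auto simp: cube_del_def cube_cons_def fun_eq_iff split: nat.splits)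

lemma cube_del_0_cons: "t \<in> topspace (cube n) \<Longrightarrow> cube_del 0 n (cube_cons x n t) = t"
  by (auto simp: cube_del_def cube_cons_def fun_eq_iff topspace_cube PiE_iff extensional_def split: nat.splits)

lemma cube_merge_cons: "cube_merge (Suc k) (Suc n) (cube_cons x (Suc n) t) = cube_cons x n (cube_merge k n t)"
  by (auto simp: cube_merge_def cube_cons_def fun_eq_iff split: nat.splits)

lemma cube_merge_0_cons: "t \<in> topspace (cube n) \<Longrightarrow> cube_merge 0 n (cube_cons 0 n t) = t"
  by (auto simp: cube_merge_def cube_cons_def fun_eq_iff topspace_cube PiE_iff extensional_def max_def split: nat.splits)

lemma cube_init_cons: "n \<le> m \<Longrightarrow> cube_init (Suc n) (cube_cons x m t) = cube_cons x n (cube_init n t)"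
  by (auto simp: cube_init_def cube_cons_def fun_eq_iff split: nat.splits)

lemma cube_shift_cons: "n + k \<le> m \<Longrightarrow> cube_shift (Suc k) n (cube_cons x m t) = cube_shift k n t"
  by (auto simp: cube_shift_def cube_cons_def fun_eq_iff split: nat.splits)

lemma cube_del_shift: "cube_del k n (cube_shift 1 (Suc n) t) = cube_shift 1 n (cube_del (Suc k) (Suc n) t)"
  by (auto simp: cube_del_def cube_shift_def fun_eq_iff)

lemma cube_shift_shift: "n + k \<le> m \<Longrightarrow> cube_shift k n (cube_shift 1 m t) = cube_shift (Suc k) n t"
  by (auto simp: cube_shift_def fun_eq_iff)

lemma cube_init_shift: "n \<le> m \<Longrightarrow> cube_init n (cube_shift 1 m t) = cube_shift 1 n (cube_init (Suc n) t)"
  by (auto simp: cube_init_def cube_shift_def fun_eq_iff)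

lemma cube_del_0_shift: "cube_del 0 n (cube_shift 1 (Suc n) t) = cube_shift 1 n (cube_merge 0 (Suc n) t)"
  by (auto simp: cube_del_def cube_merge_def cube_shift_def fun_eq_iff)

lemma cube_merge_shift: "cube_merge k n (cube_shift 1 (Suc n) t) = cube_shift 1 n (cube_merge (Suc k) (Suc n) t)"
  by (auto simp: cube_merge_def cube_shift_def fun_eq_iff)

lemma cube_del_raise: "cube_del (Suc k) n (cube_raise (Suc n) u t) = cube_raise n u (cube_del (Suc k) n t)"
  by (auto simp: cube_del_def cube_raise_def fun_eq_iff)

lemma cube_init_raise: "n \<le> m \<Longrightarrow> cube_init n (cube_raise m u t) = cube_raise n u (cube_init n t)"
  by (auto simp: cube_init_def cube_raise_def fun_eq_iff)

lemma cube_shift_raise: "n + Suc k \<le> m \<Longrightarrow> cube_shift (Suc k) n (cube_raise m u t) = cube_shift (Suc k) n t"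
  by (auto simp: cube_shift_def cube_raise_def fun_eq_iff)

lemma cube_merge_raise: "cube_merge k n (cube_raise (Suc n) u t) = cube_raise n u (cube_merge k n t)"
  by (auto simp: cube_merge_def cube_raise_def fun_eq_iff max.assoc)

lemma cube_raise_0: "t \<in> topspace (cube n) \<Longrightarrow> cube_raise n 0 t = t"
  by (auto simp: cube_raise_def fun_eq_iff topspace_cube PiE_iff extensional_def max_def)

text \<open>Strings of composable arrows starting at \<open>c\<close>; the empty string is included, and its end is \<open>c\<close>.\<close>

fun path_from :: "('o, 'm) cat \<Rightarrow> 'o \<Rightarrow> 'm list \<Rightarrow> bool" where
  "path_from C c [] \<longleftrightarrow> True"
| "path_from C c (f # fs) \<longleftrightarrow> f \<in> Ar C \<and> Dom C f = c \<and> path_from C (Cod C f) fs"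

fun path_end :: "('o, 'm) cat \<Rightarrow> 'o \<Rightarrow> 'm list \<Rightarrow> 'o" where
  "path_end C c [] = c"
| "path_end C c (f # fs) = path_end C (Cod C f) fs"

lemma path_from_append [simp]:
  "path_from C c (fs @ gs) \<longleftrightarrow> path_from C c fs \<and> path_from C (path_end C c fs) gs"
  by (induction fs arbitrary: c) auto

lemma path_end_append [simp]: "path_end C c (fs @ gs) = path_end C (path_end C c fs) gs"
  by (induction fs arbitrary: c) auto

lemma path_end_last: "fs \<noteq> [] \<Longrightarrow> path_end C c fs = Cod C (last fs)"
  by (induction fs arbitrary: c) auto

lemma path_from_comp_string: "path_from C c fs \<Longrightarrow> fs \<noteq> [] \<Longrightarrow> comp_string C fs"
proof (induction fs arbitrary: c)
  case (Cons f fs)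
  show ?case
  proof (cases fs)
    case (Cons g gs)
    then have fs: "comp_string C fs" using Cons.IH[of "Cod C f"] Cons.prems by simp
    have "Cod C ((f # fs) ! i) = Dom C ((f # fs) ! (i + 1))" if "i + 1 < length (f # fs)" for i
      using that fs Cons.prems \<open>fs = g # gs\<close> by (cases i) (auto simp: comp_string_def)
    then show ?thesis
      using fs Cons.prems by (simp add: comp_string_def)
  qed (use Cons.prems in \<open>simp add: comp_string_def\<close>)
qed simp

lemma path_from_hd: "path_from C c fs \<Longrightarrow> fs \<noteq> [] \<Longrightarrow> Dom C (hd fs) = c"
  by (cases fs) auto

section \<open>Rectification of coherent diagrams\<close>

lemma restrict_empty: "restrict f {} = (\<lambda>x. undefined)"
  by (simp add: fun_eq_iff)

locale coherent_diagram =
  fixes C :: "('o, 'm) cat" and D :: "('o, 'm, 'a) hc_diagram"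
  assumes diagram: "hc_functor C D"
    and Idt_arrow: "\<And>a. a \<in> Ob C \<Longrightarrow> Idt C a \<in> Ar C \<and> Dom C (Idt C a) = a \<and> Cod C (Idt C a) = a"
    and Cmp_arrow: "\<And>f g. \<lbrakk>f \<in> Ar C; g \<in> Ar C; Cod C f = Dom C g\<rbrakk> \<Longrightarrow>
      Cmp C g f \<in> Ar C \<and> Dom C (Cmp C g f) = Dom C f \<and> Cod C (Cmp C g f) = Cod C g"
begin

lemmas diagram_clauses = diagram[unfolded hc_functor_def, THEN conjunct2]

lemma coh_continuous:
  assumes "path_from C c fs" "fs \<noteq> []"
  shows "continuous2 (cube (length fs - 1)) (space_at D c) (space_at D (path_end C c fs)) (coh D fs)"
  using diagram_clauses[THEN conjunct1, rule_format, OF path_from_comp_string[OF assms]]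
  by (simp add: path_end_last[OF assms(2)] path_from_hd[OF assms] case_prod_unfold)

lemma coh_compose:
  assumes "path_from C c (fs @ f # g # gs)" "t \<in> topspace (cube (Suc (length fs + length gs)))"
    "x \<in> topspace (space_at D c)" "t (length fs) = 0"
  shows "coh D (fs @ f # g # gs) t x =
    coh D (fs @ Cmp C g f # gs) (cube_del (length fs) (length fs + length gs) t) x"
proof -
  have "comp_string C (fs @ [f, g] @ gs)" "Dom C (hd (fs @ [f, g] @ gs)) = c"
    using path_from_comp_string[OF assms(1)] path_from_hd[OF assms(1)] by auto
  then show ?thesis
    using diagram_clauses[THEN conjunct2, THEN conjunct1, rule_format, of fs f g gs t x] assms(2-4) by simp
qed

lemma coh_split:
  assumes "path_from C c (fs @ gs)" "fs \<noteq> []" "gs \<noteq> []" "t \<in> topspace (cube (length fs + length gs - 1))"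
    "x \<in> topspace (space_at D c)" "t (length fs - 1) = 1"
  shows "coh D (fs @ gs) t x = coh D gs (cube_shift (length fs) (length gs - 1) t)
    (coh D fs (cube_init (length fs - 1) t) x)"
proof -
  have "comp_string C (fs @ gs)" "Dom C (hd fs) = c"
    using path_from_comp_string[OF assms(1)] path_from_hd[of C c fs] assms by auto
  then show ?thesis
    using diagram_clauses[THEN conjunct2, THEN conjunct2, THEN conjunct1, rule_format, of fs gs t x] assms by simp
qed

lemma coh_identity:
  assumes "a \<in> Ob C" "x \<in> topspace (space_at D a)" "t \<in> topspace (cube 0)"
  shows "coh D [Idt C a] t x = x"
  using diagram_clauses[THEN conjunct2, THEN conjunct2, THEN conjunct2, THEN conjunct1, rule_format, OF assms(1,3,2)] .

lemma coh_identity_first: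
  assumes "path_from C c (Idt C a # gs)" "gs \<noteq> []" "a \<in> Ob C" "t \<in> topspace (cube (length gs))"
    "x \<in> topspace (space_at D c)"
  shows "coh D (Idt C a # gs) t x = coh D gs (cube_del 0 (length gs - 1) t) x"
proof -
  have "comp_string C ([Idt C a] @ gs)" "a = c"
    using path_from_comp_string[OF assms(1)] path_from_hd[OF assms(1)] Idt_arrow[OF assms(3)] by auto
  then show ?thesis
    using diagram_clauses[THEN conjunct2, THEN conjunct2, THEN conjunct2, THEN conjunct2, THEN conjunct1, rule_format, of gs a t x]
      assms by simp
qed

lemma coh_identity_last:
  assumes "path_from C c (fs @ [Idt C a])" "fs \<noteq> []" "a \<in> Ob C" "t \<in> topspace (cube (length fs))"
    "x \<in> topspace (space_at D c)"
  shows "coh D (fs @ [Idt C a]) t x = coh D fs (cube_init (length fs - 1) t) x"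
proof -
  have "comp_string C (fs @ [Idt C a])" "Dom C (hd fs) = c"
    using path_from_comp_string[OF assms(1)] path_from_hd[of C c fs] assms by auto
  then show ?thesis
    using diagram_clauses[THEN conjunct2, THEN conjunct2, THEN conjunct2, THEN conjunct2, THEN conjunct2, THEN conjunct1, rule_format, of fs a t x]
      assms by simp
qed

lemma coh_identity_inside:
  assumes "path_from C c (fs @ Idt C a # gs)" "fs \<noteq> []" "gs \<noteq> []" "a \<in> Ob C"
    "t \<in> topspace (cube (length fs + length gs))" "x \<in> topspace (space_at D c)"
  shows "coh D (fs @ Idt C a # gs) t x = coh D (fs @ gs) (cube_merge (length fs - 1) (length fs + length gs - 1) t) x"
proof -
  have "comp_string C (fs @ [Idt C a] @ gs)" "Dom C (hd fs) = c"
    using path_from_comp_string[OF assms(1)] path_from_hd[of C c fs] assms by auto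
  then show ?thesis
    using diagram_clauses[THEN conjunct2, THEN conjunct2, THEN conjunct2, THEN conjunct2, THEN conjunct2, THEN conjunct2, rule_format, of fs gs a t x]
      assms by simp
qed

text \<open>These are the laws of a coherent diagram for strings that begin with one additional formal arrow
  from a cone point to \<open>c\<close>. For a string of \<open>n\<close> arrows
  there are \<open>n\<close> coordinates, one at each source; coordinate \<open>0\<close> belongs to \<open>c\<close> itself. It is subject
  to the splitting law at \<open>1\<close>, but at \<open>0\<close> composition with the formal arrow gives no condition:
  that face is the family seen from the next object, see \<open>rect_act\<close>.\<close>

definition coherent_family :: "'o \<Rightarrow> ('m list \<Rightarrow> (nat \<Rightarrow> real) \<Rightarrow> 'a) \<Rightarrow> bool" where
  "coherent_family c r \<longleftrightarrow>
     (\<forall>fs f g gs t. path_from C c (fs @ f # g # gs) \<and> t \<in> topspace (cube (Suc (Suc (length fs + length gs)))) \<and>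
        t (Suc (length fs)) = 0 \<longrightarrow>
        r (fs @ f # g # gs) t = r (fs @ Cmp C g f # gs) (cube_del (Suc (length fs)) (Suc (length fs + length gs)) t)) \<and>
     (\<forall>fs gs t. gs \<noteq> [] \<and> path_from C c (fs @ gs) \<and> t \<in> topspace (cube (length fs + length gs)) \<and> t (length fs) = 1 \<longrightarrow>
        r (fs @ gs) t = coh D gs (cube_shift (Suc (length fs)) (length gs - 1) t) (r fs (cube_init (length fs) t))) \<and>
     (\<forall>a fs gs t. gs \<noteq> [] \<and> a \<in> Ob C \<and> path_from C c (fs @ Idt C a # gs) \<and>
        t \<in> topspace (cube (Suc (length fs + length gs))) \<longrightarrow>
        r (fs @ Idt C a # gs) t = r (fs @ gs) (cube_merge (length fs) (length fs + length gs) t)) \<and>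
     (\<forall>a fs t. a \<in> Ob C \<and> path_from C c (fs @ [Idt C a]) \<and> t \<in> topspace (cube (Suc (length fs))) \<longrightarrow>
        r (fs @ [Idt C a]) t = r fs (cube_init (length fs) t))"

definition rect :: "'o \<Rightarrow> ('m list \<Rightarrow> (nat \<Rightarrow> real) \<Rightarrow> 'a) topology" where
  "rect c = subtopology
     (product_topology (\<lambda>fs. mapping_space (cube (length fs)) (space_at D (path_end C c fs))) {fs. path_from C c fs})
     {r. coherent_family c r}"

text \<open>The restrictions make equality of families equality on strings from \<open>c\<close> and on points of cubes, as
  the topologies on mapping spaces and on products require.\<close>

definition family :: "'o \<Rightarrow> ('m list \<Rightarrow> (nat \<Rightarrow> real) \<Rightarrow> 'a) \<Rightarrow> 'm list \<Rightarrow> (nat \<Rightarrow> real) \<Rightarrow> 'a" where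
  "family c r = (\<lambda>fs\<in>{fs. path_from C c fs}. \<lambda>t\<in>topspace (cube (length fs)). r fs t)"

lemma family_apply [simp]:
  "path_from C c fs \<Longrightarrow> t \<in> topspace (cube (length fs)) \<Longrightarrow> family c r fs t = r fs t"
  by (simp add: family_def)

lemma family_eqI:
  assumes "\<And>fs t. path_from C c fs \<Longrightarrow> t \<in> topspace (cube (length fs)) \<Longrightarrow> r fs t = r' fs t"
  shows "family c r = family c r'"
  using assms by (auto simp: family_def fun_eq_iff)

lemma rect_eq_family: "r \<in> topspace (rect c) \<Longrightarrow> r = family c r"
  by (fastforce simp: rect_def family_def topspace_mapping_space PiE_iff extensional_def fun_eq_iff)

lemma rect_coherent: "r \<in> topspace (rect c) \<Longrightarrow> coherent_family c r"
  by (simp add: rect_def)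

lemma rect_compose:
  assumes "r \<in> topspace (rect c)" "path_from C c (fs @ f # g # gs)"
    "t \<in> topspace (cube (Suc (Suc (length fs + length gs))))" "t (Suc (length fs)) = 0"
  shows "r (fs @ f # g # gs) t = r (fs @ Cmp C g f # gs) (cube_del (Suc (length fs)) (Suc (length fs + length gs)) t)"
  using rect_coherent[OF assms(1), unfolded coherent_family_def, THEN conjunct1] assms by blast

lemma rect_split:
  assumes "r \<in> topspace (rect c)" "path_from C c (fs @ gs)" "gs \<noteq> []"
    "t \<in> topspace (cube (length fs + length gs))" "t (length fs) = 1"
  shows "r (fs @ gs) t = coh D gs (cube_shift (Suc (length fs)) (length gs - 1) t) (r fs (cube_init (length fs) t))"
  using rect_coherent[OF assms(1), unfolded coherent_family_def, THEN conjunct2, THEN conjunct1] assms by blast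

lemma rect_identity:
  assumes "r \<in> topspace (rect c)" "path_from C c (fs @ Idt C a # gs)" "gs \<noteq> []" "a \<in> Ob C"
    "t \<in> topspace (cube (Suc (length fs + length gs)))"
  shows "r (fs @ Idt C a # gs) t = r (fs @ gs) (cube_merge (length fs) (length fs + length gs) t)"
  using rect_coherent[OF assms(1), unfolded coherent_family_def, THEN conjunct2, THEN conjunct2, THEN conjunct1] assms by blast

lemma rect_identity_last:
  assumes "r \<in> topspace (rect c)" "path_from C c (fs @ [Idt C a])" "a \<in> Ob C" "t \<in> topspace (cube (Suc (length fs)))"
  shows "r (fs @ [Idt C a]) t = r fs (cube_init (length fs) t)"
  using rect_coherent[OF assms(1), unfolded coherent_family_def, THEN conjunct2, THEN conjunct2, THEN conjunct2] assms by blast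

lemma continuous_map_rect_eval:
  assumes "continuous_map T (rect c) r" "path_from C c fs" "continuous_map T (cube (length fs)) e"
  shows "continuous_map T (space_at D (path_end C c fs)) (\<lambda>t. r t fs (e t))"
proof -
  have "continuous_map T (mapping_space (cube (length fs)) (space_at D (path_end C c fs))) (\<lambda>t. r t fs)"
    using assms(1,2) unfolding rect_def continuous_map_in_subtopology
    by (intro continuous_map_product_component[where i = fs and I = "{fs. path_from C c fs}" and
          X = "\<lambda>fs. mapping_space (cube (length fs)) (space_at D (path_end C c fs))"]) auto
  then show ?thesis
    by (rule continuous2_apply[OF continuous_map_evaluation[OF compact_space_cube Hausdorff_space_cube] _ assms(3)])
qed

text \<open>Together with \<open>continuous_map_rect_eval\<close> this reduces continuity for \<open>rect c\<close> to continuity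
  of each member of a family in its cube coordinates, by the exponential law.\<close>

lemma continuous_map_into_rect:
  assumes "\<And>fs. path_from C c fs \<Longrightarrow>
      continuous2 T (cube (length fs)) (space_at D (path_end C c fs)) (\<lambda>t. r t fs)"
    and "\<And>t. t \<in> topspace T \<Longrightarrow> coherent_family c (family c (r t))"
  shows "continuous_map T (rect c) (\<lambda>t. family c (r t))"
  unfolding rect_def
proof (rule continuous_map_into_subtopology)
  show "continuous_map T (product_topology (\<lambda>fs. mapping_space (cube (length fs)) (space_at D (path_end C c fs)))
      {fs. path_from C c fs}) (\<lambda>t. family c (r t))"
    unfolding family_def
    by (rule continuous_map_into_product, rule continuous_map_curry, rule assms(1)) simp
qed (use assms(2) in auto)

lemma coherent_familyI:
  assumes "\<And>fs f g gs t. \<lbrakk>path_from C c (fs @ f # g # gs); t \<in> topspace (cube (Suc (Suc (length fs + length gs))));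
      t (Suc (length fs)) = 0\<rbrakk> \<Longrightarrow>
      r (fs @ f # g # gs) t = r (fs @ Cmp C g f # gs) (cube_del (Suc (length fs)) (Suc (length fs + length gs)) t)"
    and "\<And>fs gs t. \<lbrakk>gs \<noteq> []; path_from C c (fs @ gs); t \<in> topspace (cube (length fs + length gs)); t (length fs) = 1\<rbrakk> \<Longrightarrow>
      r (fs @ gs) t = coh D gs (cube_shift (Suc (length fs)) (length gs - 1) t) (r fs (cube_init (length fs) t))"
    and "\<And>a fs gs t. \<lbrakk>gs \<noteq> []; a \<in> Ob C; path_from C c (fs @ Idt C a # gs);
      t \<in> topspace (cube (Suc (length fs + length gs)))\<rbrakk> \<Longrightarrow>
      r (fs @ Idt C a # gs) t = r (fs @ gs) (cube_merge (length fs) (length fs + length gs) t)"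
    and "\<And>a fs t. \<lbrakk>a \<in> Ob C; path_from C c (fs @ [Idt C a]); t \<in> topspace (cube (Suc (length fs)))\<rbrakk> \<Longrightarrow>
      r (fs @ [Idt C a]) t = r fs (cube_init (length fs) t)"
  shows "coherent_family c (family c r)"
  unfolding coherent_family_def
proof (intro conjI allI impI; elim conjE)
  fix fs f g gs t
  assume 1: "path_from C c (fs @ f # g # gs)" "t \<in> topspace (cube (Suc (Suc (length fs + length gs))))" "t (Suc (length fs)) = 0"
  then have "path_from C c (fs @ Cmp C g f # gs)" using Cmp_arrow by auto
  then show "family c r (fs @ f # g # gs) t =
    family c r (fs @ Cmp C g f # gs) (cube_del (Suc (length fs)) (Suc (length fs + length gs)) t)"
    using 1 assms(1)[OF 1] cube_del_in[OF 1(2)] by (simp del: path_from_append)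
next
  fix fs gs t
  assume 1: "gs \<noteq> []" "path_from C c (fs @ gs)" "t \<in> topspace (cube (length fs + length gs))" "t (length fs) = 1"
  show "family c r (fs @ gs) t =
    coh D gs (cube_shift (Suc (length fs)) (length gs - 1) t) (family c r fs (cube_init (length fs) t))"
    using 1 assms(2)[OF 1] cube_init_in[OF 1(3)] by simp
next
  fix a fs gs t
  assume 1: "gs \<noteq> []" "a \<in> Ob C" "path_from C c (fs @ Idt C a # gs)" "t \<in> topspace (cube (Suc (length fs + length gs)))"
  have "path_from C c (fs @ gs)" using 1 Idt_arrow[OF 1(2)] by auto
  then show "family c r (fs @ Idt C a # gs) t = family c r (fs @ gs) (cube_merge (length fs) (length fs + length gs) t)"
    using 1 assms(3)[OF 1] cube_merge_in[OF 1(4)] by (simp del: path_from_append)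
next
  fix a fs t
  assume 1: "a \<in> Ob C" "path_from C c (fs @ [Idt C a])" "t \<in> topspace (cube (Suc (length fs)))"
  show "family c r (fs @ [Idt C a]) t = family c r fs (cube_init (length fs) t)"
    using 1 assms(3)[of "[]"] assms(4)[OF 1] cube_init_in[OF 1(3)] by simp
qed

text \<open>The family is restricted to the face on which the formal arrow has been composed with \<open>f\<close>.\<close>

definition rect_act :: "'m \<Rightarrow> ('m list \<Rightarrow> (nat \<Rightarrow> real) \<Rightarrow> 'a) \<Rightarrow> 'm list \<Rightarrow> (nat \<Rightarrow> real) \<Rightarrow> 'a" where
  "rect_act f r = family (Cod C f) (\<lambda>fs t. r (f # fs) (cube_cons 0 (length fs) t))"

lemma continuous_map_rect_act:
  assumes f: "f \<in> Ar C" "Dom C f = c"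
  shows "continuous_map (rect c) (rect (Cod C f)) (rect_act f)"
  unfolding rect_act_def
proof (rule continuous_map_into_rect)
  fix fs assume fs: "path_from C (Cod C f) fs"
  let ?T = "prod_topology (rect c) (cube (length fs))"
  have "continuous_map ?T (cube (length (f # fs))) (\<lambda>z. cube_cons 0 (length fs) (snd z))"
    unfolding cube_cons_def length_Cons
  proof (rule continuous_map_into_cube)
    fix j assume "j < Suc (length fs)"
    then show "continuous_map ?T UI (\<lambda>t. case j of 0 \<Rightarrow> 0 | Suc i \<Rightarrow> snd t i)"
      using continuous_map_cube_coordinate[OF continuous_map_snd] by (cases j) auto
  qed
  from continuous_map_rect_eval[OF continuous_map_fst _ this]
  show "continuous2 (rect c) (cube (length fs)) (space_at D (path_end C (Cod C f) fs))
     (\<lambda>r t. r (f # fs) (cube_cons 0 (length fs) t))"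
    using fs f by simp
next
  fix r assume r: "r \<in> topspace (rect c)"
  show "coherent_family (Cod C f) (family (Cod C f) (\<lambda>fs t. r (f # fs) (cube_cons 0 (length fs) t)))"
  proof (rule coherent_familyI)
    fix fs f1 g gs t
    assume 1: "path_from C (Cod C f) (fs @ f1 # g # gs)" "t \<in> topspace (cube (Suc (Suc (length fs + length gs))))" "t (Suc (length fs)) = 0"
    have "r ((f # fs) @ f1 # g # gs) (cube_cons 0 (Suc (Suc (length fs + length gs))) t) =
      r ((f # fs) @ Cmp C g f1 # gs) (cube_del (Suc (length (f # fs))) (Suc (length (f # fs) + length gs))
        (cube_cons 0 (Suc (Suc (length fs + length gs))) t))"
      by (rule rect_compose[OF r]) (use 1 f cube_cons_in[OF 1(2)] in \<open>auto simp: cube_cons_def\<close>)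
    then show "r (f # fs @ f1 # g # gs) (cube_cons 0 (length (fs @ f1 # g # gs)) t) =
      r (f # fs @ Cmp C g f1 # gs) (cube_cons 0 (length (fs @ Cmp C g f1 # gs))
        (cube_del (Suc (length fs)) (Suc (length fs + length gs)) t))"
      by (simp add: cube_del_cons)
  next
    fix fs gs t
    assume 1: "gs \<noteq> []" "path_from C (Cod C f) (fs @ gs)" "t \<in> topspace (cube (length fs + length gs))" "t (length fs) = 1"
    have "r ((f # fs) @ gs) (cube_cons 0 (length fs + length gs) t) =
      coh D gs (cube_shift (Suc (length (f # fs))) (length gs - 1) (cube_cons 0 (length fs + length gs) t))
        (r (f # fs) (cube_init (length (f # fs)) (cube_cons 0 (length fs + length gs) t)))"
      by (rule rect_split[OF r]) (use 1 f cube_cons_in[OF 1(3)] in \<open>auto simp: cube_cons_def\<close>)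
    then show "r (f # fs @ gs) (cube_cons 0 (length (fs @ gs)) t) =
      coh D gs (cube_shift (Suc (length fs)) (length gs - 1) t)
        (r (f # fs) (cube_cons 0 (length fs) (cube_init (length fs) t)))"
      using 1(1) by (cases gs) (simp_all add: cube_shift_cons cube_init_cons)
  next
    fix a fs gs t
    assume 1: "gs \<noteq> []" "a \<in> Ob C" "path_from C (Cod C f) (fs @ Idt C a # gs)" "t \<in> topspace (cube (Suc (length fs + length gs)))"
    have "r ((f # fs) @ Idt C a # gs) (cube_cons 0 (Suc (length fs + length gs)) t) =
      r ((f # fs) @ gs) (cube_merge (length (f # fs)) (length (f # fs) + length gs) (cube_cons 0 (Suc (length fs + length gs)) t))"
      by (rule rect_identity[OF r]) (use 1 f cube_cons_in[OF 1(4)] in auto)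
    then show "r (f # fs @ Idt C a # gs) (cube_cons 0 (length (fs @ Idt C a # gs)) t) =
      r (f # fs @ gs) (cube_cons 0 (length (fs @ gs)) (cube_merge (length fs) (length fs + length gs) t))"
      by (simp add: cube_merge_cons)
  next
    fix a fs t
    assume 1: "a \<in> Ob C" "path_from C (Cod C f) (fs @ [Idt C a])" "t \<in> topspace (cube (Suc (length fs)))"
    have "r ((f # fs) @ [Idt C a]) (cube_cons 0 (Suc (length fs)) t) =
      r (f # fs) (cube_init (length (f # fs)) (cube_cons 0 (Suc (length fs)) t))"
      by (rule rect_identity_last[OF r]) (use 1 f cube_cons_in[OF 1(3)] in auto)
    then show "r (f # fs @ [Idt C a]) (cube_cons 0 (length (fs @ [Idt C a])) t) =
      r (f # fs) (cube_cons 0 (length fs) (cube_init (length fs) t))"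
      by (simp add: cube_init_cons)
  qed
qed

lemma rect_act_in: "f \<in> Ar C \<Longrightarrow> r \<in> topspace (rect (Dom C f)) \<Longrightarrow> rect_act f r \<in> topspace (rect (Cod C f))"
  using continuous_map_funspace[OF continuous_map_rect_act[of f]] by auto

text \<open>Acting twice sets the first two coordinates to \<open>0\<close>, and the coherence law for composition at the
  second of them replaces \<open>f\<close> and \<open>g\<close> by their composite.\<close>

lemma rect_act_comp:
  assumes f: "f \<in> Ar C" and g: "g \<in> Ar C" "Dom C g = Cod C f" and r: "r \<in> topspace (rect (Dom C f))"
  shows "rect_act g (rect_act f r) = rect_act (Cmp C g f) r"
proof -
  have cod: "Cod C (Cmp C g f) = Cod C g" using Cmp_arrow[of f g] f g by simp
  show ?thesis
    unfolding rect_act_def[of g] rect_act_def[of "Cmp C g f"] cod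
  proof (rule family_eqI)
    fix fs t assume fs: "path_from C (Cod C g) fs" and t: "t \<in> topspace (cube (length fs))"
    have t0: "cube_cons 0 (length fs) t \<in> topspace (cube (Suc (length fs)))"
      by (rule cube_cons_in[OF t]) auto
    have "rect_act f r (g # fs) (cube_cons 0 (length fs) t) =
      r (f # g # fs) (cube_cons 0 (Suc (length fs)) (cube_cons 0 (length fs) t))"
      using fs g t0 by (simp add: rect_act_def)
    also have "\<dots> = r ([] @ Cmp C g f # fs)
      (cube_del (Suc 0) (Suc (length fs)) (cube_cons 0 (Suc (length fs)) (cube_cons 0 (length fs) t)))"
      using rect_compose[OF r, of "[]" f g fs "cube_cons 0 (Suc (length fs)) (cube_cons 0 (length fs) t)"]
        fs f g cube_cons_in[OF t0, of 0] by (simp add: cube_cons_def)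
    also have "\<dots> = r (Cmp C g f # fs) (cube_cons 0 (length fs) t)"
      by (simp add: cube_del_cons cube_del_0_cons[OF t])
    finally show "rect_act f r (g # fs) (cube_cons 0 (length fs) t) = r (Cmp C g f # fs) (cube_cons 0 (length fs) t)" .
  qed
qed

text \<open>A prepended identity merges the first coordinate, which is \<open>0\<close>, into the next one.\<close>

lemma rect_act_Idt:
  assumes c: "c \<in> Ob C" and r: "r \<in> topspace (rect c)"
  shows "rect_act (Idt C c) r = r"
proof -
  have "rect_act (Idt C c) r = family c r"
    unfolding rect_act_def using Idt_arrow[OF c]
  proof (simp, intro family_eqI)
    fix fs t assume fs: "path_from C c fs" and t: "t \<in> topspace (cube (length fs))"
    have t0: "cube_cons 0 (length fs) t \<in> topspace (cube (Suc (length fs)))"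
      by (rule cube_cons_in[OF t]) auto
    show "r (Idt C c # fs) (cube_cons 0 (length fs) t) = r fs t"
    proof (cases "fs = []")
      case True
      have "r [Idt C c] (cube_cons 0 0 t) = r [] (cube_init 0 (cube_cons 0 0 t))"
        using rect_identity_last[OF r, of "[]" c "cube_cons 0 0 t"] c Idt_arrow[OF c] t0 True by simp
      moreover have "cube_init 0 (cube_cons 0 0 t) = t"
        using t True by (simp add: cube_init_def topspace_cube restrict_empty)
      ultimately show ?thesis using True by simp
    next
      case False
      have "r (Idt C c # fs) (cube_cons 0 (length fs) t) = r fs (cube_merge 0 (length fs) (cube_cons 0 (length fs) t))"
        using rect_identity[OF r, of "[]" c fs "cube_cons 0 (length fs) t"] c Idt_arrow[OF c] t0 False fs by simp
      then show ?thesis by (simp add: cube_merge_0_cons[OF t])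
    qed
  qed
  then show ?thesis using rect_eq_family[OF r] by simp
qed

abbreviation point0 :: "nat \<Rightarrow> real" where
  "point0 \<equiv> (\<lambda>j\<in>{..<0}. 0)"

lemma cube_0: "topspace (cube 0) = {point0}"
  by (simp add: topspace_cube restrict_empty)

definition vertex :: "('m list \<Rightarrow> (nat \<Rightarrow> real) \<Rightarrow> 'a) \<Rightarrow> 'a" where
  "vertex r = r [] point0"

text \<open>The cone that is independent of coordinate \<open>0\<close> and consists of the given coherence maps applied to
  the point \<open>x\<close>.\<close>

definition coherent_extension :: "'o \<Rightarrow> 'a \<Rightarrow> 'm list \<Rightarrow> (nat \<Rightarrow> real) \<Rightarrow> 'a" where
  "coherent_extension c x =
     family c (\<lambda>fs t. if fs = [] then x else coh D fs (cube_shift 1 (length fs - 1) t) x)"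

text \<open>Pushing coordinate \<open>0\<close> up to \<open>1\<close> forces the family into the form given by the splitting law, which is
  the coherent extension of its vertex.\<close>

definition slide :: "'o \<Rightarrow> real \<Rightarrow> ('m list \<Rightarrow> (nat \<Rightarrow> real) \<Rightarrow> 'a) \<Rightarrow> 'm list \<Rightarrow> (nat \<Rightarrow> real) \<Rightarrow> 'a" where
  "slide c u r = family c (\<lambda>fs t. r fs (cube_raise (length fs) u t))"

lemma continuous_map_vertex: "continuous_map (rect c) (space_at D c) vertex"
  using continuous_map_rect_eval[OF continuous_map_self, of c "[]" "\<lambda>_. point0"]
  unfolding vertex_def by (simp add: topspace_cube restrict_empty)

lemma vertex_in: "r \<in> topspace (rect c) \<Longrightarrow> vertex r \<in> topspace (space_at D c)"
  using continuous_map_funspace[OF continuous_map_vertex] by blast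

lemma continuous_map_coherent_extension: "continuous_map (space_at D c) (rect c) (coherent_extension c)"
  unfolding coherent_extension_def
proof (rule continuous_map_into_rect)
  fix fs assume fs: "path_from C c fs"
  show "continuous2 (space_at D c) (cube (length fs)) (space_at D (path_end C c fs))
      (\<lambda>x t. if fs = [] then x else coh D fs (cube_shift 1 (length fs - 1) t) x)"
  proof (cases "fs = []")
    case True
    then show ?thesis by (simp add: continuous_map_fst)
  next
    case False
    let ?T = "prod_topology (space_at D c) (cube (length fs))"
    have "continuous_map ?T (cube (length fs - 1)) (\<lambda>z. cube_shift 1 (length fs - 1) (snd z))"
      unfolding cube_shift_def
      by (rule continuous_map_into_cube, rule continuous_map_cube_coordinate[OF continuous_map_snd]) auto
    from continuous2_apply[OF coh_continuous[OF fs False] this continuous_map_fst]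
    show ?thesis using False by simp
  qed
next
  fix x assume x: "x \<in> topspace (space_at D c)"
  show "coherent_family c (family c (\<lambda>fs t. if fs = [] then x else coh D fs (cube_shift 1 (length fs - 1) t) x))"
  proof (rule coherent_familyI)
    fix fs f g gs t
    assume 1: "path_from C c (fs @ f # g # gs)" "t \<in> topspace (cube (Suc (Suc (length fs + length gs))))" "t (Suc (length fs)) = 0"
    let ?t = "cube_shift 1 (Suc (length fs + length gs)) t"
    have "coh D (fs @ f # g # gs) ?t x = coh D (fs @ Cmp C g f # gs) (cube_del (length fs) (length fs + length gs) ?t) x"
    proof (rule coh_compose[OF 1(1) _ x])
      show "?t \<in> topspace (cube (Suc (length fs + length gs)))" by (rule cube_shift_in[OF 1(2)]) simp
      show "?t (length fs) = 0" using 1(3) by (simp add: cube_shift_def)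
    qed
    then show "(if fs @ f # g # gs = [] then x else coh D (fs @ f # g # gs) (cube_shift 1 (length (fs @ f # g # gs) - 1) t) x) =
      (if fs @ Cmp C g f # gs = [] then x else coh D (fs @ Cmp C g f # gs) (cube_shift 1 (length (fs @ Cmp C g f # gs) - 1)
        (cube_del (Suc (length fs)) (Suc (length fs + length gs)) t)) x)"
      using cube_del_shift[of "length fs" "length fs + length gs" t] by simp
  next
    fix fs gs t
    assume 1: "gs \<noteq> []" "path_from C c (fs @ gs)" "t \<in> topspace (cube (length fs + length gs))" "t (length fs) = 1"
    show "(if fs @ gs = [] then x else coh D (fs @ gs) (cube_shift 1 (length (fs @ gs) - 1) t) x) =
      coh D gs (cube_shift (Suc (length fs)) (length gs - 1) t)
       (if fs = [] then x else coh D fs (cube_shift 1 (length fs - 1) (cube_init (length fs) t)) x)"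
    proof (cases fs)
      case Nil
      then show ?thesis using 1(1) by simp
    next
      case (Cons f fs')
      let ?t = "cube_shift 1 (length fs + length gs - 1) t"
      have "coh D (fs @ gs) ?t x = coh D gs (cube_shift (length fs) (length gs - 1) ?t)
          (coh D fs (cube_init (length fs - 1) ?t) x)"
      proof (rule coh_split[OF 1(2) _ 1(1) _ x])
        show "?t \<in> topspace (cube (length fs + length gs - 1))" by (rule cube_shift_in[OF 1(3)]) (simp add: Cons)
        have "length fs - 1 < length fs + length gs - 1" using Cons 1(1) by (cases gs) auto
        then show "?t (length fs - 1) = 1" using 1(4) Cons by (simp add: cube_shift_def)
      qed (simp add: Cons)
      moreover have "cube_shift (length fs) (length gs - 1) ?t = cube_shift (Suc (length fs)) (length gs - 1) t"
        using 1(1) by (intro cube_shift_shift) (cases gs; auto)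
      moreover have "cube_init (length fs - 1) ?t = cube_shift 1 (length fs - 1) (cube_init (length fs) t)"
        using cube_init_shift[of "length fs - 1" "length fs + length gs - 1" t] Cons by simp
      ultimately show ?thesis using Cons by simp
    qed
  next
    fix a fs gs t
    assume 1: "gs \<noteq> []" "a \<in> Ob C" "path_from C c (fs @ Idt C a # gs)" "t \<in> topspace (cube (Suc (length fs + length gs)))"
    obtain n where n: "length gs = Suc n" using 1(1) by (cases gs) auto
    show "(if fs @ Idt C a # gs = [] then x else coh D (fs @ Idt C a # gs) (cube_shift 1 (length (fs @ Idt C a # gs) - 1) t) x) =
      (if fs @ gs = [] then x else coh D (fs @ gs) (cube_shift 1 (length (fs @ gs) - 1) (cube_merge (length fs) (length fs + length gs) t)) x)"
    proof (cases fs)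
      case Nil
      have "coh D (Idt C a # gs) (cube_shift 1 (length gs) t) x =
          coh D gs (cube_del 0 (length gs - 1) (cube_shift 1 (length gs) t)) x"
        by (rule coh_identity_first[OF _ 1(1,2) _ x]) (use 1 Nil cube_shift_in[OF 1(4)] in auto)
      then show ?thesis using Nil 1(1) n cube_del_0_shift[of n t] by simp
    next
      case (Cons f fs')
      have "coh D (fs @ Idt C a # gs) (cube_shift 1 (length fs + length gs) t) x =
          coh D (fs @ gs) (cube_merge (length fs - 1) (length fs + length gs - 1) (cube_shift 1 (length fs + length gs) t)) x"
        by (rule coh_identity_inside[OF 1(3) _ 1(1,2) _ x]) (use Cons cube_shift_in[OF 1(4)] in auto)
      then show ?thesis
        using Cons 1(1) n cube_merge_shift[of "length fs'" "length fs' + Suc n" t] by simp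
    qed
  next
    fix a fs t
    assume 1: "a \<in> Ob C" "path_from C c (fs @ [Idt C a])" "t \<in> topspace (cube (Suc (length fs)))"
    show "(if fs @ [Idt C a] = [] then x else coh D (fs @ [Idt C a]) (cube_shift 1 (length (fs @ [Idt C a]) - 1) t) x) =
      (if fs = [] then x else coh D fs (cube_shift 1 (length fs - 1) (cube_init (length fs) t)) x)"
    proof (cases fs)
      case Nil
      then have "c = a" using 1 Idt_arrow[OF 1(1)] by simp
      then show ?thesis
        using Nil coh_identity[OF 1(1), of x "cube_shift 1 0 t"] x cube_shift_in[OF 1(3), of 0 1] by simp
    next
      case (Cons f fs')
      have "coh D (fs @ [Idt C a]) (cube_shift 1 (length fs) t) x = coh D fs (cube_init (length fs - 1) (cube_shift 1 (length fs) t)) x"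
        by (rule coh_identity_last[OF 1(2) _ 1(1) _ x]) (use Cons cube_shift_in[OF 1(3)] in auto)
      then show ?thesis
        using Cons cube_init_shift[of "length fs'" "length fs" t] by simp
    qed
  qed
qed

lemma vertex_coherent_extension: "vertex (coherent_extension c x) = x"
  unfolding vertex_def coherent_extension_def by (subst family_apply) (simp_all add: cube_0)

lemma continuous_map_slide: "continuous2 UI (rect c) (rect c) (slide c)"
  unfolding slide_def
proof (rule continuous_map_into_rect)
  fix fs assume fs: "path_from C c fs"
  let ?T = "prod_topology (prod_topology UI (rect c)) (cube (length fs))"
  have u: "continuous_map ?T UI (\<lambda>z. fst (fst z))" and r: "continuous_map ?T (rect c) (\<lambda>z. snd (fst z))"
    by (rule continuous_map_fst_of[OF continuous_map_fst] continuous_map_snd_of[OF continuous_map_fst])+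
  have "continuous_map ?T (cube (length fs)) (\<lambda>z. cube_raise (length fs) (fst (fst z)) (snd z))"
    unfolding cube_raise_def
  proof (rule continuous_map_into_cube)
    fix j assume j: "j < length fs"
    then show "continuous_map ?T UI (\<lambda>z. if j = 0 then max (fst (fst z)) (snd z 0) else snd z j)"
      using continuous_map_UI_max[OF u continuous_map_cube_coordinate[OF continuous_map_snd]]
        continuous_map_cube_coordinate[OF continuous_map_snd j] by (cases "j = 0") simp_all
  qed
  from continuous_map_rect_eval[OF r fs this]
  show "continuous2 (prod_topology UI (rect c)) (cube (length fs)) (space_at D (path_end C c fs))
     (\<lambda>z t. snd z fs (cube_raise (length fs) (fst z) t))" .
next
  fix z assume z: "z \<in> topspace (prod_topology UI (rect c))"
  obtain u r where ur: "z = (u, r)" "0 \<le> u" "u \<le> 1" and r: "r \<in> topspace (rect c)"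
    using z by (cases z) auto
  note raise = cube_raise_in[OF _ ur(2,3)]
  have "coherent_family c (family c (\<lambda>fs t. r fs (cube_raise (length fs) u t)))"
  proof (rule coherent_familyI)
    fix fs f g gs t
    assume 1: "path_from C c (fs @ f # g # gs)" "t \<in> topspace (cube (Suc (Suc (length fs + length gs))))" "t (Suc (length fs)) = 0"
    have "r (fs @ f # g # gs) (cube_raise (Suc (Suc (length fs + length gs))) u t) =
      r (fs @ Cmp C g f # gs) (cube_del (Suc (length fs)) (Suc (length fs + length gs)) (cube_raise (Suc (Suc (length fs + length gs))) u t))"
      by (rule rect_compose[OF r 1(1) raise[OF 1(2)]]) (use 1(3) in \<open>simp add: cube_raise_def\<close>)
    then show "r (fs @ f # g # gs) (cube_raise (length (fs @ f # g # gs)) u t) =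
      r (fs @ Cmp C g f # gs) (cube_raise (length (fs @ Cmp C g f # gs)) u (cube_del (Suc (length fs)) (Suc (length fs + length gs)) t))"
      by (simp add: cube_del_raise)
  next
    fix fs gs t
    assume 1: "gs \<noteq> []" "path_from C c (fs @ gs)" "t \<in> topspace (cube (length fs + length gs))" "t (length fs) = 1"
    obtain n where n: "length gs = Suc n" using 1(1) by (cases gs) auto
    have "r (fs @ gs) (cube_raise (length fs + length gs) u t) =
      coh D gs (cube_shift (Suc (length fs)) (length gs - 1) (cube_raise (length fs + length gs) u t))
        (r fs (cube_init (length fs) (cube_raise (length fs + length gs) u t)))"
      by (rule rect_split[OF r 1(2,1) raise[OF 1(3)]]) (use 1(4) n ur in \<open>auto simp: cube_raise_def\<close>)
    then show "r (fs @ gs) (cube_raise (length (fs @ gs)) u t) =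
      coh D gs (cube_shift (Suc (length fs)) (length gs - 1) t) (r fs (cube_raise (length fs) u (cube_init (length fs) t)))"
      by (simp add: cube_shift_raise cube_init_raise n)
  next
    fix a fs gs t
    assume 1: "gs \<noteq> []" "a \<in> Ob C" "path_from C c (fs @ Idt C a # gs)" "t \<in> topspace (cube (Suc (length fs + length gs)))"
    show "r (fs @ Idt C a # gs) (cube_raise (length (fs @ Idt C a # gs)) u t) =
      r (fs @ gs) (cube_raise (length (fs @ gs)) u (cube_merge (length fs) (length fs + length gs) t))"
      using rect_identity[OF r 1(3,1,2) raise[OF 1(4)]] by (simp add: cube_merge_raise)
  next
    fix a fs t
    assume 1: "a \<in> Ob C" "path_from C c (fs @ [Idt C a])" "t \<in> topspace (cube (Suc (length fs)))"
    show "r (fs @ [Idt C a]) (cube_raise (length (fs @ [Idt C a])) u t) = r fs (cube_raise (length fs) u (cube_init (length fs) t))"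
      using rect_identity_last[OF r 1(2,1) raise[OF 1(3)]] by (simp add: cube_init_raise)
  qed
  then show "coherent_family c (family c (\<lambda>fs t. snd z fs (cube_raise (length fs) (fst z) t)))"
    by (simp add: ur)
qed

text \<open>The vertex map is left inverse to the coherent extension, and sliding contracts \<open>rect c\<close> onto its
  image.\<close>

lemma he_vertex: "homotopy_equivalence_map (rect c) (space_at D c) vertex"
proof -
  have "homotopic_maps (rect c) (rect c) id (coherent_extension c \<circ> vertex)"
  proof (rule homotopic_mapsI[OF continuous_map_slide])
    fix r assume r: "r \<in> topspace (rect c)"
    have "slide c 0 r = family c r"
      unfolding slide_def by (rule family_eqI) (simp add: cube_raise_0)
    then show "slide c 0 r = id r" using rect_eq_family[OF r] by simp
    show "slide c 1 r = (coherent_extension c \<circ> vertex) r"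
      unfolding slide_def coherent_extension_def comp_def
    proof (rule family_eqI)
      fix fs t assume fs: "path_from C c fs" and t: "t \<in> topspace (cube (length fs))"
      show "r fs (cube_raise (length fs) 1 t) =
        (if fs = [] then vertex r else coh D fs (cube_shift 1 (length fs - 1) t) (vertex r))"
      proof (cases fs)
        case Nil
        then show ?thesis by (simp add: vertex_def cube_raise_def restrict_empty)
      next
        case (Cons f fs')
        have t0: "t 0 \<le> 1" using cube_memD[OF t] Cons by simp
        have "cube_raise (length fs) 1 t 0 = 1" using t0 Cons by (simp add: cube_raise_def)
        then have "r fs (cube_raise (length fs) 1 t) =
          coh D fs (cube_shift (Suc 0) (length fs - 1) (cube_raise (length fs) 1 t))
            (r [] (cube_init 0 (cube_raise (length fs) 1 t)))"
          using rect_split[OF r, of "[]" fs "cube_raise (length fs) 1 t"] fs Cons cube_raise_in[OF t, of 1] by simp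
        moreover have "cube_shift (Suc 0) (length fs - 1) (cube_raise (length fs) 1 t) = cube_shift (Suc 0) (length fs - 1) t"
          using Cons by (intro cube_shift_raise) simp
        ultimately show ?thesis using Cons by (simp add: vertex_def cube_init_def restrict_empty)
      qed
    qed
  qed
  note 1 = homotopic_with_symD[OF this]
  have 2: "homotopic_maps (space_at D c) (space_at D c) (vertex \<circ> coherent_extension c) id"
    by (rule homotopic_with_equal)
       (auto simp: vertex_coherent_extension intro: continuous_map_compose[OF continuous_map_coherent_extension continuous_map_vertex])
  show ?thesis
    unfolding homotopy_equivalence_map_def
    by (intro conjI exI[of _ "coherent_extension c"] continuous_map_vertex continuous_map_coherent_extension 1 2)
qed

end

section \<open>Coherent squares and their rectification\<close>

context coherent_diagram
begin

text \<open>As the coordinate \<open>u\<close> runs from \<open>0\<close> to \<open>1\<close>, the value on the string \<open>[f]\<close> runs from the vertex of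
  the family acted on by \<open>f\<close> to the image of its vertex under \<open>f\<close>: the naturality homotopy of the
  vertex map.\<close>

definition rect_edge :: "'m \<Rightarrow> real \<Rightarrow> ('m list \<Rightarrow> (nat \<Rightarrow> real) \<Rightarrow> 'a) \<Rightarrow> 'a" where
  "rect_edge f u r = r [f] (\<lambda>j\<in>{..<1}. u)"

text \<open>The coherence of the naturality homotopies for two composable arrows. Its four
  sides are identified in \<open>rect_face_left\<close>, \<open>rect_face_right\<close>, \<open>rect_face_start\<close> and
  \<open>rect_face_end\<close>.\<close>

definition rect_face :: "'m \<Rightarrow> 'm \<Rightarrow> real \<Rightarrow> real \<Rightarrow> ('m list \<Rightarrow> (nat \<Rightarrow> real) \<Rightarrow> 'a) \<Rightarrow> 'a" where
  "rect_face f g u t r = r [f, g] (\<lambda>j\<in>{..<2}. if j = 0 then u else t)"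

lemma edge_in: "0 \<le> u \<Longrightarrow> u \<le> 1 \<Longrightarrow> (\<lambda>j\<in>{..<1}. u) \<in> topspace (cube 1)"
  by (auto simp: topspace_cube)

lemma face_in: "0 \<le> u \<Longrightarrow> u \<le> 1 \<Longrightarrow> 0 \<le> t \<Longrightarrow> t \<le> 1 \<Longrightarrow> (\<lambda>j\<in>{..<2}. if j = 0 then u else t) \<in> topspace (cube 2)"
  by (auto simp: topspace_cube)

lemma continuous_map_rect_edge:
  assumes f: "f \<in> Ar C"
  shows "continuous2 UI (rect (Dom C f)) (space_at D (Cod C f)) (rect_edge f)"
proof -
  have "continuous_map (prod_topology UI (rect (Dom C f))) (cube (length [f])) (\<lambda>z. \<lambda>j\<in>{..<1}. fst z)"
    unfolding length_Cons list.size One_nat_def plus_nat.simps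
    by (rule continuous_map_into_cube, rule continuous_map_fst)
  from continuous_map_rect_eval[OF continuous_map_snd _ this] f
  show ?thesis by (simp add: rect_edge_def)
qed

lemma continuous_map_rect_face:
  assumes f: "f \<in> Ar C" and g: "g \<in> Ar C" "Dom C g = Cod C f"
  shows "continuous2 (prod_topology UI UI) (rect (Dom C f)) (space_at D (Cod C g))
    (\<lambda>y. rect_face f g (fst y) (snd y))"
proof -
  let ?T = "prod_topology (prod_topology UI UI) (rect (Dom C f))"
  have "continuous_map ?T (cube (length [f, g])) (\<lambda>z. \<lambda>j\<in>{..<2}. if j = 0 then fst (fst z) else snd (fst z))"
    unfolding length_Cons list.size numeral_2_eq_2 plus_nat.simps
  proof (rule continuous_map_into_cube)
    fix j :: nat
    show "continuous_map ?T UI (\<lambda>z. if j = 0 then fst (fst z) else snd (fst z))"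
      using continuous_map_fst_of[OF continuous_map_fst, of UI UI "rect (Dom C f)"]
        continuous_map_snd_of[OF continuous_map_fst, of UI UI "rect (Dom C f)"]
      by (cases "j = 0") (simp_all only: if_True if_False simp_thms)
  qed
  from continuous_map_rect_eval[OF continuous_map_snd _ this] f g
  show ?thesis by (simp add: rect_face_def)
qed

lemma rect_edge_0: "f \<in> Ar C \<Longrightarrow> rect_edge f 0 r = vertex (rect_act f r)"
  unfolding vertex_def rect_act_def
  by (subst family_apply) (auto simp: cube_0 rect_edge_def cube_cons_def fun_eq_iff intro!: arg_cong[where f = "r [f]"])

lemma rect_edge_1:
  assumes f: "f \<in> Ar C" and r: "r \<in> topspace (rect (Dom C f))"
  shows "rect_edge f 1 r = act D f (vertex r)"
  using rect_split[OF r, of "[]" "[f]" "\<lambda>j\<in>{..<1}. 1"] f edge_in[of 1]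
  by (simp add: rect_edge_def act_def vertex_def cube_init_def cube_shift_def restrict_empty)

lemma rect_face_left:
  assumes f: "f \<in> Ar C" and g: "g \<in> Ar C" "Dom C g = Cod C f" and t: "0 \<le> t" "t \<le> 1"
  shows "rect_face f g 0 t r = rect_edge g t (rect_act f r)"
proof -
  have "cube_cons 0 1 (\<lambda>j\<in>{..<1}. t) = (\<lambda>j\<in>{..<2}. if j = 0 then 0 else t)"
    by (auto simp: cube_cons_def fun_eq_iff split: nat.splits)
  then show ?thesis
    unfolding rect_edge_def rect_act_def rect_face_def
    by (subst family_apply) (use f g edge_in[OF t] in \<open>auto\<close>)
qed

lemma rect_face_end:
  assumes f: "f \<in> Ar C" and g: "g \<in> Ar C" "Dom C g = Cod C f" and r: "r \<in> topspace (rect (Dom C f))" and u: "0 \<le> u" "u \<le> 1"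
  shows "rect_face f g u 1 r = act D g (rect_edge f u r)"
proof -
  have "cube_init 1 (\<lambda>j\<in>{..<2}. if j = 0 then u else 1) = (\<lambda>j\<in>{..<1}. u)"
    by (auto simp: cube_init_def fun_eq_iff)
  then show ?thesis
    using rect_split[OF r, of "[f]" "[g]" "\<lambda>j\<in>{..<2}. if j = 0 then u else 1"] f g face_in[OF u, of 1]
    by (simp add: rect_face_def rect_edge_def act_def cube_shift_def restrict_empty numeral_2_eq_2)
qed

lemma rect_face_start:
  assumes f: "f \<in> Ar C" and g: "g \<in> Ar C" "Dom C g = Cod C f" and r: "r \<in> topspace (rect (Dom C f))" and u: "0 \<le> u" "u \<le> 1"
  shows "rect_face f g u 0 r = rect_edge (Cmp C g f) u r"
proof -
  have "cube_del 1 1 (\<lambda>j\<in>{..<2}. if j = 0 then u else 0) = (\<lambda>j\<in>{..<1}. u)"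
    by (auto simp: cube_del_def fun_eq_iff)
  then show ?thesis
    using rect_compose[OF r, of "[]" f g "[]" "\<lambda>j\<in>{..<2}. if j = 0 then u else 0"] f g face_in[OF u, of 0]
    by (simp add: rect_face_def rect_edge_def numeral_2_eq_2)
qed

lemma rect_face_right:
  assumes f: "f \<in> Ar C" and g: "g \<in> Ar C" "Dom C g = Cod C f" and r: "r \<in> topspace (rect (Dom C f))" and t: "0 \<le> t" "t \<le> 1"
  shows "rect_face f g 1 t r = act2 D f g t (vertex r)"
proof -
  have "cube_shift 1 1 (\<lambda>j\<in>{..<2}. if j = 0 then 1 else t) = (\<lambda>j\<in>{..<1}. t)"
    by (auto simp: cube_shift_def fun_eq_iff)
  then show ?thesis
    using rect_split[OF r, of "[]" "[f, g]" "\<lambda>j\<in>{..<2}. if j = 0 then 1 else t"] f g face_in[OF _ _ t, of 1]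
    by (simp add: rect_face_def act2_def vertex_def cube_init_def restrict_empty numeral_2_eq_2)
qed

lemma continuous_map_act: "f \<in> Ar C \<Longrightarrow> continuous_map (space_at D (Dom C f)) (space_at D (Cod C f)) (act D f)"
  unfolding act_def
  using continuous2_apply[OF coh_continuous[of "Dom C f" "[f]"] _ continuous_map_self, of "\<lambda>_. point0"]
  by (simp add: cube_0 restrict_empty)

lemma continuous_map_act2:
  assumes f: "f \<in> Ar C" and g: "g \<in> Ar C" "Dom C g = Cod C f"
  shows "continuous2 UI (space_at D (Dom C f)) (space_at D (Cod C g)) (act2 D f g)"
proof -
  have "continuous_map (prod_topology UI (space_at D (Dom C f))) (cube 1) (\<lambda>z. \<lambda>j\<in>{..<1}. fst z)"
    by (rule continuous_map_into_cube, rule continuous_map_fst)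
  then have "continuous_map (prod_topology UI (space_at D (Dom C f))) (cube (length [f, g] - 1)) (\<lambda>z. \<lambda>j\<in>{..<1}. fst z)"
    by simp
  from continuous2_apply[OF coh_continuous this continuous_map_snd] f g
  show ?thesis by (simp add: act2_def restrict_def)
qed

lemma act2_0:
  assumes f: "f \<in> Ar C" and g: "g \<in> Ar C" "Dom C g = Cod C f" and x: "x \<in> topspace (space_at D (Dom C f))"
  shows "act2 D f g 0 x = act D (Cmp C g f) x"
  using coh_compose[of "Dom C f" "[]" f g "[]" "\<lambda>j\<in>{..<1}. 0" x] f g x edge_in[of 0]
  by (simp add: act2_def act_def cube_del_def restrict_empty)

lemma act2_1:
  assumes f: "f \<in> Ar C" and g: "g \<in> Ar C" "Dom C g = Cod C f" and x: "x \<in> topspace (space_at D (Dom C f))"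
  shows "act2 D f g 1 x = act D g (act D f x)"
  using coh_split[of "Dom C f" "[f]" "[g]" "\<lambda>j\<in>{..<1}. 1" x] f g x edge_in[of 1]
  by (simp add: act2_def act_def cube_init_def cube_shift_def restrict_empty)

definition arrow_square :: "'m \<Rightarrow> 'm \<Rightarrow> 'm \<Rightarrow> 'm \<Rightarrow> bool" where
  "arrow_square p f q g \<longleftrightarrow> p \<in> Ar C \<and> f \<in> Ar C \<and> q \<in> Ar C \<and> g \<in> Ar C \<and>
     Dom C f = Cod C p \<and> Dom C g = Cod C q \<and> Dom C q = Dom C p \<and> Cmp C f p = Cmp C g q"

lemma arrow_square_Cod: "arrow_square p f q g \<Longrightarrow> Cod C g = Cod C f"
  unfolding arrow_square_def by (metis Cmp_arrow)

lemma continuous_map_square_filler: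
  assumes "arrow_square p f q g"
  shows "continuous2 UI (space_at D (Dom C p)) (space_at D (Cod C f)) (square_filler D p f q g)"
proof -
  note sq = assms[unfolded arrow_square_def]
  let ?T = "prod_topology UI (space_at D (Dom C p))"
  have s: "continuous_map ?T euclideanreal fst" "\<And>z. z \<in> topspace ?T \<Longrightarrow> 0 \<le> fst z \<and> fst z \<le> 1"
    using continuous_map_fst[of UI "space_at D (Dom C p)"] unfolding continuous_map_UI_iff by auto
  have s1: "continuous_map ?T UI (\<lambda>z. max 0 (1 - 2 * fst z))" and s2: "continuous_map ?T UI (\<lambda>z. max 0 (2 * fst z - 1))"
    unfolding continuous_map_UI_iff
    by (intro conjI ballI continuous_map_real_max continuous_map_diff continuous_map_real_mult s
        continuous_map_const[THEN iffD2]; use s(2) in force)+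
  have p: "continuous_map ?T (space_at D (Cod C f)) (\<lambda>z. act2 D p f (max 0 (1 - 2 * fst z)) (snd z))"
    by (rule continuous2_apply[OF continuous_map_act2 s1 continuous_map_snd]) (use sq in auto)
  have q: "continuous_map ?T (space_at D (Cod C f)) (\<lambda>z. act2 D q g (max 0 (2 * fst z - 1)) (snd z))"
    unfolding arrow_square_Cod[OF assms, symmetric]
    by (rule continuous2_apply[OF continuous_map_act2 s2]) (use sq in \<open>auto intro: continuous_map_snd\<close>)
  have "continuous_map ?T (space_at D (Cod C f)) (\<lambda>z. if fst z \<le> 1/2 then act2 D p f (max 0 (1 - 2 * fst z)) (snd z)
      else act2 D q g (max 0 (2 * fst z - 1)) (snd z))"
  proof (rule continuous_map_case_le[OF s(1) _ p q])
    fix z assume z: "z \<in> topspace ?T" "fst z = 1/2"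
    have "snd z \<in> topspace (space_at D (Dom C p))" using z(1) by auto
    then show "act2 D p f (max 0 (1 - 2 * fst z)) (snd z) = act2 D q g (max 0 (2 * fst z - 1)) (snd z)"
      unfolding z(2) using sq by (simp add: act2_0)
  qed simp
  then show ?thesis
    by (rule continuous_map_eq) (auto simp: square_filler_def max_def)
qed

lemma square_filler_0:
  assumes "arrow_square p f q g" "x \<in> topspace (space_at D (Dom C p))"
  shows "square_filler D p f q g 0 x = act D f (act D p x)"
  using assms by (simp add: square_filler_def act2_1 arrow_square_def)

lemma square_filler_1:
  assumes "arrow_square p f q g" "x \<in> topspace (space_at D (Dom C p))"
  shows "square_filler D p f q g 1 x = act D g (act D q x)"
  using assms by (simp add: square_filler_def act2_1 arrow_square_def)

lemma rect_act_square:
  assumes "arrow_square p f q g" "r \<in> topspace (rect (Dom C p))"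
  shows "rect_act f (rect_act p r) = rect_act g (rect_act q r)"
  using assms rect_act_comp[of p f r] rect_act_comp[of q g r] by (simp add: arrow_square_def)

lemma rect_face_filler_left:
  assumes "arrow_square p f q g" "r \<in> topspace (rect (Dom C p))" "0 \<le> s" "s \<le> 1/2"
  shows "rect_face p f 1 (1 - 2 * s) r = square_filler D p f q g s (vertex r)"
  using assms by (simp add: square_filler_def rect_face_right arrow_square_def)

lemma rect_face_filler_right:
  assumes "arrow_square p f q g" "r \<in> topspace (rect (Dom C p))" "1/2 \<le> s" "s \<le> 1"
  shows "rect_face q g 1 (2 * s - 1) r = square_filler D p f q g s (vertex r)"
proof (cases "s = 1/2")
  case True
  then show ?thesis
    using assms vertex_in[OF assms(2)] unfolding True
    by (simp add: square_filler_def rect_face_right arrow_square_def act2_0)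
next
  case False
  then show ?thesis
    using assms by (simp add: square_filler_def rect_face_right arrow_square_def)
qed

lemma rect_face_diagonal:
  assumes "arrow_square p f q g" "r \<in> topspace (rect (Dom C p))" "0 \<le> u" "u \<le> 1"
  shows "rect_face p f u 0 r = rect_face q g u 0 r"
  using assms by (simp add: rect_face_start arrow_square_def)

text \<open>Both triangles of a square in the index category have the same diagonal, so the two faces \<open>rect_face\<close>
  for them share the side with second coordinate \<open>0\<close> and form the families \<open>L\<close> and \<open>R\<close> of the
  strictification lemma.\<close>

lemma sends_to_pullback_iff_rect:
  assumes sq: "arrow_square p f q g"
  shows "sends_to_pullback C D p f q g \<longleftrightarrow>
    strict_hpb (rect (Dom C p)) (rect (Cod C p)) (rect (Cod C q)) (rect (Cod C f))
      (rect_act p) (rect_act q) (rect_act f) (rect_act g)"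
proof -
  note a = sq[unfolded arrow_square_def] and cod = arrow_square_Cod[OF sq]
  have c: "p \<in> Ar C" "f \<in> Ar C" "q \<in> Ar C" "g \<in> Ar C" "Dom C f = Cod C p" "Dom C g = Cod C q" "Dom C q = Dom C p"
    using a by auto
  note ca = continuous_map_act[OF c(1)] continuous_map_act[OF c(3), unfolded c(7)]
    continuous_map_act[OF c(2), unfolded c(5)] continuous_map_act[OF c(4), unfolded c(6) cod]
  note ce = continuous_map_rect_edge[OF c(2), unfolded c(5)] continuous_map_rect_edge[OF c(4), unfolded c(6) cod]
    continuous_map_rect_edge[OF c(1)] continuous_map_rect_edge[OF c(3), unfolded c(7)]
  note cf = continuous_map_rect_face[OF c(1,2,5)] continuous_map_rect_face[OF c(3,4,6), unfolded c(7) cod]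
  have strict: "commuting_square (rect (Dom C p)) (rect (Cod C p)) (rect (Cod C q)) (rect (Cod C f))
      (rect_act p) (rect_act q) (rect_act f) (rect_act g)"
    unfolding commuting_square_def
    using continuous_map_rect_act[OF c(1) refl] continuous_map_rect_act[OF c(3,7)]
      continuous_map_rect_act[OF c(2,5)] continuous_map_rect_act[OF c(4,6)] rect_act_square[OF sq] by (simp add: cod)
  show ?thesis
    unfolding sends_to_pullback_def
    by (rule homotopy_pullback_strictification[OF strict ca continuous_map_square_filler[OF sq]
          square_filler_0[OF sq] square_filler_1[OF sq] he_vertex he_vertex he_vertex he_vertex ce(1,2)
          _ _ _ _ ce(3,4) _ _ _ _ cf])
       (use c rect_act_in in \<open>simp_all add: rect_edge_0 rect_edge_1 rect_face_left rect_face_end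
          rect_face_diagonal[OF sq] rect_face_filler_left[OF sq] rect_face_filler_right[OF sq]\<close>)
qed

text \<open>The version for the squares in the definition of semi-ikeo maps, in which two of the corners are
  products: all homotopies are formed coordinatewise.\<close>

lemma product_homotopy_pullback_iff_rect:
  fixes I :: "'i set"
  assumes sq: "\<And>i. i \<in> I \<Longrightarrow> arrow_square p (f i) (q i) (g i)" and p: "p \<in> Ar C"
  shows "homotopy_pullback (space_at D (Dom C p)) (space_at D (Cod C p))
       (product_topology (\<lambda>i. space_at D (Cod C (q i))) I) (product_topology (\<lambda>i. space_at D (Cod C (f i))) I)
       (act D p) (\<lambda>y. \<lambda>i\<in>I. act D (q i) y) (\<lambda>x. \<lambda>i\<in>I. act D (f i) x) (\<lambda>y. \<lambda>i\<in>I. act D (g i) (y i))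
       (\<lambda>s y. \<lambda>i\<in>I. square_filler D p (f i) (q i) (g i) s y) \<longleftrightarrow>
    strict_hpb (rect (Dom C p)) (rect (Cod C p))
       (product_topology (\<lambda>i. rect (Cod C (q i))) I) (product_topology (\<lambda>i. rect (Cod C (f i))) I)
       (rect_act p) (\<lambda>y. \<lambda>i\<in>I. rect_act (q i) y) (\<lambda>x. \<lambda>i\<in>I. rect_act (f i) x) (\<lambda>y. \<lambda>i\<in>I. rect_act (g i) (y i))"
proof -
  have a: "f i \<in> Ar C" "q i \<in> Ar C" "g i \<in> Ar C" "Dom C (f i) = Cod C p" "Dom C (g i) = Cod C (q i)"
      "Dom C (q i) = Dom C p" "Cod C (g i) = Cod C (f i)" if "i \<in> I" for i
    using sq[OF that] arrow_square_Cod[OF sq[OF that]] unfolding arrow_square_def by auto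
  have comp: "continuous_map (product_topology X I) Z (\<lambda>y. h (y i))" if "i \<in> I" "continuous_map (X i) Z h"
    for X :: "'i \<Rightarrow> 'x topology" and Z :: "'z topology" and h i
    by (rule continuous_map_compose'[OF that(2) continuous_map_product_projection[OF that(1), of X]])
  have comp2: "continuous2 UI (product_topology X I) Z (\<lambda>u y. h u (y i))" if "i \<in> I" "continuous2 UI (X i) Z h"
    for X :: "'i \<Rightarrow> 'x topology" and Z :: "'z topology" and h i
    by (rule continuous2_apply[OF that(2) continuous_map_fst continuous_map_product_component[where X = X, OF continuous_map_snd that(1)]])
  let ?A = "product_topology (\<lambda>i. rect (Cod C (q i))) I"
  have inq: "y i \<in> topspace (rect (Cod C (q i)))" if "y \<in> topspace ?A" "i \<in> I" for y i
    using that by (auto simp: PiE_iff)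
  have strict: "commuting_square (rect (Dom C p)) (rect (Cod C p)) ?A (product_topology (\<lambda>i. rect (Cod C (f i))) I)
       (rect_act p) (\<lambda>y. \<lambda>i\<in>I. rect_act (q i) y) (\<lambda>x. \<lambda>i\<in>I. rect_act (f i) x) (\<lambda>y. \<lambda>i\<in>I. rect_act (g i) (y i))"
    unfolding commuting_square_def
  proof (intro conjI ballI)
    show "continuous_map (rect (Dom C p)) (rect (Cod C p)) (rect_act p)"
      by (rule continuous_map_rect_act[OF p refl])
    show "continuous_map (rect (Dom C p)) ?A (\<lambda>y. \<lambda>i\<in>I. rect_act (q i) y)"
      by (rule continuous_map_into_product, rule continuous_map_rect_act) (simp_all add: a)
    show "continuous_map (rect (Cod C p)) (product_topology (\<lambda>i. rect (Cod C (f i))) I) (\<lambda>x. \<lambda>i\<in>I. rect_act (f i) x)"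
      by (rule continuous_map_into_product, rule continuous_map_rect_act) (simp_all add: a)
    show "continuous_map ?A (product_topology (\<lambda>i. rect (Cod C (f i))) I) (\<lambda>y. \<lambda>i\<in>I. rect_act (g i) (y i))"
    proof (rule continuous_map_into_product)
      fix i assume i: "i \<in> I"
      show "continuous_map ?A (rect (Cod C (f i))) (\<lambda>y. rect_act (g i) (y i))"
        by (rule comp[OF i]) (use continuous_map_rect_act[OF a(3,5)[OF i]] in \<open>simp add: a(7)[OF i]\<close>)
    qed
    fix r assume "r \<in> topspace (rect (Dom C p))"
    then show "(\<lambda>i\<in>I. rect_act (f i) (rect_act p r)) = (\<lambda>i\<in>I. rect_act (g i) ((\<lambda>i\<in>I. rect_act (q i) r) i))"
      using rect_act_square[OF sq] by (auto intro!: restrict_ext)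
  qed
  show ?thesis
  proof (rule homotopy_pullback_strictification[OF strict,
        where eP = vertex and eA = vertex and eB = "\<lambda>y. \<lambda>i\<in>I. vertex (y i)" and eZ = "\<lambda>y. \<lambda>i\<in>I. vertex (y i)"
          and K = "\<lambda>u r. \<lambda>i\<in>I. rect_edge (f i) u r" and J = "\<lambda>u y. \<lambda>i\<in>I. rect_edge (g i) u (y i)"
          and M = "rect_edge p" and N = "\<lambda>u r. \<lambda>i\<in>I. rect_edge (q i) u r"
          and L = "\<lambda>u t r. \<lambda>i\<in>I. rect_face p (f i) u t r" and R = "\<lambda>u t r. \<lambda>i\<in>I. rect_face (q i) (g i) u t r"])
    show "homotopy_equivalence_map (rect (Dom C p)) (space_at D (Dom C p)) vertex"
      "homotopy_equivalence_map (rect (Cod C p)) (space_at D (Cod C p)) vertex"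
      by (rule he_vertex)+
    show "homotopy_equivalence_map ?A (product_topology (\<lambda>i. space_at D (Cod C (q i))) I) (\<lambda>y. \<lambda>i\<in>I. vertex (y i))"
      "homotopy_equivalence_map (product_topology (\<lambda>i. rect (Cod C (f i))) I)
         (product_topology (\<lambda>i. space_at D (Cod C (f i))) I) (\<lambda>y. \<lambda>i\<in>I. vertex (y i))"
      by (rule he_product_topology, rule he_vertex)+
    show "continuous_map (space_at D (Dom C p)) (space_at D (Cod C p)) (act D p)"
      by (rule continuous_map_act[OF p])
    show "continuous_map (space_at D (Dom C p)) (product_topology (\<lambda>i. space_at D (Cod C (q i))) I) (\<lambda>y. \<lambda>i\<in>I. act D (q i) y)"
    proof (rule continuous_map_into_product)
      fix i assume i: "i \<in> I"
      show "continuous_map (space_at D (Dom C p)) (space_at D (Cod C (q i))) (\<lambda>y. act D (q i) y)"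
        using continuous_map_act[OF a(2)[OF i]] by (simp add: a[OF i])
    qed
    show "continuous_map (space_at D (Cod C p)) (product_topology (\<lambda>i. space_at D (Cod C (f i))) I) (\<lambda>y. \<lambda>i\<in>I. act D (f i) y)"
    proof (rule continuous_map_into_product)
      fix i assume i: "i \<in> I"
      show "continuous_map (space_at D (Cod C p)) (space_at D (Cod C (f i))) (\<lambda>y. act D (f i) y)"
        using continuous_map_act[OF a(1)[OF i]] by (simp add: a[OF i])
    qed
    show "continuous_map (product_topology (\<lambda>i. space_at D (Cod C (q i))) I) (product_topology (\<lambda>i. space_at D (Cod C (f i))) I)
        (\<lambda>y. \<lambda>i\<in>I. act D (g i) (y i))"
    proof (rule continuous_map_into_product)
      fix i assume i: "i \<in> I"
      show "continuous_map (product_topology (\<lambda>i. space_at D (Cod C (q i))) I) (space_at D (Cod C (f i))) (\<lambda>y. act D (g i) (y i))"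
        by (rule comp[OF i]) (use continuous_map_act[OF a(3)[OF i]] in \<open>simp add: a[OF i]\<close>)
    qed
    show "continuous2 UI (space_at D (Dom C p)) (product_topology (\<lambda>i. space_at D (Cod C (f i))) I)
        (\<lambda>s y. \<lambda>i\<in>I. square_filler D p (f i) (q i) (g i) s y)"
      by (rule continuous_map_into_product, rule continuous_map_square_filler, rule sq)
    show "continuous2 UI (rect (Cod C p)) (product_topology (\<lambda>i. space_at D (Cod C (f i))) I) (\<lambda>u r. \<lambda>i\<in>I. rect_edge (f i) u r)"
    proof (rule continuous_map_into_product)
      fix i assume i: "i \<in> I"
      show "continuous2 UI (rect (Cod C p)) (space_at D (Cod C (f i))) (\<lambda>u r. rect_edge (f i) u r)"
        using continuous_map_rect_edge[OF a(1)[OF i]] by (simp add: a[OF i])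
    qed
    show "continuous2 UI (rect (Dom C p)) (product_topology (\<lambda>i. space_at D (Cod C (q i))) I) (\<lambda>u r. \<lambda>i\<in>I. rect_edge (q i) u r)"
    proof (rule continuous_map_into_product)
      fix i assume i: "i \<in> I"
      show "continuous2 UI (rect (Dom C p)) (space_at D (Cod C (q i))) (\<lambda>u r. rect_edge (q i) u r)"
        using continuous_map_rect_edge[OF a(2)[OF i]] by (simp add: a[OF i])
    qed
    show "continuous2 UI (rect (Dom C p)) (space_at D (Cod C p)) (rect_edge p)"
      by (rule continuous_map_rect_edge[OF p])
    show "continuous2 UI ?A (product_topology (\<lambda>i. space_at D (Cod C (f i))) I) (\<lambda>u y. \<lambda>i\<in>I. rect_edge (g i) u (y i))"
    proof (rule continuous_map_into_product)
      fix i assume i: "i \<in> I"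
      show "continuous2 UI ?A (space_at D (Cod C (f i))) (\<lambda>u y. rect_edge (g i) u (y i))"
        by (rule comp2[OF i]) (use continuous_map_rect_edge[OF a(3)[OF i]] in \<open>simp add: a[OF i]\<close>)
    qed
    show "continuous2 (prod_topology UI UI) (rect (Dom C p)) (product_topology (\<lambda>i. space_at D (Cod C (f i))) I)
        (\<lambda>y r. \<lambda>i\<in>I. rect_face p (f i) (fst y) (snd y) r)"
    proof (rule continuous_map_into_product)
      fix i assume i: "i \<in> I"
      show "continuous2 (prod_topology UI UI) (rect (Dom C p)) (space_at D (Cod C (f i))) (\<lambda>y. rect_face p (f i) (fst y) (snd y))"
        by (rule continuous_map_rect_face[OF p a(1,4)[OF i]])
    qed
    show "continuous2 (prod_topology UI UI) (rect (Dom C p)) (product_topology (\<lambda>i. space_at D (Cod C (f i))) I)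
        (\<lambda>y r. \<lambda>i\<in>I. rect_face (q i) (g i) (fst y) (snd y) r)"
    proof (rule continuous_map_into_product)
      fix i assume i: "i \<in> I"
      show "continuous2 (prod_topology UI UI) (rect (Dom C p)) (space_at D (Cod C (f i))) (\<lambda>y. rect_face (q i) (g i) (fst y) (snd y))"
        using continuous_map_rect_face[OF a(2,3,5)[OF i]] by (simp add: a[OF i])
    qed
  qed (use p a rect_act_in rect_face_diagonal[OF sq] rect_face_filler_left[OF sq] rect_face_filler_right[OF sq]
       in \<open>auto simp: rect_edge_0 rect_edge_1 rect_face_left rect_face_end square_filler_0[OF sq] square_filler_1[OF sq]
         PiE_iff intro!: restrict_ext\<close>)
qed

end

section \<open>Active and inert maps\<close>

text \<open>Arrows of the simplex category written without their extensionality convention, which matters for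
  equality of arrows only.\<close>

definition dmap :: "nat \<Rightarrow> (nat \<Rightarrow> nat) \<Rightarrow> nat \<Rightarrow> darrow" where
  "dmap n f m = Arr n (\<lambda>i\<in>{..n}. f i) m"

lemma dmap_sel [simp]: "src (dmap n f m) = n" "tgt (dmap n f m) = m" "i \<le> n \<Longrightarrow> fn (dmap n f m) i = f i"
  by (auto simp: dmap_def)

lemma dmap_eqI: "(\<And>i. i \<le> n \<Longrightarrow> f i = g i) \<Longrightarrow> dmap n f m = dmap n g m"
  by (auto simp: dmap_def intro!: restrict_ext)

lemma delta_Ar_iff:
  "a \<in> Ar delta_cat \<longleftrightarrow> fn a \<in> extensional {..src a} \<and> (\<forall>i\<le>src a. fn a i \<le> tgt a) \<and>
     (\<forall>i j. i \<le> j \<and> j \<le> src a \<longrightarrow> fn a i \<le> fn a j)"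
  by (auto simp: delta_cat_def PiE_iff mono_on_def)

lemma dmap_in_Ar: "(\<And>i. i \<le> n \<Longrightarrow> f i \<le> m) \<Longrightarrow> (\<And>i j. i \<le> j \<Longrightarrow> j \<le> n \<Longrightarrow> f i \<le> f j) \<Longrightarrow> dmap n f m \<in> Ar delta_cat"
  unfolding delta_Ar_iff by (auto simp: dmap_def)

lemma dmap_fn: "a \<in> Ar delta_cat \<Longrightarrow> dmap (src a) (fn a) (tgt a) = a"
  by (cases a) (auto simp: dmap_def delta_Ar_iff fun_eq_iff extensional_def)

lemma delta_sel [simp]: "Ob delta_cat = UNIV" "Dom delta_cat = src" "Cod delta_cat = tgt" "Idt delta_cat n = dmap n (\<lambda>i. i) n"
  by (auto simp: delta_cat_def dmap_def)

lemma delta_Cmp: "Cmp delta_cat b a = dmap (src a) (\<lambda>i. fn b (fn a i)) (tgt b)"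
  by (simp add: delta_cat_def dmap_def compose_def)

lemma delta_Cmp_dmap:
  "(\<And>i. i \<le> n \<Longrightarrow> f i \<le> m) \<Longrightarrow> Cmp delta_cat (dmap m g l) (dmap n f m) = dmap n (\<lambda>i. g (f i)) l"
  unfolding delta_Cmp by (auto intro: dmap_eqI)

lemma delta_Cmp_in_Ar:
  "\<lbrakk>a \<in> Ar delta_cat; b \<in> Ar delta_cat; tgt a = src b\<rbrakk> \<Longrightarrow> Cmp delta_cat b a \<in> Ar delta_cat"
  unfolding delta_Cmp by (rule dmap_in_Ar) (auto simp: delta_Ar_iff)

lemma delta_Cmp_assoc:
  "\<lbrakk>a \<in> Ar delta_cat; tgt a = src b\<rbrakk> \<Longrightarrow> Cmp delta_cat c (Cmp delta_cat b a) = Cmp delta_cat (Cmp delta_cat c b) a"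
  unfolding delta_Cmp by (auto intro!: dmap_eqI simp: delta_Ar_iff)

lemma delta_Idt_in_Ar: "dmap n (\<lambda>i. i) n \<in> Ar delta_cat"
  by (rule dmap_in_Ar) auto

lemma delta_Cmp_Idt: "a \<in> Ar delta_cat \<Longrightarrow> src a = n \<Longrightarrow> Cmp delta_cat a (dmap n (\<lambda>i. i) n) = a"
  by (subst (2) dmap_fn[symmetric], assumption) (auto simp: delta_Cmp intro: dmap_eqI)

lemma delta_Idt_Cmp: "a \<in> Ar delta_cat \<Longrightarrow> tgt a = n \<Longrightarrow> Cmp delta_cat (dmap n (\<lambda>i. i) n) a = a"
  by (subst (2) dmap_fn[symmetric], assumption) (auto simp: delta_Cmp delta_Ar_iff intro: dmap_eqI)

lemma inert_shift: "inert g \<Longrightarrow> j \<le> src g \<Longrightarrow> fn g j = fn g 0 + j"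
  by (induction j) (auto simp: inert_def)

lemma inert_eq_dmap:
  assumes g: "inert g"
  shows "g = dmap (src g) (\<lambda>j. fn g 0 + j) (tgt g)"
proof -
  have "g = dmap (src g) (fn g) (tgt g)"
    by (rule dmap_fn[symmetric]) (use g in \<open>simp add: inert_def\<close>)
  also have "\<dots> = dmap (src g) (\<lambda>j. fn g 0 + j) (tgt g)"
    by (rule dmap_eqI) (rule inert_shift[OF g])
  finally show ?thesis .
qed

lemma inert_dmap: "p + n \<le> m \<Longrightarrow> inert (dmap n (\<lambda>j. p + j) m)"
  by (auto simp: inert_def intro!: dmap_in_Ar)

text \<open>In a factorisation through an inert map, the offset and the length of the inert map are read off from the
  values at the two end points, since the active part preserves end points.\<close>

lemma inert_part_eq:
  assumes a: "a \<in> Ar delta_cat"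
  shows "inert_part a = dmap (fn a (src a) - fn a 0) (\<lambda>j. fn a 0 + j) (tgt a)"
  unfolding inert_part_def
proof (rule the_equality)
  have a0: "fn a 0 \<le> fn a i" "fn a i \<le> fn a (src a)" "fn a i \<le> tgt a" if "i \<le> src a" for i
    using a that by (auto simp: delta_Ar_iff)
  let ?g = "dmap (fn a (src a) - fn a 0) (\<lambda>j. fn a 0 + j) (tgt a)"
  let ?b = "dmap (src a) (\<lambda>i. fn a i - fn a 0) (fn a (src a) - fn a 0)"
  have "?b \<in> Ar delta_cat"
    by (rule dmap_in_Ar) (use a a0 in \<open>auto simp: delta_Ar_iff intro!: diff_le_mono\<close>)
  then have b: "active ?b" by (simp add: active_def)
  have g: "inert ?g" by (rule inert_dmap) (use a0[of "src a"] in simp)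
  have "Cmp delta_cat ?g ?b = dmap (src a) (\<lambda>i. fn a 0 + (fn a i - fn a 0)) (tgt a)"
    by (rule delta_Cmp_dmap) (simp add: a0 diff_le_mono)
  also have "\<dots> = dmap (src a) (fn a) (tgt a)"
    by (rule dmap_eqI) (simp add: a0)
  also have "\<dots> = a" by (rule dmap_fn[OF a])
  finally show "inert ?g \<and> (\<exists>b. active b \<and> tgt b = src ?g \<and> Cmp delta_cat ?g b = a)"
    using b g by (intro conjI exI[of _ ?b]) auto
next
  fix g assume "inert g \<and> (\<exists>b. active b \<and> tgt b = src g \<and> Cmp delta_cat g b = a)"
  then obtain b where g: "inert g" and b: "active b" "tgt b = src g" and c: "Cmp delta_cat g b = a" by blast
  have s: "src a = src b" "tgt a = tgt g" using c by (auto simp: delta_Cmp)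
  have f: "fn a i = fn g (fn b i)" if "i \<le> src b" for i using c that by (auto simp: delta_Cmp)
  have "fn a 0 = fn g 0" "fn a (src a) = fn g (src g)"
    using f[of 0] f[of "src b"] b s by (auto simp: active_def)
  then show "g = dmap (fn a (src a) - fn a 0) (\<lambda>j. fn a 0 + j) (tgt a)"
    using inert_eq_dmap[OF g] inert_shift[OF g, of "src g"] s by simp
qed

lemma gam_eq:
  assumes a: "a \<in> Ar delta_cat" and i: "1 \<le> i" "i \<le> src a"
  shows "gam a i = dmap (fn a i - fn a (i - 1)) (\<lambda>j. fn a (i - 1) + j) (tgt a)"
proof -
  have rho: "rho (src a) i = dmap 1 (\<lambda>j. i - 1 + j) (src a)" by (simp add: rho_def dmap_def)
  have "rho (src a) i \<in> Ar delta_cat" unfolding rho by (rule dmap_in_Ar) (use i in auto)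
  then have "Cmp delta_cat a (rho (src a) i) \<in> Ar delta_cat"
    by (rule delta_Cmp_in_Ar[OF _ a]) (simp add: rho)
  from inert_part_eq[OF this] show ?thesis
    using i by (simp add: gam_def delta_Cmp rho)
qed

definition pushout_inert :: "nat \<Rightarrow> nat \<Rightarrow> nat \<Rightarrow> darrow" where
  "pushout_inert p n q = dmap n (\<lambda>j. p + j) (p + n + q)"

text \<open>The extension of an active map by identities on \<open>p\<close> edges before and \<open>q\<close> edges after its source.\<close>

definition pushout_active :: "nat \<Rightarrow> darrow \<Rightarrow> nat \<Rightarrow> darrow" where
  "pushout_active p a q = dmap (p + src a + q)
     (\<lambda>j. if j < p then j else if j \<le> p + src a then p + fn a (j - p) else j - src a + tgt a) (p + tgt a + q)"

text \<open>A map out of the pushout is pieced together from \<open>v\<close> on the outer edges and \<open>u\<close> on the middle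
  ones; they agree at the two break points because \<open>a\<close> preserves end points.\<close>

lemma pushout_square_canonical:
  assumes a: "active a"
  shows "pushout_square delta_cat a (pushout_inert p (src a) q) (pushout_inert p (tgt a) q) (pushout_active p a q)"
proof -
  let ?k = "src a" and ?n = "tgt a"
  let ?i = "pushout_inert p ?k q" and ?h = "pushout_inert p ?n q" and ?g = "pushout_active p a q"
  have aA: "a \<in> Ar delta_cat" and a0: "fn a 0 = 0" "fn a ?k = ?n"
    and am: "\<And>i j. i \<le> j \<Longrightarrow> j \<le> ?k \<Longrightarrow> fn a i \<le> fn a j" and al: "\<And>i. i \<le> ?k \<Longrightarrow> fn a i \<le> ?n"
    using a by (auto simp: active_def delta_Ar_iff)
  have iA: "?i \<in> Ar delta_cat" and hA: "?h \<in> Ar delta_cat"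
    unfolding pushout_inert_def by (rule dmap_in_Ar; simp)+
  have gA: "?g \<in> Ar delta_cat"
    unfolding pushout_active_def
  proof (rule dmap_in_Ar)
    fix i assume "i \<le> p + ?k + q"
    then show "(if i < p then i else if i \<le> p + ?k then p + fn a (i - p) else i - ?k + ?n) \<le> p + ?n + q"
      using al[of "i - p", THEN trans_le_add1, of q] by (auto simp: le_diff_conv)
  next
    fix i j assume ij: "i \<le> j" "j \<le> p + ?k + q"
    show "(if i < p then i else if i \<le> p + ?k then p + fn a (i - p) else i - ?k + ?n) \<le>
        (if j < p then j else if j \<le> p + ?k then p + fn a (j - p) else j - ?k + ?n)"
      using ij am[of "i - p" "j - p"] al[of "i - p"] by (auto simp: le_diff_conv)
  qed
  have comm: "Cmp delta_cat ?h a = Cmp delta_cat ?g ?i"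
    by (auto simp: delta_Cmp pushout_inert_def pushout_active_def al intro!: dmap_eqI)
  have ex: "\<exists>!w. arrow_in delta_cat w (p + ?n + q) e \<and> Cmp delta_cat w ?h = u \<and> Cmp delta_cat w ?g = v"
    if u: "u \<in> Ar delta_cat" "src u = ?n" "tgt u = e" and v: "v \<in> Ar delta_cat" "src v = p + ?k + q" "tgt v = e"
      and uv: "Cmp delta_cat u a = Cmp delta_cat v ?i" for e u v
  proof -
    have uvj: "fn u (fn a j) = fn v (p + j)" if "j \<le> ?k" for j
      using arg_cong[OF uv, of "\<lambda>x. fn x j"] that by (simp add: delta_Cmp pushout_inert_def)
    have um: "fn u i \<le> fn u j" if "i \<le> j" "j \<le> ?n" for i j using u that by (auto simp: delta_Ar_iff)
    have vm: "fn v i \<le> fn v j" if "i \<le> j" "j \<le> p + ?k + q" for i j using v that by (auto simp: delta_Ar_iff)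
    have vp: "fn v p = fn u 0" and vq: "fn v (p + ?k) = fn u ?n"
      using uvj[of 0] uvj[of ?k] a0 by auto
    define w where "w = dmap (p + ?n + q)
      (\<lambda>j. if j < p then fn v j else if j \<le> p + ?n then fn u (j - p) else fn v (j - ?n + ?k)) e"
    have wA: "w \<in> Ar delta_cat"
      unfolding w_def
    proof (rule dmap_in_Ar)
      fix i assume i: "i \<le> p + ?n + q"
      show "(if i < p then fn v i else if i \<le> p + ?n then fn u (i - p) else fn v (i - ?n + ?k)) \<le> e"
        using i u v by (auto simp: delta_Ar_iff)
    next
      fix i j assume ij: "i \<le> j" "j \<le> p + ?n + q"
      have 1: "fn v i \<le> fn u (j - p)" if "i < p" "j \<le> p + ?n"
        using vm[of i p] um[of 0 "j - p"] vp that by (auto simp: le_diff_conv)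
      have 2: "fn u (i - p) \<le> fn v (j - ?n + ?k)" if "i \<le> p + ?n" "p + ?n < j"
      proof -
        have "fn u (i - p) \<le> fn u ?n" by (rule um) (use that in auto)
        also have "\<dots> \<le> fn v (j - ?n + ?k)" unfolding vq[symmetric] by (rule vm) (use that ij in auto)
        finally show ?thesis .
      qed
      show "(if i < p then fn v i else if i \<le> p + ?n then fn u (i - p) else fn v (i - ?n + ?k)) \<le>
        (if j < p then fn v j else if j \<le> p + ?n then fn u (j - p) else fn v (j - ?n + ?k))"
      proof -
        have 3: "fn u (i - p) \<le> fn u (j - p)" if "j \<le> p + ?n" by (rule um) (use that ij in auto)
        have 4: "fn v i \<le> fn v j" if "j < p" by (rule vm) (use that ij in auto)
        have 5: "fn v i \<le> fn v (j - ?n + ?k)" if "i < p" "p + ?n < j" by (rule vm) (use that ij in auto)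
        have 6: "fn v (i - ?n + ?k) \<le> fn v (j - ?n + ?k)" if "p + ?n < i" by (rule vm) (use that ij in auto)
        show ?thesis using 1 2 3 4 5 6 ij by (auto simp: not_less not_le)
      qed
    qed
    have "Cmp delta_cat w ?h = dmap ?n (fn u) e"
      unfolding w_def pushout_inert_def by (subst delta_Cmp_dmap) (auto intro: dmap_eqI)
    then have wh: "Cmp delta_cat w ?h = u" using dmap_fn[OF u(1)] u by simp
    have "Cmp delta_cat w ?g = dmap (p + ?k + q) (fn v) e"
      unfolding delta_Cmp
    proof (simp add: w_def pushout_active_def, rule dmap_eqI)
      fix j assume j: "j \<le> p + ?k + q"
      show "fn (dmap (p + ?n + q) (\<lambda>j. if j < p then fn v j else if j \<le> p + ?n then fn u (j - p) else fn v (j - ?n + ?k)) e)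
           (fn (dmap (p + ?k + q) (\<lambda>j. if j < p then j else if j \<le> p + ?k then p + fn a (j - p) else j - ?k + ?n) (p + ?n + q)) j) = fn v j"
        using j al[of "j - p"] uvj[of "j - p"] by (auto simp: le_diff_conv)
    qed
    then have wg: "Cmp delta_cat w ?g = v" using dmap_fn[OF v(1)] v by simp
    show ?thesis
    proof (rule ex1I[of _ w])
      show "arrow_in delta_cat w (p + ?n + q) e \<and> Cmp delta_cat w ?h = u \<and> Cmp delta_cat w ?g = v"
        using wA wh wg by (simp add: arrow_in_def w_def)
      fix w' assume w': "arrow_in delta_cat w' (p + ?n + q) e \<and> Cmp delta_cat w' ?h = u \<and> Cmp delta_cat w' ?g = v"
      then have w'A: "w' \<in> Ar delta_cat" "src w' = p + ?n + q" "tgt w' = e" by (auto simp: arrow_in_def)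
      have h': "fn w' (p + j) = fn u j" if "j \<le> ?n" for j
        using w' that by (auto simp: delta_Cmp pushout_inert_def)
      have g': "fn w' (fn ?g j) = fn v j" if "j \<le> p + ?k + q" for j
        using w' that by (auto simp: delta_Cmp pushout_active_def)
      have "dmap (src w') (fn w') (tgt w') = w"
        unfolding w_def w'A
      proof (rule dmap_eqI)
        fix j assume j: "j \<le> p + ?n + q"
        show "fn w' j = (if j < p then fn v j else if j \<le> p + ?n then fn u (j - p) else fn v (j - ?n + ?k))"
        proof (cases "p + ?n < j")
          case True
          have x: "\<not> j - ?n + ?k < p" "\<not> j - ?n + ?k \<le> p + ?k" "j - ?n + ?k \<le> p + ?k + q" "j - ?n + ?k - ?k + ?n = j"
            using True j by auto
          have "fn ?g (j - ?n + ?k) = j"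
            unfolding pushout_active_def dmap_sel(3)[OF x(3)] using x by simp
          then show ?thesis using g'[OF x(3)] True by simp
        next
          case False
          then show ?thesis
            using j h'[of "j - p"] g'[of j] by (auto simp: pushout_active_def le_diff_conv)
        qed
      qed
      then show "w' = w" using dmap_fn[OF w'A(1)] by simp
    qed
  qed
  show ?thesis
    unfolding pushout_square_def
    using aA iA hA gA comm ex by (auto simp: arrow_in_def pushout_inert_def pushout_active_def)
qed

text \<open>A monotone map with a left inverse is strictly monotone.\<close>

lemma delta_retract_ge:
  assumes "w \<in> Ar delta_cat" "w' \<in> Ar delta_cat" "tgt w = src w'" "Cmp delta_cat w' w = dmap (src w) (\<lambda>i. i) (src w)"
    and "i \<le> src w"
  shows "i \<le> fn w i"
  using \<open>i \<le> src w\<close>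
proof (induction i)
  case (Suc i)
  have e: "fn w' (fn w j) = j" if "j \<le> src w" for j
    using arg_cong[OF assms(4), of "\<lambda>x. fn x j"] that by (simp add: delta_Cmp)
  have "fn w i \<le> fn w (Suc i)" using assms(1) Suc.prems by (auto simp: delta_Ar_iff)
  moreover have "fn w i \<noteq> fn w (Suc i)" using e[of i] e[of "Suc i"] Suc.prems by auto
  ultimately show ?case using Suc by simp
qed simp

text \<open>Pushouts agree up to isomorphism, and the only isomorphisms of the simplex category are identities.\<close>

lemma pushout_square_unique:
  assumes P: "pushout_square delta_cat a i h k" and Q: "pushout_square delta_cat a i h' k'"
  shows "h = h' \<and> k = k'"
proof -
  have uni: "\<exists>!w. arrow_in delta_cat w (tgt h) e \<and> Cmp delta_cat w h = u \<and> Cmp delta_cat w k = v"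
    if "pushout_square delta_cat a i h k" "arrow_in delta_cat u (tgt a) e" "arrow_in delta_cat v (tgt i) e"
      "Cmp delta_cat u a = Cmp delta_cat v i" for h k u v e
    using that unfolding pushout_square_def by simp
  have arr: "h \<in> Ar delta_cat" "k \<in> Ar delta_cat" "src h = tgt a" "src k = tgt i" "tgt k = tgt h"
      "Cmp delta_cat h a = Cmp delta_cat k i"
    if "pushout_square delta_cat a i h k" for h k
    using that unfolding pushout_square_def arrow_in_def by auto
  have ain: "arrow_in delta_cat h (tgt a) (tgt h)" "arrow_in delta_cat k (tgt i) (tgt h)"
    if "pushout_square delta_cat a i h k" for h k
    using arr[OF that] by (auto simp: arrow_in_def)
  obtain w where w: "arrow_in delta_cat w (tgt h) (tgt h')" "Cmp delta_cat w h = h'" "Cmp delta_cat w k = k'"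
    using uni[OF P ain[OF Q] arr(6)[OF Q]] by blast
  obtain w' where w': "arrow_in delta_cat w' (tgt h') (tgt h)" "Cmp delta_cat w' h' = h" "Cmp delta_cat w' k' = k"
    using uni[OF Q ain[OF P] arr(6)[OF P]] by blast
  have inv: "Cmp delta_cat w' w = dmap (tgt h) (\<lambda>i. i) (tgt h)"
    if P: "pushout_square delta_cat a i h k"
      and w: "arrow_in delta_cat w (tgt h) (tgt h')" "Cmp delta_cat w h = h'" "Cmp delta_cat w k = k'"
      and w': "arrow_in delta_cat w' (tgt h') (tgt h)" "Cmp delta_cat w' h' = h" "Cmp delta_cat w' k' = k"
    for h k h' k' w w'
  proof -
    have "arrow_in delta_cat (Cmp delta_cat w' w) (tgt h) (tgt h)"
      using w(1) w'(1) delta_Cmp_in_Ar[of w w'] by (auto simp: arrow_in_def delta_Cmp)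
    moreover have "Cmp delta_cat (Cmp delta_cat w' w) h = h" "Cmp delta_cat (Cmp delta_cat w' w) k = k"
      using w w' arr[OF P] delta_Cmp_assoc[of h w w'] delta_Cmp_assoc[of k w w'] by (auto simp: arrow_in_def)
    moreover have "arrow_in delta_cat (dmap (tgt h) (\<lambda>i. i) (tgt h)) (tgt h) (tgt h)"
      "Cmp delta_cat (dmap (tgt h) (\<lambda>i. i) (tgt h)) h = h" "Cmp delta_cat (dmap (tgt h) (\<lambda>i. i) (tgt h)) k = k"
      using arr[OF P] delta_Idt_in_Ar delta_Idt_Cmp by (auto simp: arrow_in_def)
    ultimately show ?thesis
      using uni[OF P ain[OF P] arr(6)[OF P]] by blast
  qed
  have i1: "Cmp delta_cat w' w = dmap (tgt h) (\<lambda>i. i) (tgt h)" by (rule inv[OF P w w'])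
  have i2: "Cmp delta_cat w w' = dmap (tgt h') (\<lambda>i. i) (tgt h')" by (rule inv[OF Q w' w])
  have wA: "w \<in> Ar delta_cat" "src w = tgt h" "tgt w = tgt h'" and wA': "w' \<in> Ar delta_cat" "src w' = tgt h'" "tgt w' = tgt h"
    using w w' by (auto simp: arrow_in_def)
  have ge: "i \<le> fn w i" if "i \<le> tgt h" for i
    by (rule delta_retract_ge[OF wA(1) wA'(1)]) (use wA wA' i1 that in auto)
  have ge': "i \<le> fn w' i" if "i \<le> tgt h'" for i
    by (rule delta_retract_ge[OF wA'(1) wA(1)]) (use wA wA' i2 that in auto)
  have le: "fn w i \<le> tgt h'" if "i \<le> tgt h" for i using wA that by (auto simp: delta_Ar_iff)
  have le': "fn w' i \<le> tgt h" if "i \<le> tgt h'" for i using wA' that by (auto simp: delta_Ar_iff)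
  have t: "tgt h = tgt h'" using ge[of "tgt h"] le[of "tgt h"] ge'[of "tgt h'"] le'[of "tgt h'"] by simp
  have "fn w i = i" if "i \<le> tgt h" for i
  proof -
    have "fn w' (fn w i) = i" using arg_cong[OF i1, of "\<lambda>x. fn x i"] that wA by (simp add: delta_Cmp)
    then show ?thesis using ge[OF that] ge'[OF le[OF that]] by simp
  qed
  then have "w = dmap (tgt h) (\<lambda>i. i) (tgt h)"
    using dmap_fn[OF wA(1)] wA t dmap_eqI[of "tgt h" "fn w" "\<lambda>i. i" "tgt h"] by simp
  then show ?thesis
    using w arr[OF P] delta_Idt_Cmp by auto
qed

lemma pushout_square_active_inert:
  assumes a: "active a" and i: "inert i" and P: "pushout_square delta_cat a i h k"
  obtains p q where "i = pushout_inert p (src a) q" "h = pushout_inert p (tgt a) q" "k = pushout_active p a q"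
proof -
  let ?p = "fn i 0" and ?q = "tgt i - (fn i 0 + src a)"
  have s: "src i = src a" using P by (simp add: pushout_square_def)
  have "fn i (src i) \<le> tgt i" using i by (auto simp: inert_def delta_Ar_iff)
  then have "?p + src a + ?q = tgt i" using inert_shift[OF i, of "src i"] s by simp
  then have e: "i = pushout_inert ?p (src a) ?q"
    using inert_eq_dmap[OF i] s by (simp add: pushout_inert_def)
  have "pushout_square delta_cat a i (pushout_inert ?p (tgt a) ?q) (pushout_active ?p a ?q)"
    using pushout_square_canonical[OF a, of ?p ?q] e by simp
  from pushout_square_unique[OF P this] that[OF e] show ?thesis by blast
qed

section \<open>Block decompositions\<close>

text \<open>The end points of the blocks of lengths \<open>p, n, q\<close>. If \<open>p = 0\<close> the first block is absent and
  the block of length \<open>n\<close> has number \<open>1\<close> instead of \<open>2\<close>; the values below the main block are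
  then just \<open>0\<close>. An absent last block (\<open>q = 0\<close>) is accounted for by \<open>block_count\<close>.\<close>

definition block_map :: "nat \<Rightarrow> nat \<Rightarrow> nat \<Rightarrow> nat \<Rightarrow> nat" where
  "block_map p n q i = (let j = (if p = 0 then 1 else 2) in if i < j then i * p else p + n + (i - j) * q)"

definition main_block :: "nat \<Rightarrow> nat" where
  "main_block p = (if p = 0 then 1 else 2)"

definition block_count :: "nat \<Rightarrow> nat \<Rightarrow> nat" where
  "block_count p q = main_block p + (if q = 0 then 0 else 1)"

definition blocks :: "nat \<Rightarrow> nat \<Rightarrow> nat \<Rightarrow> darrow" where
  "blocks p n q = dmap (block_count p q) (block_map p n q) (p + n + q)"

lemma main_block_in: "main_block p \<in> {1..block_count p q}"
  by (simp add: main_block_def block_count_def)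

lemma block_map_mono: "i \<le> j \<Longrightarrow> block_map p n q i \<le> block_map p n q j"
  by (auto simp: block_map_def Let_def mult_le_mono1 less_Suc_eq numeral_2_eq_2)

lemma block_map_top: "i \<le> block_count p q \<Longrightarrow> block_map p n q i \<le> p + n + q"
proof -
  have "block_map p n q (block_count p q) = p + n + q"
    by (auto simp: block_map_def block_count_def main_block_def)
  then show "i \<le> block_count p q \<Longrightarrow> block_map p n q i \<le> p + n + q"
    using block_map_mono[of i "block_count p q" p n q] by simp
qed

lemma blocks_in_Ar: "blocks p n q \<in> Ar delta_cat"
  unfolding blocks_def by (rule dmap_in_Ar) (auto intro: block_map_mono block_map_top)

lemma active_blocks: "active (blocks p n q)"
  using blocks_in_Ar[of p n q]
  by (auto simp: active_def blocks_def block_map_def block_count_def main_block_def)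

lemma inj_on_blocks: "n \<noteq> 0 \<Longrightarrow> inj_on (fn (blocks p n q)) {..src (blocks p n q)}"
proof -
  assume n: "n \<noteq> 0"
  have "block_map p n q i < block_map p n q (Suc i)" if "Suc i \<le> block_count p q" for i
    using that n by (auto simp: block_map_def Let_def block_count_def main_block_def less_Suc_eq numeral_2_eq_2 split: if_splits)
  then have "block_map p n q i < block_map p n q j" if "i < j" "j \<le> block_count p q" for i j
    using that
  proof (induction j)
    case (Suc j)
    then show ?case by (cases "i = j") (auto simp: less_Suc_eq intro: less_trans)
  qed simp
  then have "strict_mono_on {..block_count p q} (block_map p n q)"
    by (auto simp: strict_mono_on_def)
  then have "inj_on (block_map p n q) {..block_count p q}"
    by (rule strict_mono_on_imp_inj_on)
  then show ?thesis
    by (simp add: blocks_def inj_on_def)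
qed

lemma gam_blocks:
  assumes "i \<in> {1..block_count p q}"
  shows "gam (blocks p n q) i = dmap (if i = main_block p then n else if i < main_block p then p else q)
    (\<lambda>j. (if i < main_block p then 0 else if i = main_block p then p else p + n) + j) (p + n + q)"
proof -
  have "gam (blocks p n q) i = dmap (block_map p n q i - block_map p n q (i - 1)) (\<lambda>j. block_map p n q (i - 1) + j) (p + n + q)"
    using gam_eq[OF blocks_in_Ar, of i p n q] assms by (simp add: blocks_def)
  moreover have "block_map p n q (i - 1) = (if i < main_block p then 0 else if i = main_block p then p else p + n)"
      "block_map p n q i - block_map p n q (i - 1) = (if i = main_block p then n else if i < main_block p then p else q)"
    using assms by (auto simp: block_map_def block_count_def main_block_def split: if_splits)
  ultimately show ?thesis by simp
qed

text \<open>The pushout of \<open>a\<close> cut into blocks: \<open>a\<close> on the main block and identities on the others.\<close>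

definition block_arrow :: "nat \<Rightarrow> darrow \<Rightarrow> nat \<Rightarrow> nat \<Rightarrow> darrow" where
  "block_arrow p a q i = (if i = main_block p then a else if i < main_block p then dmap p (\<lambda>j. j) p else dmap q (\<lambda>j. j) q)"

lemma gam_blocks_main: "gam (blocks p n q) (main_block p) = pushout_inert p n q"
  by (simp add: gam_blocks[OF main_block_in] pushout_inert_def)

lemma pushout_active_gam_blocks:
  assumes a: "active a" and i: "i \<in> {1..block_count p q}"
  shows "Cmp delta_cat (pushout_active p a q) (gam (blocks p (src a) q) i) =
    Cmp delta_cat (gam (blocks p (tgt a) q) i) (block_arrow p a q i)"
proof -
  have a0: "fn a 0 = 0" "fn a (src a) = tgt a" "\<And>i. i \<le> src a \<Longrightarrow> fn a i \<le> tgt a"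
    using a by (auto simp: active_def delta_Ar_iff)
  have pq: "i < main_block p \<Longrightarrow> p \<noteq> 0" "i > main_block p \<Longrightarrow> q \<noteq> 0"
    using i by (auto simp: main_block_def block_count_def split: if_splits)
  consider "i < main_block p" "p \<noteq> 0" | "i = main_block p" | "i > main_block p" "q \<noteq> 0"
    using pq by (cases i "main_block p" rule: linorder_cases) auto
  then show ?thesis
  proof cases
    case 1
    then show ?thesis
      by (auto simp: gam_blocks[OF i] block_arrow_def delta_Cmp pushout_active_def a0 intro!: dmap_eqI)
  next
    case 2
    show ?thesis
      unfolding 2 gam_blocks_main
      by (auto simp: pushout_inert_def block_arrow_def delta_Cmp pushout_active_def a0 intro!: dmap_eqI)
  next
    case 3
    then show ?thesis
      by (auto simp: gam_blocks[OF i] block_arrow_def delta_Cmp pushout_active_def a0 intro!: dmap_eqI)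
  qed
qed

section \<open>Simplicial maps\<close>

abbreviation smap_cat :: "(nat \<times> bool, darrow \<times> (bool \<times> bool)) cat" where
  "smap_cat \<equiv> prod_cat (opp_cat delta_cat) walking_arrow"

lemma smap_cat_sel [simp]:
  "Ob smap_cat = UNIV" "(a, e, e') \<in> Ar smap_cat \<longleftrightarrow> a \<in> Ar delta_cat \<and> (e \<le> e')"
  "Dom smap_cat (a, e, e') = (tgt a, e)" "Cod smap_cat (a, e, e') = (src a, e')"
  "Idt smap_cat (n, e) = (dmap n (\<lambda>i. i) n, e, e)"
  "Cmp smap_cat (b, d, d') (a, e, e') = (Cmp delta_cat a b, e, d')"
  by (auto simp: prod_cat_def opp_cat_def walking_arrow_def simp del: delta_sel(1)) (auto simp: delta_sel)

lemma delta_Cmp_src_tgt: "src (Cmp delta_cat b a) = src a" "tgt (Cmp delta_cat b a) = tgt b"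
  by (simp_all add: delta_Cmp)

text \<open>A simplicial map is rectified as a whole, so that the rectified component maps are strictly natural
  with respect to the rectifications of its two ends.\<close>

lemma coherent_diagram_smap:
  assumes "hc_functor smap_cat F"
  shows "coherent_diagram smap_cat F"
  by unfold_locales (use assms delta_Cmp_in_Ar in \<open>auto simp: delta_Idt_in_Ar delta_Cmp_src_tgt\<close>)

locale coherent_smap =
  fixes F :: "'a smap"
  assumes smap: "hc_functor smap_cat F"

sublocale coherent_smap \<subseteq> coherent_diagram smap_cat F
  by (rule coherent_diagram_smap[OF smap])

context coherent_smap
begin

text \<open>The rectified spaces of simplices: \<open>e = False\<close> is the source of the simplicial map and
  \<open>e = True\<close> its target.\<close>

abbreviation level :: "nat \<Rightarrow> bool \<Rightarrow> _ topology" where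
  "level n e \<equiv> rect (n, e)"

abbreviation pull :: "bool \<Rightarrow> darrow \<Rightarrow> _" where
  "pull e a \<equiv> rect_act (a, e, e)"

text \<open>The rectified components of the simplicial map.\<close>

abbreviation cross :: "nat \<Rightarrow> _" where
  "cross n \<equiv> rect_act (dmap n (\<lambda>i. i) n, False, True)"

lemma continuous_map_pull: "a \<in> Ar delta_cat \<Longrightarrow> continuous_map (level (tgt a) e) (level (src a) e) (pull e a)"
  using continuous_map_rect_act[of "(a, e, e)"] by simp

lemma pull_comp:
  "\<lbrakk>a \<in> Ar delta_cat; b \<in> Ar delta_cat; tgt a = src b; r \<in> topspace (level (tgt b) e)\<rbrakk> \<Longrightarrow>
    pull e a (pull e b r) = pull e (Cmp delta_cat b a) r"
  using rect_act_comp[of "(b, e, e)" "(a, e, e)" r] by simp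

lemma pull_Idt: "r \<in> topspace (level n e) \<Longrightarrow> pull e (dmap n (\<lambda>i. i) n) r = r"
  using rect_act_Idt[of "(n, e)" r] by simp

lemma pull_square:
  "\<lbrakk>Cmp delta_cat b a = Cmp delta_cat d c; a \<in> Ar delta_cat; b \<in> Ar delta_cat; c \<in> Ar delta_cat; d \<in> Ar delta_cat;
    tgt a = src b; tgt c = src d; r \<in> topspace (level (tgt b) e); tgt b = tgt d\<rbrakk> \<Longrightarrow>
    pull e a (pull e b r) = pull e c (pull e d r)"
  by (simp add: pull_comp)

text \<open>Both sides are the action of the diagonal arrow of the naturality square.\<close>

lemma cross_pull:
  "a \<in> Ar delta_cat \<Longrightarrow> r \<in> topspace (level (tgt a) False) \<Longrightarrow>
    cross (src a) (pull False a r) = pull True a (cross (tgt a) r)"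
  using rect_act_comp[of "(a, False, False)" "(dmap (src a) (\<lambda>i. i) (src a), False, True)" r]
    rect_act_comp[of "(dmap (tgt a) (\<lambda>i. i) (tgt a), False, True)" "(a, True, True)" r]
  by (simp add: delta_Idt_in_Ar delta_Cmp_Idt delta_Idt_Cmp)

lemma restricts_to_coh:
  assumes "restricts_to F e X" "path_from (opp_cat delta_cat) n fs" "fs \<noteq> []"
    "t \<in> topspace (cube (length fs - 1))" "x \<in> topspace (space_at X n)"
  shows "coh F (map (\<lambda>f. (f, e, e)) fs) t x = coh X fs t x"
  using assms path_from_comp_string[OF assms(2,3)] path_from_hd[OF assms(2,3)]
  unfolding restricts_to_def by (simp add: opp_cat_def)

lemma restricts_to_act:
  assumes "restricts_to F e X" "a \<in> Ar delta_cat" "x \<in> topspace (space_at X (tgt a))"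
  shows "act F (a, e, e) x = act X a x"
  using restricts_to_coh[OF assms(1), of "tgt a" "[a]" "\<lambda>j\<in>{..<0}. 0" x] assms
  by (simp add: act_def cube_0 opp_cat_def restrict_empty)

lemma restricts_to_act2:
  assumes "restricts_to F e X" "a \<in> Ar delta_cat" "b \<in> Ar delta_cat" "tgt a = src b"
    "x \<in> topspace (space_at X (tgt b))" "0 \<le> s" "s \<le> 1"
  shows "act2 F (b, e, e) (a, e, e) s x = act2 X b a s x"
  using restricts_to_coh[OF assms(1), of "tgt b" "[b, a]" "\<lambda>j\<in>{..<1}. s" x] assms edge_in[of s]
  by (simp add: act2_def opp_cat_def)

lemma restricts_to_space: "restricts_to F e X \<Longrightarrow> space_at F (n, e) = space_at X n"
  by (simp add: restricts_to_def)

lemma sends_to_pullback_iff_level: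
  assumes res: "restricts_to F e X"
    and A: "h \<in> Ar delta_cat" "a \<in> Ar delta_cat" "k \<in> Ar delta_cat" "i \<in> Ar delta_cat"
      "tgt a = src h" "tgt i = src k" "tgt h = tgt k" "src a = src i" "Cmp delta_cat h a = Cmp delta_cat k i"
  shows "sends_to_pullback (opp_cat delta_cat) X h a k i \<longleftrightarrow>
    strict_hpb (level (tgt h) e) (level (src h) e) (level (src k) e) (level (src a) e)
      (pull e h) (pull e k) (pull e a) (pull e i)"
proof -
  have sq: "arrow_square (h, e, e) (a, e, e) (k, e, e) (i, e, e)"
    unfolding arrow_square_def using A by simp
  have fill: "square_filler F (h, e, e) (a, e, e) (k, e, e) (i, e, e) s x = square_filler X h a k i s x"
    if "0 \<le> s" "s \<le> 1" "x \<in> topspace (space_at X (tgt h))" for s x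
    using that A restricts_to_act2[OF res A(2,1,5)] restricts_to_act2[OF res A(4,3,6)]
    by (simp add: square_filler_def)
  note act = restricts_to_act[OF res A(1)] restricts_to_act[OF res A(3)] restricts_to_act[OF res A(2)] restricts_to_act[OF res A(4)]
  let ?X = "homotopy_pullback (space_at X (tgt h)) (space_at X (src h)) (space_at X (src k)) (space_at X (src a))"
  have "sends_to_pullback smap_cat F (h, e, e) (a, e, e) (k, e, e) (i, e, e) \<longleftrightarrow>
    ?X (act F (h, e, e)) (act F (k, e, e)) (act F (a, e, e)) (act F (i, e, e))
      (square_filler F (h, e, e) (a, e, e) (k, e, e) (i, e, e))"
    by (simp add: sends_to_pullback_def restricts_to_space[OF res])
  also have "\<dots> \<longleftrightarrow> ?X (act X h) (act X k) (act X a) (act X i) (square_filler X h a k i)"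
    by (rule iffI; erule homotopy_pullback_cong[rotated 5])
       (use act fill A in \<open>simp_all add: eq_commute[of "act X _ _"]\<close>)
  also have "\<dots> \<longleftrightarrow> sends_to_pullback (opp_cat delta_cat) X h a k i"
    by (simp add: sends_to_pullback_def opp_cat_def)
  finally show ?thesis
    using sends_to_pullback_iff_rect[OF sq] by simp
qed

lemma semi_ikeo_strict:
  assumes ikeo: "semi_ikeo Y X F" and Y: "restricts_to F False Y" and X: "restricts_to F True X"
    and b: "active b" "inj_on (fn b) {..src b}" "src b \<noteq> 0" "tgt b \<noteq> 0"
  shows "strict_hpb (level (tgt b) False) (level (tgt b) True)
     (product_topology (\<lambda>i. level (src (gam b i)) False) {1..src b})
     (product_topology (\<lambda>i. level (src (gam b i)) True) {1..src b})
     (cross (tgt b)) (\<lambda>y. \<lambda>i\<in>{1..src b}. pull False (gam b i) y)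
     (\<lambda>x. \<lambda>i\<in>{1..src b}. pull True (gam b i) x) (\<lambda>y. \<lambda>i\<in>{1..src b}. cross (src (gam b i)) (y i))"
proof -
  let ?I = "{1..src b}"
  have bA: "b \<in> Ar delta_cat" using b by (simp add: active_def)
  have gA: "gam b i \<in> Ar delta_cat" "tgt (gam b i) = tgt b" if "i \<in> ?I" for i
  proof -
    have "fn b (i - 1) \<le> fn b i" "fn b i \<le> tgt b" using bA that by (auto simp: delta_Ar_iff)
    then show "gam b i \<in> Ar delta_cat" "tgt (gam b i) = tgt b"
      using that gam_eq[OF bA, of i] by (auto intro!: dmap_in_Ar)
  qed
  let ?id = "\<lambda>n. (dmap n (\<lambda>i. i) n, False, True)"
  have sq: "arrow_square (?id (tgt b)) (gam b i, True, True) (gam b i, False, False) (?id (src (gam b i)))"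
    if "i \<in> ?I" for i
    unfolding arrow_square_def using gA[OF that] by (simp add: delta_Idt_in_Ar delta_Cmp_Idt delta_Idt_Cmp)
  let ?P = "homotopy_pullback (space_at Y (tgt b)) (space_at X (tgt b))
          (product_topology (\<lambda>i. space_at Y (src (gam b i))) ?I)
          (product_topology (\<lambda>i. space_at X (src (gam b i))) ?I)
          (component F (tgt b))"
  have "?P (\<lambda>y. \<lambda>i\<in>?I. act Y (gam b i) y) (\<lambda>x. \<lambda>i\<in>?I. act X (gam b i) x)
          (\<lambda>y. \<lambda>i\<in>?I. component F (src (gam b i)) (y i)) (\<lambda>s y. \<lambda>i\<in>?I. smap_filler F (gam b i) s y)"
    using ikeo b unfolding semi_ikeo_def by blast
  then have "?P (\<lambda>y. \<lambda>i\<in>?I. act F (gam b i, False, False) y) (\<lambda>x. \<lambda>i\<in>?I. act F (gam b i, True, True) x)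
          (\<lambda>y. \<lambda>i\<in>?I. component F (src (gam b i)) (y i)) (\<lambda>s y. \<lambda>i\<in>?I. smap_filler F (gam b i) s y)"
    by (rule homotopy_pullback_cong[rotated 5])
       (auto simp: restricts_to_act[OF Y] restricts_to_act[OF X] gA intro!: restrict_ext)
  moreover have "component F n = act F (?id n)" for n by (simp add: component_def)
  moreover have "(\<lambda>s y. \<lambda>i\<in>?I. smap_filler F (gam b i) s y) =
      (\<lambda>s y. \<lambda>i\<in>?I. square_filler F (?id (tgt b)) (gam b i, True, True) (gam b i, False, False) (?id (src (gam b i))) s y)"
    by (auto simp: smap_filler_def gA fun_eq_iff)
  ultimately show ?thesis
    using product_homotopy_pullback_iff_rect[where I = ?I and p = "?id (tgt b)" and f = "\<lambda>i. (gam b i, True, True)"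
        and q = "\<lambda>i. (gam b i, False, False)" and g = "\<lambda>i. ?id (src (gam b i))", OF sq]
    by (simp add: delta_Idt_in_Ar restricts_to_space[OF Y] restricts_to_space[OF X])
qed
end

section \<open>The decomposition property\<close>

context coherent_smap
begin

text \<open>Write \<open>\<gamma>\<close> and \<open>\<delta>\<close> for the block inclusions of \<open>[m]\<close> and \<open>[M]\<close>, and consider the rectangle
  from \<open>Y\<^sub>M\<close> to the product of the \<open>X\<close>-spaces of the blocks of \<open>[m]\<close>. It factors through
  \<open>X\<^sub>M\<close> and the blocks of \<open>[M]\<close> in \<open>X\<close> as the semi-ikeo square for \<open>[M]\<close> followed by
  the square of \<open>X\<close>, so it is a homotopy pullback. It also factors through \<open>Y\<^sub>m\<close> and the
  blocks of \<open>[m]\<close> in \<open>Y\<close> as the square of \<open>Y\<close> followed by the semi-ikeo square for \<open>[m]\<close>, so the square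
  of \<open>Y\<close> is a homotopy pullback by cancellation.\<close>

lemma strict_hpb_from_blocks:
  assumes a: "active a" and n: "tgt a \<noteq> 0"
    and blocks_strict: "\<And>n. n \<noteq> 0 \<Longrightarrow> strict_hpb (level (p + n + q) False) (level (p + n + q) True)
      (product_topology (\<lambda>i. level (src (gam (blocks p n q) i)) False) {1..block_count p q})
      (product_topology (\<lambda>i. level (src (gam (blocks p n q) i)) True) {1..block_count p q})
      (cross (p + n + q)) (\<lambda>y. \<lambda>i\<in>{1..block_count p q}. pull False (gam (blocks p n q) i) y)
      (\<lambda>x. \<lambda>i\<in>{1..block_count p q}. pull True (gam (blocks p n q) i) x)
      (\<lambda>y. \<lambda>i\<in>{1..block_count p q}. cross (src (gam (blocks p n q) i)) (y i))"
    and X: "strict_hpb (level (p + tgt a + q) True) (level (tgt a) True) (level (p + src a + q) True) (level (src a) True)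
      (pull True (pushout_inert p (tgt a) q)) (pull True (pushout_active p a q))
      (pull True a) (pull True (pushout_inert p (src a) q))"
  shows "strict_hpb (level (p + tgt a + q) False) (level (tgt a) False) (level (p + src a + q) False) (level (src a) False)
      (pull False (pushout_inert p (tgt a) q)) (pull False (pushout_active p a q))
      (pull False a) (pull False (pushout_inert p (src a) q))"
proof -
  let ?n = "tgt a" and ?k = "src a" and ?I = "{1..block_count p q}" and ?j = "main_block p"
  let ?M = "p + ?n + q" and ?m = "p + ?k + q"
  let ?h = "pushout_inert p ?n q" and ?i = "pushout_inert p ?k q" and ?g = "pushout_active p a q"
  let ?\<gamma> = "gam (blocks p ?k q)" and ?\<delta> = "gam (blocks p ?n q)" and ?\<alpha> = "block_arrow p a q"
  let ?prod = "\<lambda>\<gamma> e. product_topology (\<lambda>i. level (src (\<gamma> i)) e) ?I"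
  have k: "?k \<noteq> 0" using a n unfolding active_def by metis
  have aA: "a \<in> Ar delta_cat" using a by (simp add: active_def)
  have P: "pushout_square delta_cat a ?i ?h ?g" by (rule pushout_square_canonical[OF a])
  have gA: "?g \<in> Ar delta_cat" and hA: "?h \<in> Ar delta_cat" and iA: "?i \<in> Ar delta_cat"
    using P by (auto simp: pushout_square_def arrow_in_def)
  have st: "src ?g = ?m" "tgt ?g = ?M" "src ?h = ?n" "tgt ?h = ?M" "src ?i = ?k" "tgt ?i = ?m"
    by (simp_all add: pushout_active_def pushout_inert_def)
  have gam: "gam (blocks p n q) i \<in> Ar delta_cat" "tgt (gam (blocks p n q) i) = p + n + q" if "i \<in> ?I" for n i
    using gam_blocks[OF that, of n] that by (auto intro!: dmap_in_Ar simp: block_count_def main_block_def split: if_splits)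
  have \<alpha>: "?\<alpha> i \<in> Ar delta_cat" "src (?\<alpha> i) = src (?\<gamma> i)" "tgt (?\<alpha> i) = src (?\<delta> i)" if "i \<in> ?I" for i
    using gam_blocks[OF that] aA by (auto simp: block_arrow_def delta_Idt_in_Ar)
  have \<alpha>id: "?\<alpha> i = dmap (src (?\<gamma> i)) (\<lambda>j. j) (src (?\<gamma> i))" "src (?\<delta> i) = src (?\<gamma> i)" if "i \<in> ?I" "i \<noteq> ?j" for i
    using gam_blocks[OF that(1)] that(2) by (auto simp: block_arrow_def)
  have \<alpha>j: "?\<alpha> ?j = a" "?\<gamma> ?j = ?i" "?\<delta> ?j = ?h"
    by (simp_all add: block_arrow_def gam_blocks_main)
  \<comment> \<open>Every square of blocks commutes, by the description of the pushout map on blocks.\<close>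
  have comm: "pull e (?\<gamma> i) (pull e ?g r) = pull e (?\<alpha> i) (pull e (?\<delta> i) r)"
    if "i \<in> ?I" "r \<in> topspace (level ?M e)" for e i r
    by (rule pull_square[OF pushout_active_gam_blocks[OF a that(1)]])
       (use that gam[OF that(1)] \<alpha>[OF that(1)] gA st in auto)
  have cont: "continuous_map (level (tgt b) e) (level (src b) e) (pull e b)" if "b \<in> Ar delta_cat" for b e
    by (rule continuous_map_pull[OF that])
  have cprod: "continuous_map (level (p + n + q) e) (?prod (gam (blocks p n q)) e) (\<lambda>y. \<lambda>i\<in>?I. pull e (gam (blocks p n q) i) y)" for n e
  proof (rule continuous_map_into_product)
    fix i assume i: "i \<in> ?I"
    show "continuous_map (level (p + n + q) e) (level (src (gam (blocks p n q) i)) e) (pull e (gam (blocks p n q) i))"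
      using cont[OF gam(1)[OF i]] by (simp add: gam(2)[OF i])
  qed
  have c\<alpha>: "continuous_map (?prod ?\<delta> e) (?prod ?\<gamma> e) (\<lambda>y. \<lambda>i\<in>?I. pull e (?\<alpha> i) (y i))" for e
  proof (rule continuous_map_into_product)
    fix i assume i: "i \<in> ?I"
    show "continuous_map (?prod ?\<delta> e) (level (src (?\<gamma> i)) e) (\<lambda>y. pull e (?\<alpha> i) (y i))"
    proof (rule continuous_map_compose'[where g = "pull e (?\<alpha> i)"])
      show "continuous_map (level (src (?\<delta> i)) e) (level (src (?\<gamma> i)) e) (pull e (?\<alpha> i))"
        using cont[OF \<alpha>(1)[OF i], of e] by (simp only: \<alpha>[OF i])
      show "continuous_map (?prod ?\<delta> e) (level (src (?\<delta> i)) e) (\<lambda>y. y i)"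
        by (rule continuous_map_product_projection[OF i])
    qed
  qed
  have cg: "continuous_map (level ?M e) (level ?m e) (pull e ?g)" for e
    using cont[OF gA, of e] by (simp only: st)
  have comm_sq: "commuting_square (level ?M e) (level ?m e) (?prod ?\<delta> e) (?prod ?\<gamma> e)
      (pull e ?g) (\<lambda>y. \<lambda>i\<in>?I. pull e (?\<delta> i) y) (\<lambda>y. \<lambda>i\<in>?I. pull e (?\<gamma> i) y) (\<lambda>y. \<lambda>i\<in>?I. pull e (?\<alpha> i) (y i))" for e
    unfolding commuting_square_def
    using cg cprod[of ?n] cprod[of ?k] c\<alpha> comm by (auto intro!: restrict_ext)
  have factor: "strict_hpb (level ?M e) (level ?m e) (?prod ?\<delta> e) (?prod ?\<gamma> e)
      (pull e ?g) (\<lambda>y. \<lambda>i\<in>?I. pull e (?\<delta> i) y) (\<lambda>y. \<lambda>i\<in>?I. pull e (?\<gamma> i) y) (\<lambda>y. \<lambda>i\<in>?I. pull e (?\<alpha> i) (y i)) \<longleftrightarrow>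
    strict_hpb (level ?M e) (level ?m e) (level ?n e) (level ?k e) (pull e ?g) (pull e ?h) (pull e ?i) (pull e a)" for e
  proof -
    have "continuous_map (level (src (?\<delta> ?j)) e) (level (src (?\<gamma> ?j)) e) (pull e (?\<alpha> ?j))"
      using cont[OF aA, of e] by (simp only: \<alpha>j st)
    from strict_hpb_product_iff_factor[where j = ?j and I = ?I and g = "\<lambda>i. pull e (?\<alpha> i)",
        OF main_block_in _ _ comm_sq this]
    show ?thesis
      using main_block_in[of p q] by (simp add: \<alpha>j \<alpha>id pull_Idt st)
  qed
  have X': "strict_hpb (level ?M True) (level ?m True) (?prod ?\<delta> True) (?prod ?\<gamma> True)
      (pull True ?g) (\<lambda>y. \<lambda>i\<in>?I. pull True (?\<delta> i) y) (\<lambda>y. \<lambda>i\<in>?I. pull True (?\<gamma> i) y) (\<lambda>y. \<lambda>i\<in>?I. pull True (?\<alpha> i) (y i))"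
    unfolding factor by (rule strict_hpb_flip[OF X])
  note SM = blocks_strict[OF n] and Sm = blocks_strict[OF k]
  have "strict_hpb (level ?M False) (level ?m True) (?prod ?\<delta> False) (?prod ?\<gamma> True)
      (pull True ?g \<circ> cross ?M) (\<lambda>y. \<lambda>i\<in>?I. pull False (?\<delta> i) y) (\<lambda>x. \<lambda>i\<in>?I. pull True (?\<gamma> i) x)
      ((\<lambda>y. \<lambda>i\<in>?I. pull True (?\<alpha> i) (y i)) \<circ> (\<lambda>y. \<lambda>i\<in>?I. cross (src (?\<delta> i)) (y i)))"
    by (rule strict_hpb_paste[OF X' SM[unfolded strict_hpb_iff, THEN conjunct1], THEN iffD1, OF SM])
  then have "strict_hpb (level ?M False) (level ?m True) (?prod ?\<delta> False) (?prod ?\<gamma> True)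
      (cross ?m \<circ> pull False ?g) (\<lambda>y. \<lambda>i\<in>?I. pull False (?\<delta> i) y) (\<lambda>x. \<lambda>i\<in>?I. pull True (?\<gamma> i) x)
      ((\<lambda>y. \<lambda>i\<in>?I. cross (src (?\<gamma> i)) (y i)) \<circ> (\<lambda>y. \<lambda>i\<in>?I. pull False (?\<alpha> i) (y i)))"
  proof (rule strict_hpb_cong[rotated 4])
    fix r assume "r \<in> topspace (level ?M False)"
    then show "(pull True ?g \<circ> cross ?M) r = (cross ?m \<circ> pull False ?g) r"
      using cross_pull[OF gA, of r] by (simp add: st)
  next
    fix y assume "y \<in> topspace (?prod ?\<delta> False)"
    then have y: "y i \<in> topspace (level (tgt (?\<alpha> i)) False)" if "i \<in> ?I" for i
      using that by (auto simp: \<alpha> PiE_iff)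
    have "pull True (?\<alpha> i) (cross (src (?\<delta> i)) (y i)) = cross (src (?\<gamma> i)) (pull False (?\<alpha> i) (y i))" if "i \<in> ?I" for i
      using cross_pull[OF \<alpha>(1)[OF that] y[OF that]] unfolding \<alpha>(2,3)[OF that] by (rule sym)
    then show "((\<lambda>y. \<lambda>i\<in>?I. pull True (?\<alpha> i) (y i)) \<circ> (\<lambda>y. \<lambda>i\<in>?I. cross (src (?\<delta> i)) (y i))) y =
        ((\<lambda>y. \<lambda>i\<in>?I. cross (src (?\<gamma> i)) (y i)) \<circ> (\<lambda>y. \<lambda>i\<in>?I. pull False (?\<alpha> i) (y i))) y"
      by (auto intro!: restrict_ext)
  qed simp_all
  then have "strict_hpb (level ?M False) (level ?m False) (?prod ?\<delta> False) (?prod ?\<gamma> False)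
      (pull False ?g) (\<lambda>y. \<lambda>i\<in>?I. pull False (?\<delta> i) y) (\<lambda>y. \<lambda>i\<in>?I. pull False (?\<gamma> i) y) (\<lambda>y. \<lambda>i\<in>?I. pull False (?\<alpha> i) (y i))"
    by (rule strict_hpb_paste[OF Sm comm_sq, THEN iffD2])
  then show ?thesis
    unfolding factor by (rule strict_hpb_flip)
qed

text \<open>The square of \<open>a : [k] \<rightarrow> [0]\<close> is a retract of the one of \<open>a' : [k + 1] \<rightarrow> [1]\<close>. The section inserts a vertex
  behind the image of \<open>[k]\<close>, or behind the point to which that image is collapsed, and the retraction
  removes it again. Reversing arrows exchanges the roles: the retractions \<open>r\<close> of the simplex category
  induce the inclusions of spaces.\<close>

lemma strict_hpb_degenerate:
  assumes a: "active a" and n: "tgt a = 0"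
    and S: "strict_hpb (level (p + 1 + q) e) (level 1 e) (level (p + Suc (src a) + q) e) (level (Suc (src a)) e)
      (pull e (pushout_inert p 1 q)) (pull e (pushout_active p (dmap (Suc (src a)) (\<lambda>j. if j \<le> src a then 0 else 1) 1) q))
      (pull e (dmap (Suc (src a)) (\<lambda>j. if j \<le> src a then 0 else 1) 1)) (pull e (pushout_inert p (Suc (src a)) q))"
  shows "strict_hpb (level (p + tgt a + q) e) (level (tgt a) e) (level (p + src a + q) e) (level (src a) e)
      (pull e (pushout_inert p (tgt a) q)) (pull e (pushout_active p a q)) (pull e a) (pull e (pushout_inert p (src a) q))"
proof -
  let ?k = "src a"
  define a' where "a' = dmap (Suc ?k) (\<lambda>j. if j \<le> ?k then 0 else (1::nat)) 1"
  have a': "active a'" "src a' = Suc ?k" "tgt a' = 1"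
    by (auto simp: a'_def active_def intro!: dmap_in_Ar)
  have aA: "a \<in> Ar delta_cat" and a0: "fn a j = 0" if "j \<le> ?k" for j
    using a n that by (auto simp: active_def delta_Ar_iff)
  have a'0: "fn a' j = (if j \<le> ?k then 0 else 1)" if "j \<le> Suc ?k" for j
    using that by (simp add: a'_def)
  let ?h = "pushout_inert p 0 q" and ?g = "pushout_active p a q" and ?i = "pushout_inert p ?k q"
  let ?h' = "pushout_inert p 1 q" and ?g' = "pushout_active p a' q" and ?i' = "pushout_inert p (Suc ?k) q"
  have P: "pushout_square delta_cat a ?i ?h ?g"
    using pushout_square_canonical[OF a] by (simp add: n)
  have P': "pushout_square delta_cat a' ?i' ?h' ?g'"
    using pushout_square_canonical[OF a'(1)] by (simp add: a')
  have A: "a \<in> Ar delta_cat" "?i \<in> Ar delta_cat" "?h \<in> Ar delta_cat" "?g \<in> Ar delta_cat"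
    and A': "a' \<in> Ar delta_cat" "?i' \<in> Ar delta_cat" "?h' \<in> Ar delta_cat" "?g' \<in> Ar delta_cat"
    and sq: "Cmp delta_cat ?h a = Cmp delta_cat ?g ?i"
    using P P' by (auto simp: pushout_square_def arrow_in_def)
  have st: "src ?i = ?k" "tgt ?i = p + ?k + q" "src ?h = 0" "tgt ?h = p + q" "src ?g = p + ?k + q" "tgt ?g = p + q"
    "src ?i' = Suc ?k" "tgt ?i' = Suc (p + ?k + q)" "src ?h' = 1" "tgt ?h' = Suc (p + q)" "src ?g' = Suc (p + ?k + q)" "tgt ?g' = Suc (p + q)"
    by (simp_all add: pushout_inert_def pushout_active_def n a')
  \<comment> \<open>Insertion of a new vertex behind the vertex \<open>c\<close> of \<open>[l]\<close>, and its removal by collapsing the edge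
    from \<open>c\<close> to it.\<close>
  define s where "s c l = dmap l (\<lambda>j. if j \<le> c then j else Suc j) (Suc l)" for c l
  define r where "r c l = dmap (Suc l) (\<lambda>j. if j \<le> c then j else j - 1) l" for c l
  have sA: "s c l \<in> Ar delta_cat" for c l
    unfolding s_def by (rule dmap_in_Ar) auto
  have rA: "r c l \<in> Ar delta_cat" if "c \<le> l" for c l
    unfolding r_def by (rule dmap_in_Ar) (use that in auto)
  have sst: "src (s c l) = l" "tgt (s c l) = Suc l" "src (r c l) = Suc l" "tgt (r c l) = l" for c l
    by (simp_all add: s_def r_def)
  have rs: "Cmp delta_cat (r c l) (s c l) = dmap l (\<lambda>j. j) l" for c l
    by (auto simp: delta_Cmp s_def r_def intro!: dmap_eqI)
  have retr: "pull e (s c l) (pull e (r c l) x) = x" if "c \<le> l" "x \<in> topspace (level l e)" for c l x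
    using pull_comp[of "s c l" "r c l" x e] sA rA[OF that(1)] that by (simp add: sst rs pull_Idt)
  have cont: "continuous_map (level (tgt b) e) (level (src b) e) (pull e b)" if "b \<in> Ar delta_cat" for b
    by (rule continuous_map_pull[OF that])
  have cs: "continuous_map (level (Suc l) e) (level l e) (pull e (s c l))" for c l
    using cont[OF sA[of c l]] by (simp only: sst)
  have cr: "continuous_map (level l e) (level (Suc l) e) (pull e (r c l))" if "c \<le> l" for c l
    using cont[OF rA[OF that]] by (simp only: sst)
  have comm: "commuting_square (level (p + q) e) (level 0 e) (level (p + ?k + q) e) (level ?k e)
      (pull e ?h) (pull e ?g) (pull e a) (pull e ?i)"
    unfolding commuting_square_def
    using cont[OF A(1)] cont[OF A(2)] cont[OF A(3)] cont[OF A(4)] pull_square[OF sq A(1,3,2,4), of _ e] st n by simp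
  have S': "strict_hpb (level (Suc (p + q)) e) (level (Suc 0) e) (level (Suc (p + ?k + q)) e) (level (Suc ?k) e)
      (pull e ?h') (pull e ?g') (pull e a') (pull e ?i')"
    using S by (simp add: a'_def)
  have "strict_hpb (level (p + q) e) (level 0 e) (level (p + ?k + q) e) (level ?k e)
      (pull e ?h) (pull e ?g) (pull e a) (pull e ?i)"
  proof (rule strict_hpb_retract[OF S' comm,
        where iP = "pull e (r p (p + q))" and rP = "pull e (s p (p + q))"
          and iA = "pull e (r 0 0)" and rA = "pull e (s 0 0)"
          and iB = "pull e (r (p + ?k) (p + ?k + q))" and rB = "pull e (s (p + ?k) (p + ?k + q))"
          and iZ = "pull e (r ?k ?k)" and rZ = "pull e (s ?k ?k)"])
    show "pull e ?h' (pull e (r p (p + q)) x) = pull e (r 0 0) (pull e ?h x)" if "x \<in> topspace (level (p + q) e)" for x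
      by (rule pull_square) (use that A' A rA in \<open>auto simp: st sst delta_Cmp, auto simp: r_def pushout_inert_def intro!: dmap_eqI\<close>)
    show "pull e ?g' (pull e (r p (p + q)) x) = pull e (r (p + ?k) (p + ?k + q)) (pull e ?g x)" if "x \<in> topspace (level (p + q) e)" for x
      by (rule pull_square) (use that A' A rA in \<open>auto simp: st sst delta_Cmp, auto simp: r_def pushout_active_def a' n a0 a'0 intro!: dmap_eqI\<close>)
    show "pull e (r ?k ?k) (pull e a x) = pull e a' (pull e (r 0 0) x)" if "x \<in> topspace (level 0 e)" for x
      by (rule pull_square) (use that A' A rA in \<open>auto simp: st sst delta_Cmp n a', auto simp: r_def a0 a'0 intro!: dmap_eqI\<close>)
    show "pull e (r ?k ?k) (pull e ?i x) = pull e ?i' (pull e (r (p + ?k) (p + ?k + q)) x)" if "x \<in> topspace (level (p + ?k + q) e)" for x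
      by (rule pull_square) (use that A' A rA in \<open>auto simp: st sst delta_Cmp, auto simp: r_def pushout_inert_def intro!: dmap_eqI\<close>)
    show "pull e ?h (pull e (s p (p + q)) x) = pull e (s 0 0) (pull e ?h' x)" if "x \<in> topspace (level (Suc (p + q)) e)" for x
      by (rule pull_square) (use that A' A sA in \<open>auto simp: st sst delta_Cmp, auto simp: s_def pushout_inert_def intro!: dmap_eqI\<close>)
    show "pull e ?g (pull e (s p (p + q)) x) = pull e (s (p + ?k) (p + ?k + q)) (pull e ?g' x)" if "x \<in> topspace (level (Suc (p + q)) e)" for x
      by (rule pull_square) (use that A' A sA in \<open>auto simp: st sst delta_Cmp, auto simp: s_def pushout_active_def a' n a0 a'0 intro!: dmap_eqI\<close>)
    show "pull e (s ?k ?k) (pull e a' x) = pull e a (pull e (s 0 0) x)" if "x \<in> topspace (level (Suc 0) e)" for x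
      by (rule pull_square) (use that A' A sA in \<open>auto simp: st sst delta_Cmp n a', auto simp: s_def a0 a'0 intro!: dmap_eqI\<close>)
    show "pull e (s ?k ?k) (pull e ?i' x) = pull e ?i (pull e (s (p + ?k) (p + ?k + q)) x)" if "x \<in> topspace (level (Suc (p + ?k + q)) e)" for x
      by (rule pull_square) (use that A' A sA in \<open>auto simp: st sst delta_Cmp, auto simp: s_def pushout_inert_def intro!: dmap_eqI\<close>)
  qed (auto intro!: cs cr simp: retr)
  then show ?thesis by (simp add: n)
qed

end

theorem proposition3p2p1:
  fixes X Y :: "'a sspace" and F :: "'a smap"
  assumes "simplicial_space Y" and "simplicial_space X"
    and "simplicial_map Y X F"
    and "semi_ikeo Y X F"
    and "decomposition_space X"
  shows "decomposition_space Y"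
proof -
  have res: "restricts_to F False Y" "restricts_to F True X"
    using assms(3) by (auto simp: simplicial_map_def)
  interpret coherent_smap F
    by unfold_locales (use assms(3) in \<open>simp add: simplicial_map_def\<close>)
  let ?square = "\<lambda>e p a q. strict_hpb (level (p + tgt a + q) e) (level (tgt a) e) (level (p + src a + q) e) (level (src a) e)
      (pull e (pushout_inert p (tgt a) q)) (pull e (pushout_active p a q)) (pull e a) (pull e (pushout_inert p (src a) q))"
  have sends: "sends_to_pullback (opp_cat delta_cat) W (pushout_inert p (tgt a) q) a (pushout_active p a q) (pushout_inert p (src a) q)
      \<longleftrightarrow> ?square e p a q" if "active a" "restricts_to F e W" for e W p a q
    using pushout_square_canonical[OF that(1), of p q]
      sends_to_pullback_iff_level[OF that(2), of "pushout_inert p (tgt a) q" a "pushout_active p a q" "pushout_inert p (src a) q"]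
    by (auto simp: pushout_square_def arrow_in_def pushout_inert_def pushout_active_def)
  have X: "?square True p a q" if a: "active a" for p a q
  proof -
    have "inert (pushout_inert p (src a) q)"
      unfolding pushout_inert_def by (rule inert_dmap) simp
    then show ?thesis
      using assms(5) a pushout_square_canonical[OF a] sends[OF a res(2)] unfolding decomposition_space_def by blast
  qed
  have nondegenerate: "?square False p a q" if a: "active a" and n: "tgt a \<noteq> 0" for p a q
  proof (rule strict_hpb_from_blocks[OF a n _ X[OF a]])
    fix n :: nat assume n: "n \<noteq> 0"
    have "src (blocks p n q) = block_count p q" "tgt (blocks p n q) = p + n + q" by (simp_all add: blocks_def)
    moreover have "block_count p q \<noteq> 0" by (simp add: block_count_def main_block_def)
    ultimately show "strict_hpb (level (p + n + q) False) (level (p + n + q) True)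
      (product_topology (\<lambda>i. level (src (gam (blocks p n q) i)) False) {1..block_count p q})
      (product_topology (\<lambda>i. level (src (gam (blocks p n q) i)) True) {1..block_count p q})
      (cross (p + n + q)) (\<lambda>y. \<lambda>i\<in>{1..block_count p q}. pull False (gam (blocks p n q) i) y)
      (\<lambda>x. \<lambda>i\<in>{1..block_count p q}. pull True (gam (blocks p n q) i) x)
      (\<lambda>y. \<lambda>i\<in>{1..block_count p q}. cross (src (gam (blocks p n q) i)) (y i))"
      using semi_ikeo_strict[OF assms(4) res active_blocks[of p n q] inj_on_blocks[OF n, of p q]] n by simp
  qed
  have Y: "?square False p a q" if a: "active a" for p a q
  proof (cases "tgt a = 0")
    case True
    let ?a = "dmap (Suc (src a)) (\<lambda>j. if j \<le> src a then 0 else (1::nat)) 1"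
    have "active ?a" by (auto simp: active_def intro!: dmap_in_Ar)
    from nondegenerate[OF this, of p q] show ?thesis
      using strict_hpb_degenerate[OF a True, of p q False] by simp
  qed (rule nondegenerate[OF a])
  show ?thesis
    unfolding decomposition_space_def
  proof (intro allI impI, elim conjE)
    fix a i h k assume a: "active a" and i: "inert i" and P: "pushout_square delta_cat a i h k"
    obtain p q where "i = pushout_inert p (src a) q" "h = pushout_inert p (tgt a) q" "k = pushout_active p a q"
      using pushout_square_active_inert[OF a i P] .
    then show "sends_to_pullback (opp_cat delta_cat) Y h a k i"
      using Y[OF a] sends[OF a res(1)] by simp
  qed
qed

end
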